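(* The (completed) tensor product of two Våge spaces is also a Våge space: if $A,B\subseteq\mathbb N$ and $\mathcal F_a'$, $\mathcal F_b'$ are Våge spaces associated with functions $a:\ell_A\to\mathbb R$ and $b:\ell_B\to\mathbb R$, then $\mathcal F_a'\hat\otimes\mathcal F_b'$, viewed as a space of families of complex numbers indexed by $\ell_C$ with $C=2B\cup(2A-1)$, is a Våge space.
   Context: $\mathbb N=\{1,2,\dots\}$, $\mathbb N_0=\mathbb N\cup\{0\}$. For $A\subseteq\mathbb N$, $\ell_A=\mathbb N_0^{(A)}$ is the additive monoid of finitely supported functions $A\to\mathbb N_0$; $e_n$ ($n\in A$) is the element equal to $1$ at $n$ and $0$ elsewhere. A positive function $a:\ell_A\to\mathbb R$ ($a_\alpha>0$ for all $\alpha$) is admissible if $a_0=1$ and $a_{e_n}>1$ for all $n\in A$; an admissible $a$ is $d$-regular ($d\in\mathbb N$) if $\sum_{n\in A}\frac{1}{a_{e_n}^d-1}<\infty$. For $p\in\mathbb N$ let $\ell^2_{a^{-p}}=\{f=(f_\alpha)_{\alpha\in\ell_A}\in\mathbb C^{\ell_A}:\|f\|_p<\infty\}$ with $\|f\|_p=\big(\sum_{\alpha}|f_\alpha|^2a_\alpha^{-p}\big)^{1/2}$. $\mathcal F_a=\{(\varphi_\alpha):\sum_\alpha|\varphi_\alpha|^2a_\alpha^p<\infty\ \forall p\in\mathbb N\}$ is a Fréchet space with the norms $(\sum_\alpha|\varphi_\alpha|^2a_\alpha^p)^{1/2}$, and its strong dual is written $\mathcal F_a'=\bigcup_{p\in\mathbb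 N}\ell^2_{a^{-p}}$; it is called regular admissible if $a$ is admissible and $d$-regular for some $d\in\mathbb N$. The convolution of $f,g\in\mathbb C^{\ell_A}$ is $fg=\big(\sum_{\alpha+\beta=\gamma}f_\alpha g_\beta\big)_{\gamma\in\ell_A}$. A regular admissible space $\mathcal F_a'$ is a Våge space if there is $e\in\mathbb N$ and finite positive numbers $A(k)$, $k\ge e$, such that for all $q\in\mathbb N$ and all $p\ge q+e$, $\|fg\|_p\le A(p-q)\|f\|_q\|g\|_p$ for all $f\in\ell^2_{a^{-q}}$ and $g\in\ell^2_{a^{-p}}$. Våge spaces are nuclear; $\hat\otimes$ denotes the completed topological tensor product (the $\pi$- and $\epsilon$-completions coincide by nuclearity). Elements of the tensor product are viewed as families indexed by $\ell_A\times\ell_B$ ($f\otimes g$ corresponding to $(f_\alpha g_\beta)_{(\alpha,\beta)}$), and $\ell_A\times\ell_B$ is identified with $\ell_C$, where $2B=\{2n:n\in B\}$, $2A-1=\{2n-1:n\in A\}$, and $(\alpha,\beta)$ corresponds to $\gamma\in\ell_C$ with $\gamma_{2n-1}=\alpha_n$ for $n\in A$ and $\gamma_{2n}=\beta_n$ for $n\in B$. *)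

theory Defs
  imports "HOL-Analysis.Analysis" "HOL-Library.Poly_Mapping"
begin

section \<open>Locally convex spaces of families of complex numbers\<close>

text \<open>
  All spaces below are spaces of families of complex numbers, that is, linear subspaces of
  \<open>'i \<Rightarrow> complex\<close> under the pointwise operations. A topological vector space is given by a
  topology on such a subspace; the subspace is the \<^const>\<open>topspace\<close>.
\<close>

definition family_subspace :: "('i \<Rightarrow> complex) set \<Rightarrow> bool" where
  "family_subspace S \<longleftrightarrow>
     (\<lambda>_. 0) \<in> S \<and>
     (\<forall>x\<in>S. \<forall>y\<in>S. (\<lambda>i. x i + y i) \<in> S) \<and>
     (\<forall>c. \<forall>x\<in>S. (\<lambda>i. c * x i) \<in> S)"

definition seminorm_on :: "('i \<Rightarrow> complex) set \<Rightarrow> (('i \<Rightarrow> complex) \<Rightarrow> real) \<Rightarrow> bool" where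
  "seminorm_on S p \<longleftrightarrow>
     (\<forall>x\<in>S. 0 \<le> p x) \<and>
     (\<forall>c. \<forall>x\<in>S. p (\<lambda>i. c * x i) = cmod c * p x) \<and>
     (\<forall>x\<in>S. \<forall>y\<in>S. p (\<lambda>i. x i + y i) \<le> p x + p y)"

text \<open>Inserting \<open>S\<close> itself only matters for \<open>P = {}\<close>, where the topology is the indiscrete one.\<close>

definition seminorm_topology ::
    "('i \<Rightarrow> complex) set \<Rightarrow> (('i \<Rightarrow> complex) \<Rightarrow> real) set \<Rightarrow> ('i \<Rightarrow> complex) topology" where
  "seminorm_topology S P =
     topology_generated_by
       (insert S {{y \<in> S. p (\<lambda>i. y i - x i) < \<epsilon>} | x p \<epsilon>. x \<in> S \<and> p \<in> P \<and> 0 < \<epsilon>})"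

definition locally_convex :: "('i \<Rightarrow> complex) topology \<Rightarrow> bool" where
  "locally_convex T \<longleftrightarrow>
     family_subspace (topspace T) \<and>
     (\<exists>P. (\<forall>p\<in>P. seminorm_on (topspace T) p) \<and> T = seminorm_topology (topspace T) P)"

definition continuous_seminorms :: "('i \<Rightarrow> complex) topology \<Rightarrow> (('i \<Rightarrow> complex) \<Rightarrow> real) set" where
  "continuous_seminorms T =
     {p. seminorm_on (topspace T) p \<and> continuous_map T euclideanreal p}"

definition cauchy_filter_in :: "('i \<Rightarrow> complex) topology \<Rightarrow> ('i \<Rightarrow> complex) filter \<Rightarrow> bool" where
  "cauchy_filter_in T F \<longleftrightarrow>
     F \<noteq> bot \<and> F \<le> principal (topspace T) \<and>
     (\<forall>U. openin T U \<and> (\<lambda>_. 0) \<in> U \<longrightarrow>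
        (\<exists>M. eventually (\<lambda>x. x \<in> M) F \<and> (\<forall>x\<in>M. \<forall>y\<in>M. (\<lambda>i. x i - y i) \<in> U)))"

definition complete_tvs :: "('i \<Rightarrow> complex) topology \<Rightarrow> bool" where
  "complete_tvs T \<longleftrightarrow> (\<forall>F. cauchy_filter_in T F \<longrightarrow> (\<exists>x. limitin T (\<lambda>y. y) x F))"


section \<open>Completed tensor products\<close>

definition bilinear_families ::
    "('i \<Rightarrow> complex) set \<Rightarrow> ('j \<Rightarrow> complex) set \<Rightarrow>
     (('i \<Rightarrow> complex) \<Rightarrow> ('j \<Rightarrow> complex) \<Rightarrow> ('k \<Rightarrow> complex)) \<Rightarrow> bool" where
  "bilinear_families E F \<tau> \<longleftrightarrow>
     (\<forall>x\<in>E. \<forall>x'\<in>E. \<forall>y\<in>F. \<tau> (\<lambda>i. x i + x' i) y = (\<lambda>k. \<tau> x y k + \<tau> x' y k)) \<and>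
     (\<forall>x\<in>E. \<forall>y\<in>F. \<forall>y'\<in>F. \<tau> x (\<lambda>j. y j + y' j) = (\<lambda>k. \<tau> x y k + \<tau> x y' k)) \<and>
     (\<forall>c. \<forall>x\<in>E. \<forall>y\<in>F. \<tau> (\<lambda>i. c * x i) y = (\<lambda>k. c * \<tau> x y k)) \<and>
     (\<forall>c. \<forall>x\<in>E. \<forall>y\<in>F. \<tau> x (\<lambda>j. c * y j) = (\<lambda>k. c * \<tau> x y k))"

definition lin_indep :: "nat \<Rightarrow> (nat \<Rightarrow> 'i \<Rightarrow> complex) \<Rightarrow> bool" where
  "lin_indep n x \<longleftrightarrow> (\<forall>c. (\<lambda>i. \<Sum>m<n. c m * x m i) = (\<lambda>_. 0) \<longrightarrow> (\<forall>m<n. c m = 0))"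

definition tensor_span ::
    "('i \<Rightarrow> complex) set \<Rightarrow> ('j \<Rightarrow> complex) set \<Rightarrow>
     (('i \<Rightarrow> complex) \<Rightarrow> ('j \<Rightarrow> complex) \<Rightarrow> ('k \<Rightarrow> complex)) \<Rightarrow> ('k \<Rightarrow> complex) set" where
  "tensor_span E F \<tau> =
     {(\<lambda>k. \<Sum>m<n. \<tau> (x m) (y m) k) | (n::nat) x y. \<forall>m<n. x m \<in> E \<and> y m \<in> F}"

text \<open>
  \<open>(V, \<tau>)\<close> is an (algebraic) tensor product of \<open>E\<close> and \<open>F\<close>: \<open>\<tau>\<close> is bilinear, its image
  spans \<open>V\<close>, and \<open>E\<close> and \<open>F\<close> are \<open>\<tau>\<close>-linearly disjoint (Treves, Topological Vector Spaces,
  Distributions and Kernels, Definitions 39.1 and 39.2).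
\<close>

definition is_tensor_product ::
    "('i \<Rightarrow> complex) set \<Rightarrow> ('j \<Rightarrow> complex) set \<Rightarrow>
     (('i \<Rightarrow> complex) \<Rightarrow> ('j \<Rightarrow> complex) \<Rightarrow> ('k \<Rightarrow> complex)) \<Rightarrow> ('k \<Rightarrow> complex) set \<Rightarrow> bool" where
  "is_tensor_product E F \<tau> V \<longleftrightarrow>
     bilinear_families E F \<tau> \<and> V = tensor_span E F \<tau> \<and>
     (\<forall>n x y. (\<forall>m<n. x m \<in> E \<and> y m \<in> F) \<and> (\<lambda>k. \<Sum>m<n. \<tau> (x m) (y m) k) = (\<lambda>_. 0) \<longrightarrow>
        (lin_indep n x \<longrightarrow> (\<forall>m<n. y m = (\<lambda>_. 0))) \<and>
        (lin_indep n y \<longrightarrow> (\<forall>m<n. x m = (\<lambda>_. 0))))"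

definition proj_seminorm ::
    "('i \<Rightarrow> complex) set \<Rightarrow> ('j \<Rightarrow> complex) set \<Rightarrow>
     (('i \<Rightarrow> complex) \<Rightarrow> ('j \<Rightarrow> complex) \<Rightarrow> ('k \<Rightarrow> complex)) \<Rightarrow>
     (('i \<Rightarrow> complex) \<Rightarrow> real) \<Rightarrow> (('j \<Rightarrow> complex) \<Rightarrow> real) \<Rightarrow> ('k \<Rightarrow> complex) \<Rightarrow> real" where
  "proj_seminorm E F \<tau> p q u =
     Inf {(\<Sum>m<n. p (x m) * q (y m)) | (n::nat) x y.
            (\<forall>m<n. x m \<in> E \<and> y m \<in> F) \<and> u = (\<lambda>k. \<Sum>m<n. \<tau> (x m) (y m) k)}"

definition proj_topology ::
    "('i \<Rightarrow> complex) topology \<Rightarrow> ('j \<Rightarrow> complex) topology \<Rightarrow>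
     (('i \<Rightarrow> complex) \<Rightarrow> ('j \<Rightarrow> complex) \<Rightarrow> ('k \<Rightarrow> complex)) \<Rightarrow> ('k \<Rightarrow> complex) topology" where
  "proj_topology TE TF \<tau> =
     seminorm_topology (tensor_span (topspace TE) (topspace TF) \<tau>)
       {proj_seminorm (topspace TE) (topspace TF) \<tau> p q | p q.
          p \<in> continuous_seminorms TE \<and> q \<in> continuous_seminorms TF}"

text \<open>
  \<open>(TG, \<tau>)\<close> is the completed projective tensor product of \<open>TE\<close> and \<open>TF\<close>: a complete Hausdorff
  locally convex space that contains the algebraic tensor product, with its projective topology,
  as a dense topological subspace.
\<close>

definition is_completed_tensor_product ::
    "('i \<Rightarrow> complex) topology \<Rightarrow> ('j \<Rightarrow> complex) topology \<Rightarrow>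
     (('i \<Rightarrow> complex) \<Rightarrow> ('j \<Rightarrow> complex) \<Rightarrow> ('k \<Rightarrow> complex)) \<Rightarrow> ('k \<Rightarrow> complex) topology \<Rightarrow> bool" where
  "is_completed_tensor_product TE TF \<tau> TG \<longleftrightarrow>
     locally_convex TG \<and> Hausdorff_space TG \<and> complete_tvs TG \<and>
     (\<exists>V. is_tensor_product (topspace TE) (topspace TF) \<tau> V \<and>
          V \<subseteq> topspace TG \<and>
          subtopology TG V = proj_topology TE TF \<tau> \<and>
          TG closure_of V = topspace TG)"


section \<open>Admissible functions and the associated spaces\<close>

text \<open>
  Index sets \<open>A\<close> are sets of positive integers. Families indexed by \<open>ell A\<close> are functions on the
  type of all finitely supported exponents that vanish outside \<open>ell A\<close>; the values of a weight
  \<open>a\<close> outside \<open>ell A\<close> are irrelevant.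
\<close>

type_synonym mindex = "nat \<Rightarrow>\<^sub>0 nat"
type_synonym family = "mindex \<Rightarrow> complex"

definition ell :: "nat set \<Rightarrow> mindex set" where
  "ell A = {\<alpha>. Poly_Mapping.keys \<alpha> \<subseteq> A}"

definition families :: "nat set \<Rightarrow> family set" where
  "families A = {f. \<forall>\<alpha>. \<alpha> \<notin> ell A \<longrightarrow> f \<alpha> = 0}"

definition unit_index :: "nat \<Rightarrow> mindex" where
  "unit_index n = Poly_Mapping.single n 1"

definition admissible :: "nat set \<Rightarrow> (mindex \<Rightarrow> real) \<Rightarrow> bool" where
  "admissible A a \<longleftrightarrow>
     (\<forall>\<alpha>\<in>ell A. 0 < a \<alpha>) \<and> a 0 = 1 \<and> (\<forall>n\<in>A. 1 < a (unit_index n))"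

definition regular :: "nat set \<Rightarrow> (mindex \<Rightarrow> real) \<Rightarrow> nat \<Rightarrow> bool" where
  "regular A a d \<longleftrightarrow> (\<lambda>n. 1 / (a (unit_index n) ^ d - 1)) summable_on A"

definition l2_dual :: "nat set \<Rightarrow> (mindex \<Rightarrow> real) \<Rightarrow> nat \<Rightarrow> family set" where
  "l2_dual A a p = {f \<in> families A. (\<lambda>\<alpha>. (cmod (f \<alpha>))\<^sup>2 / a \<alpha> ^ p) summable_on ell A}"

definition dual_norm :: "nat set \<Rightarrow> (mindex \<Rightarrow> real) \<Rightarrow> nat \<Rightarrow> family \<Rightarrow> real" where
  "dual_norm A a p f = sqrt (\<Sum>\<^sub>\<infinity>\<alpha>\<in>ell A. (cmod (f \<alpha>))\<^sup>2 / a \<alpha> ^ p)"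

definition test_space :: "nat set \<Rightarrow> (mindex \<Rightarrow> real) \<Rightarrow> family set" where
  "test_space A a =
     {\<phi> \<in> families A. \<forall>p\<ge>1. (\<lambda>\<alpha>. (cmod (\<phi> \<alpha>))\<^sup>2 * a \<alpha> ^ p) summable_on ell A}"

definition test_norm :: "nat set \<Rightarrow> (mindex \<Rightarrow> real) \<Rightarrow> nat \<Rightarrow> family \<Rightarrow> real" where
  "test_norm A a p \<phi> = sqrt (\<Sum>\<^sub>\<infinity>\<alpha>\<in>ell A. (cmod (\<phi> \<alpha>))\<^sup>2 * a \<alpha> ^ p)"

definition bounded_in_test_space :: "nat set \<Rightarrow> (mindex \<Rightarrow> real) \<Rightarrow> family set \<Rightarrow> bool" where
  "bounded_in_test_space A a D \<longleftrightarrow>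
     D \<subseteq> test_space A a \<and> (\<forall>p\<ge>1. \<exists>K. \<forall>\<phi>\<in>D. test_norm A a p \<phi> \<le> K)"

definition dual_space :: "nat set \<Rightarrow> (mindex \<Rightarrow> real) \<Rightarrow> family set" where
  "dual_space A a = (\<Union>p\<in>{1..}. l2_dual A a p)"

definition pairing :: "nat set \<Rightarrow> family \<Rightarrow> family \<Rightarrow> complex" where
  "pairing A f \<phi> = (\<Sum>\<^sub>\<infinity>\<alpha>\<in>ell A. f \<alpha> * \<phi> \<alpha>)"

text \<open>
  The strong dual topology is the topology of uniform convergence on the bounded subsets of the
  test space; elements of the dual space act as functionals through \<^const>\<open>pairing\<close>.
\<close>

definition strong_dual :: "nat set \<Rightarrow> (mindex \<Rightarrow> real) \<Rightarrow> family topology" where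
  "strong_dual A a =
     seminorm_topology (dual_space A a)
       {(\<lambda>f. SUP \<phi>\<in>D. cmod (pairing A f \<phi>)) | D. D \<noteq> {} \<and> bounded_in_test_space A a D}"

definition convolution :: "nat set \<Rightarrow> family \<Rightarrow> family \<Rightarrow> family" where
  "convolution A f g =
     (\<lambda>\<gamma>. \<Sum>(\<alpha>, \<beta>) \<in> {(\<alpha>, \<beta>). \<alpha> \<in> ell A \<and> \<beta> \<in> ell A \<and> \<alpha> + \<beta> = \<gamma>}. f \<alpha> * g \<beta>)"

text \<open>
  The real-valued \<^const>\<open>dual_norm\<close> is \<open>0\<close> when the series diverges, so finiteness of the norm of
  the product is stated separately.
\<close>

definition vage_space :: "nat set \<Rightarrow> (mindex \<Rightarrow> real) \<Rightarrow> bool" where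
  "vage_space A a \<longleftrightarrow>
     admissible A a \<and> (\<exists>d\<ge>1. regular A a d) \<and>
     (\<exists>e\<ge>1. \<exists>M :: nat \<Rightarrow> real. (\<forall>k\<ge>e. 0 < M k) \<and>
        (\<forall>q\<ge>1. \<forall>p\<ge>q + e. \<forall>f\<in>l2_dual A a q. \<forall>g\<in>l2_dual A a p.
           convolution A f g \<in> l2_dual A a p \<and>
           dual_norm A a p (convolution A f g)
             \<le> M (p - q) * dual_norm A a q f * dual_norm A a p g))"


section \<open>Families indexed by pairs of multi-indices\<close>

definition joint_index :: "nat set \<Rightarrow> nat set \<Rightarrow> nat set" where
  "joint_index A B = (\<lambda>n. 2 * n) ` B \<union> (\<lambda>n. 2 * n - 1) ` A"

text \<open>
  \<open>odd_part \<gamma>\<close> and \<open>even_part \<gamma>\<close> are the components \<open>\<alpha>\<close>, \<open>\<beta>\<close> of the pair identified with \<open>\<gamma>\<close>.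
  On \<^typ>\<open>nat\<close> the map \<open>n \<mapsto> 2 * n - 1\<close> is injective because \<open>0 \<mapsto> 0\<close>; the index \<open>0\<close> never
  occurs in the support.
\<close>

definition odd_part :: "mindex \<Rightarrow> mindex" where
  "odd_part = Poly_Mapping.map_key (\<lambda>n. 2 * n - 1)"

definition even_part :: "mindex \<Rightarrow> mindex" where
  "even_part = Poly_Mapping.map_key (\<lambda>n. 2 * n)"

lemma lookup_odd_part: "Poly_Mapping.lookup (odd_part \<gamma>) n = Poly_Mapping.lookup \<gamma> (2 * n - 1)"
proof -
  have "inj (\<lambda>n::nat. 2 * n - 1)"
    by (auto simp: inj_def)
  then show ?thesis
    by (simp add: odd_part_def map_key.rep_eq)
qed

lemma lookup_even_part: "Poly_Mapping.lookup (even_part \<gamma>) n = Poly_Mapping.lookup \<gamma> (2 * n)"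
  by (simp add: even_part_def map_key.rep_eq inj_def)

definition tensor :: "nat set \<Rightarrow> nat set \<Rightarrow> family \<Rightarrow> family \<Rightarrow> family" where
  "tensor A B f g =
     (\<lambda>\<gamma>. if \<gamma> \<in> ell (joint_index A B) then f (odd_part \<gamma>) * g (even_part \<gamma>) else 0)"

lemma bij_betw_ell_joint_index:
  assumes "A \<subseteq> {1..}" "B \<subseteq> {1..}"
  shows "bij_betw (\<lambda>\<gamma>. (odd_part \<gamma>, even_part \<gamma>)) (ell (joint_index A B)) (ell A \<times> ell B)"
proof -
  let ?h = "\<lambda>\<gamma>. (odd_part \<gamma>, even_part \<gamma>)"
  have odd: "n \<in> A" if J: "2 * n - 1 \<in> joint_index A B" for n
  proof -
    consider m where "m \<in> B" "2 * n - 1 = 2 * m" | m where "m \<in> A" "2 * n - 1 = 2 * m - 1"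
      using J unfolding joint_index_def by blast
    then show ?thesis
    proof cases
      case 1
      then have "m = 0" by presburger
      then show ?thesis using 1 assms by auto
    next
      case 2
      then have "n = m \<or> m = 0" by presburger
      then show ?thesis using 2 assms by auto
    qed
  qed
  have even: "n \<in> B" if J: "2 * n \<in> joint_index A B" for n
  proof -
    consider m where "m \<in> B" "2 * n = 2 * m" | m where "m \<in> A" "2 * n = 2 * m - 1"
      using J unfolding joint_index_def by blast
    then show ?thesis
    proof cases
      case 2
      then have "m = 0" by presburger
      then show ?thesis using 2 assms by auto
    qed auto
  qed
  have "?h \<gamma> \<in> ell A \<times> ell B" if "\<gamma> \<in> ell (joint_index A B)" for \<gamma>
    using that odd even
    by (auto simp: ell_def subset_iff in_keys_iff lookup_odd_part lookup_even_part)
  moreover have "inj_on ?h (ell (joint_index A B))"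
  proof (rule inj_onI)
    fix \<gamma> \<delta> assume eq: "?h \<gamma> = ?h \<delta>"
    show "\<gamma> = \<delta>"
    proof (rule poly_mapping_eqI)
      fix k :: nat
      have "k = 2 * (k div 2) \<or> k = 2 * ((k + 1) div 2) - 1" by presburger
      then show "Poly_Mapping.lookup \<gamma> k = Poly_Mapping.lookup \<delta> k"
        using eq by (metis lookup_even_part lookup_odd_part prod.inject)
    qed
  qed
  moreover have "\<exists>\<gamma>\<in>ell (joint_index A B). ?h \<gamma> = (\<alpha>, \<beta>)"
    if \<alpha>: "\<alpha> \<in> ell A" and \<beta>: "\<beta> \<in> ell B" for \<alpha> \<beta>
  proof -
    have 0: "Poly_Mapping.lookup \<alpha> 0 = 0" "Poly_Mapping.lookup \<beta> 0 = 0"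
      using \<alpha> \<beta> assms by (auto simp: ell_def subset_iff in_keys_iff)
    let ?g = "\<lambda>k. if even k then Poly_Mapping.lookup \<beta> (k div 2)
                   else Poly_Mapping.lookup \<alpha> ((k + 1) div 2)"
    have supp: "k \<in> (\<lambda>n. 2 * n) ` Poly_Mapping.keys \<beta> \<union> (\<lambda>n. 2 * n - 1) ` Poly_Mapping.keys \<alpha>"
      if "?g k \<noteq> 0" for k
    proof (cases "even k")
      case True
      then show ?thesis using that by (auto simp: in_keys_iff intro!: image_eqI[of _ _ "k div 2"])
    next
      case False
      then show ?thesis
        using that by (intro UnI2 image_eqI[of _ _ "(k + 1) div 2"]) (auto simp: in_keys_iff)
    qed
    have fin: "finite {k. ?g k \<noteq> 0}"
      by (rule finite_subset[of _ "(\<lambda>n. 2 * n) ` Poly_Mapping.keys \<beta> \<union>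
             (\<lambda>n. 2 * n - 1) ` Poly_Mapping.keys \<alpha>"]) (use supp in blast, simp)
    define \<gamma> where "\<gamma> = Abs_poly_mapping ?g"
    have g: "Poly_Mapping.lookup \<gamma> = ?g"
      unfolding \<gamma>_def using fin by (rule lookup_Abs_poly_mapping)
    have "\<gamma> \<in> ell (joint_index A B)"
    proof -
      have "k \<in> joint_index A B" if "k \<in> Poly_Mapping.keys \<gamma>" for k
      proof -
        have "?g k \<noteq> 0" using that unfolding in_keys_iff g .
        from supp[OF this] show ?thesis
          using \<alpha> \<beta> unfolding joint_index_def ell_def by blast
      qed
      then show ?thesis by (auto simp: ell_def)
    qed
    moreover have "odd_part \<gamma> = \<alpha>"
    proof (rule poly_mapping_eqI)
      fix n show "Poly_Mapping.lookup (odd_part \<gamma>) n = Poly_Mapping.lookup \<alpha> n"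
        by (cases n) (simp_all add: lookup_odd_part g 0)
    qed
    moreover have "even_part \<gamma> = \<beta>"
      by (rule poly_mapping_eqI) (simp add: lookup_even_part g)
    ultimately show ?thesis by blast
  qed
  ultimately show ?thesis
    unfolding bij_betw_def by (intro conjI) (assumption, fastforce)
qed

lemma finite_convolution_index:
  "finite {(\<alpha>, \<beta>). \<alpha> \<in> ell A \<and> \<beta> \<in> ell A \<and> \<alpha> + \<beta> = \<gamma>}"
proof (rule finite_subset)
  let ?K = "Poly_Mapping.keys \<gamma>"
  let ?P = "\<Pi>\<^sub>E n\<in>?K. {..Poly_Mapping.lookup \<gamma> n}"
  let ?S = "{\<alpha>. \<forall>n. Poly_Mapping.lookup \<alpha> n \<le> Poly_Mapping.lookup \<gamma> n}"
  show "{(\<alpha>, \<beta>). \<alpha> \<in> ell A \<and> \<beta> \<in> ell A \<and> \<alpha> + \<beta> = \<gamma>} \<subseteq> ?S \<times> ?S"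
    by (auto simp: lookup_add)
  have "inj_on (\<lambda>\<alpha>. restrict (Poly_Mapping.lookup \<alpha>) ?K) ?S"
  proof (rule inj_onI)
    fix \<alpha> \<beta> assume h: "\<alpha> \<in> ?S" "\<beta> \<in> ?S"
      "restrict (Poly_Mapping.lookup \<alpha>) ?K = restrict (Poly_Mapping.lookup \<beta>) ?K"
    show "\<alpha> = \<beta>"
    proof (rule poly_mapping_eqI)
      fix n show "Poly_Mapping.lookup \<alpha> n = Poly_Mapping.lookup \<beta> n"
      proof (cases "n \<in> ?K")
        case True
        then show ?thesis using fun_cong[OF h(3), of n] by simp
      next
        case False
        then have "Poly_Mapping.lookup \<gamma> n = 0" by (simp add: in_keys_iff)
        then show ?thesis using h(1,2) by (metis le_zero_eq mem_Collect_eq)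
      qed
    qed
  qed
  moreover have "(\<lambda>\<alpha>. restrict (Poly_Mapping.lookup \<alpha>) ?K) ` ?S \<subseteq> ?P"
    by auto
  moreover have "finite ?P" by (intro finite_PiE) auto
  ultimately have "finite ?S" by (meson finite_imageD finite_subset)
  then show "finite (?S \<times> ?S)" by simp
qed

end

theory Submission
  imports Defs
begin

text \<open>
  A regular admissible space is a Vage space exactly when its weight is superexponential,
  \<open>a \<alpha> * a \<beta> \<le> a (\<alpha> + \<beta>)\<close>: testing Vage's inequality on basis vectors and letting \<open>p\<close> tend to
  infinity with \<open>p - q\<close> fixed gives one direction, Young's inequality the other. Both
  superexponentiality and regularity pass to the product weight \<open>c (\<alpha>, \<beta>) = a \<alpha> * b \<beta>\<close>.
  Since \<open>1 / a ^ d\<close> is summable, the strong dual topology is generated by the norms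
  \<open>\<Sum>\<alpha>. \<bar>f \<alpha>\<bar> * w \<alpha>\<close> with \<open>w\<close> decreasing faster than every power of \<open>1 / a\<close>; rapidly
  decreasing weights on pairs are cofinally products \<open>u \<alpha> * v \<beta>\<close>, and the projective norm of two
  weighted \<open>l\<^sup>1\<close> norms is the \<open>l\<^sup>1\<close> norm of the product weight.
\<close>

section \<open>Seminorm topologies\<close>

text \<open>Vage's inequality does not pass formally to families on pairs, because a general family
  there is not an elementary tensor. Superexponentiality is a pointwise inequality between positive
  numbers, so the inequalities for the two weights can simply be multiplied; this is the reason for
  the detour through it. Regularity enters through an Euler product, which makes
  \<open>1 / a ^ d\<close> summable over all of \<open>ell A\<close>. On the topological side, both
  topologies to be compared have unwieldy seminorms: suprema over bounded sets of test functions for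
  the strong dual, infima over all representations for the projective tensor product. They are not
  matched one by one with weighted l1 norms; only mutual domination is proved, which suffices for
  equality of topologies. The l2 norms of the definitions are traded for l1 norms and sup bounds at
  the price of a shift of the exponent by \<open>d\<close>.\<close>

lemma family_subspace_zero: "family_subspace S \<Longrightarrow> (\<lambda>_. 0) \<in> S"
  by (simp add: family_subspace_def)

lemma family_subspace_add:
  "family_subspace S \<Longrightarrow> x \<in> S \<Longrightarrow> y \<in> S \<Longrightarrow> (\<lambda>i. x i + y i) \<in> S"
  by (simp add: family_subspace_def)

lemma family_subspace_scale:
  "family_subspace S \<Longrightarrow> x \<in> S \<Longrightarrow> (\<lambda>i. c * x i) \<in> S"
  by (simp add: family_subspace_def)

lemma family_subspace_diff:
  assumes "family_subspace S" "x \<in> S" "y \<in> S"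
  shows "(\<lambda>i. x i - y i) \<in> S"
  using family_subspace_add[OF assms(1,2) family_subspace_scale[OF assms(1,3), of "-1"]] by simp

lemma family_subspace_sum:
  assumes "family_subspace S" "finite I" "\<And>m. m \<in> I \<Longrightarrow> f m \<in> S"
  shows "(\<lambda>i. \<Sum>m\<in>I. f m i) \<in> S"
  using assms(2,3)
proof (induction I rule: finite_induct)
  case empty
  then show ?case using assms(1) by (simp add: family_subspace_def)
next
  case (insert a I)
  have "(\<lambda>i. f a i + (\<Sum>m\<in>I. f m i)) \<in> S"
    by (rule family_subspace_add[OF assms(1)]) (use insert in auto)
  then show ?case using insert by simp
qed

lemma seminorm_on_nonneg: "seminorm_on S p \<Longrightarrow> x \<in> S \<Longrightarrow> 0 \<le> p x"
  by (simp add: seminorm_on_def)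

lemma seminorm_on_scale:
  "seminorm_on S p \<Longrightarrow> x \<in> S \<Longrightarrow> p (\<lambda>i. c * x i) = cmod c * p x"
  by (simp add: seminorm_on_def)

lemma seminorm_on_add:
  "seminorm_on S p \<Longrightarrow> x \<in> S \<Longrightarrow> y \<in> S \<Longrightarrow> p (\<lambda>i. x i + y i) \<le> p x + p y"
  by (simp add: seminorm_on_def)

lemma seminorm_on_zero:
  assumes "family_subspace S" "seminorm_on S p"
  shows "p (\<lambda>_. 0) = 0"
  using seminorm_on_scale[OF assms(2) family_subspace_zero[OF assms(1)], of 0] by simp

lemma seminorm_on_triangle:
  assumes "family_subspace S" "seminorm_on S p" "x \<in> S" "y \<in> S" "z \<in> S"
  shows "p (\<lambda>i. x i - z i) \<le> p (\<lambda>i. x i - y i) + p (\<lambda>i. y i - z i)"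
proof -
  have "p (\<lambda>i. (x i - y i) + (y i - z i)) \<le> p (\<lambda>i. x i - y i) + p (\<lambda>i. y i - z i)"
    by (rule seminorm_on_add[OF assms(2)]) (use family_subspace_diff[OF assms(1)] assms in auto)
  then show ?thesis by simp
qed

lemma seminorm_on_minus_commute:
  assumes "family_subspace S" "seminorm_on S p" "x \<in> S" "y \<in> S"
  shows "p (\<lambda>i. x i - y i) = p (\<lambda>i. y i - x i)"
proof -
  have "p (\<lambda>i. (-1) * (y i - x i)) = cmod (-1) * p (\<lambda>i. y i - x i)"
    by (rule seminorm_on_scale[OF assms(2)]) (use family_subspace_diff[OF assms(1)] assms in auto)
  then show ?thesis by (simp add: algebra_simps)
qed

lemma seminorm_on_subset: "seminorm_on S p \<Longrightarrow> V \<subseteq> S \<Longrightarrow> seminorm_on V p"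
  unfolding seminorm_on_def by blast

lemma topspace_seminorm_topology [simp]: "topspace (seminorm_topology S P) = S"
  unfolding seminorm_topology_def by auto

text \<open>\<open>U\<close> is the union of the generating balls that it contains, since a ball
  contains its centre. The converse is where directedness comes in.\<close>

lemma openin_seminorm_topologyI:
  assumes S: "family_subspace S" and P: "\<forall>p\<in>P. seminorm_on S p"
    and U: "U \<subseteq> S"
    and ball: "\<And>x. x \<in> U \<Longrightarrow> \<exists>p\<in>P. \<exists>\<epsilon>>0. {y \<in> S. p (\<lambda>i. y i - x i) < \<epsilon>} \<subseteq> U"
  shows "openin (seminorm_topology S P) U"
proof -
  let ?K = "{{y \<in> S. p (\<lambda>i. y i - x i) < \<epsilon>} | x p \<epsilon>. x \<in> S \<and> p \<in> P \<and> 0 < \<epsilon> \<and>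
              {y \<in> S. p (\<lambda>i. y i - x i) < \<epsilon>} \<subseteq> U}"
  have "openin (seminorm_topology S P) (\<Union>?K)"
    by (intro openin_Union) (auto simp: seminorm_topology_def intro!: topology_generated_by_Basis)
  moreover have "\<Union>?K = U"
  proof
    show "U \<subseteq> \<Union>?K"
    proof
      fix x assume x: "x \<in> U"
      from ball[OF x] obtain p \<epsilon> where p: "p \<in> P" "\<epsilon> > 0" "{y \<in> S. p (\<lambda>i. y i - x i) < \<epsilon>} \<subseteq> U"
        by blast
      have "x \<in> {y \<in> S. p (\<lambda>i. y i - x i) < \<epsilon>}"
        using x U p seminorm_on_zero[OF S P[rule_format, OF p(1)]] by auto
      moreover have "{y \<in> S. p (\<lambda>i. y i - x i) < \<epsilon>} \<in> ?K"
        using x U p by blast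
      ultimately show "x \<in> \<Union>?K" by blast
    qed
  qed blast
  ultimately show ?thesis by simp
qed

text \<open>Triangle inequality around an inner point \<open>y\<close>. It serves with
  \<open>q = p\<close>, to see that balls are open, and with a larger \<open>q\<close>, to compare
  two families.\<close>

lemma seminorm_ball_subset:
  assumes S: "family_subspace S" and p: "seminorm_on S p"
    and dom: "\<And>z. z \<in> S \<Longrightarrow> p z \<le> q z"
    and x: "x \<in> S" and y: "y \<in> S"
  shows "{z \<in> S. q (\<lambda>i. z i - y i) < \<epsilon> - p (\<lambda>i. y i - x i)} \<subseteq> {z \<in> S. p (\<lambda>i. z i - x i) < \<epsilon>}"
proof
  fix z assume z: "z \<in> {z \<in> S. q (\<lambda>i. z i - y i) < \<epsilon> - p (\<lambda>i. y i - x i)}"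
  then have "p (\<lambda>i. z i - x i) \<le> p (\<lambda>i. z i - y i) + p (\<lambda>i. y i - x i)"
    using seminorm_on_triangle[OF S p] x y by blast
  moreover have "p (\<lambda>i. z i - y i) \<le> q (\<lambda>i. z i - y i)"
    using dom family_subspace_diff[OF S] z y by blast
  ultimately show "z \<in> {z \<in> S. p (\<lambda>i. z i - x i) < \<epsilon>}" using z by auto
qed

text \<open>Directedness makes the balls of single seminorms a neighbourhood base rather than only a
  subbase. The family has to be nonempty because for \<open>{}\<close> the topology is indiscrete
  and there is no ball around the points of \<open>S\<close>.\<close>

definition directed_seminorms :: "('i \<Rightarrow> complex) set \<Rightarrow> (('i \<Rightarrow> complex) \<Rightarrow> real) set \<Rightarrow> bool" where
  "directed_seminorms S P \<longleftrightarrow>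
     family_subspace S \<and> (\<forall>p\<in>P. seminorm_on S p) \<and> P \<noteq> {} \<and>
     (\<forall>p\<in>P. \<forall>q\<in>P. \<exists>r\<in>P. \<forall>x\<in>S. p x \<le> r x \<and> q x \<le> r x)"

lemma openin_seminorm_topology:
  assumes D: "directed_seminorms S P"
  shows "openin (seminorm_topology S P) U \<longleftrightarrow>
     U \<subseteq> S \<and> (\<forall>x\<in>U. \<exists>p\<in>P. \<exists>\<epsilon>>0. {y \<in> S. p (\<lambda>i. y i - x i) < \<epsilon>} \<subseteq> U)" (is "?L \<longleftrightarrow> ?R U")
proof -
  note S = D[unfolded directed_seminorms_def, THEN conjunct1]
    and P = D[unfolded directed_seminorms_def, THEN conjunct2, THEN conjunct1]
  note ne = D[unfolded directed_seminorms_def, THEN conjunct2, THEN conjunct2, THEN conjunct1]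
    and dir = D[unfolded directed_seminorms_def, THEN conjunct2, THEN conjunct2, THEN conjunct2]
  show ?thesis
  proof
    assume ?L
    then have "generate_topology_on
        (insert S {{y \<in> S. p (\<lambda>i. y i - x i) < \<epsilon>} | x p \<epsilon>. x \<in> S \<and> p \<in> P \<and> 0 < \<epsilon>}) U"
      unfolding seminorm_topology_def by (rule openin_topology_generated_by)
    then show "?R U"
    proof induction
      case Empty
      then show ?case by simp
    next
      \<comment> \<open>The step that calls for a common dominating seminorm: its balls fit into
        both sets.\<close>
      case (Int U V)
      have "\<exists>p\<in>P. \<exists>\<epsilon>>0. {y \<in> S. p (\<lambda>i. y i - x i) < \<epsilon>} \<subseteq> U \<inter> V" if x: "x \<in> U \<inter> V" for x
      proof -
        obtain p \<epsilon> where p: "p \<in> P" "\<epsilon> > 0" "{y \<in> S. p (\<lambda>i. y i - x i) < \<epsilon>} \<subseteq> U"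
          using Int x by blast
        obtain q \<delta> where q: "q \<in> P" "\<delta> > 0" "{y \<in> S. q (\<lambda>i. y i - x i) < \<delta>} \<subseteq> V"
          using Int x by blast
        obtain r where r: "r \<in> P" "\<forall>x\<in>S. p x \<le> r x \<and> q x \<le> r x"
          using dir p q by blast
        have "{y \<in> S. r (\<lambda>i. y i - x i) < min \<epsilon> \<delta>} \<subseteq> U \<inter> V"
        proof
          fix y assume y: "y \<in> {y \<in> S. r (\<lambda>i. y i - x i) < min \<epsilon> \<delta>}"
          then have "(\<lambda>i. y i - x i) \<in> S"
            using family_subspace_diff[OF S] Int x by blast
          then have "p (\<lambda>i. y i - x i) \<le> r (\<lambda>i. y i - x i)" "q (\<lambda>i. y i - x i) \<le> r (\<lambda>i. y i - x i)"
            using r by auto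
          then show "y \<in> U \<inter> V" using y p q by auto
        qed
        then show ?thesis using r p q by (meson min_less_iff_conj)
      qed
      then show ?case using Int by blast
    next
      case (UN K)
      then show ?case by (meson Sup_least Union_iff Sup_upper subset_trans)
    next
      case (Basis U)
      then consider "U = S" | x p \<epsilon> where "U = {y \<in> S. p (\<lambda>i. y i - x i) < \<epsilon>}" "x \<in> S" "p \<in> P" "0 < \<epsilon>"
        by blast
      then show ?case
      proof cases
        case 1
        obtain p where "p \<in> P" using ne by blast
        then show ?thesis using 1 by (intro conjI ballI bexI[of _ p] exI[of _ 1]) auto
      next
        case 2
        have "\<exists>p'\<in>P. \<exists>\<delta>>0. {z \<in> S. p' (\<lambda>i. z i - y i) < \<delta>} \<subseteq> U" if y: "y \<in> U" for y
          using seminorm_ball_subset[OF S P[rule_format, OF 2(3)], of p x y \<epsilon>] 2 y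
          by (intro bexI[of _ p] exI[of _ "\<epsilon> - p (\<lambda>i. y i - x i)"]) auto
        then show ?thesis using 2 by auto
      qed
    qed
  next
    assume "?R U"
    then show ?L by (intro openin_seminorm_topologyI[OF S P]) auto
  qed
qed

text \<open>Stated for arbitrary families, because the seminorms from bounded sets and the
  projective seminorms are compared without showing that they are directed. It is enough that the
  generating balls of \<open>P\<close> are open for \<open>Q\<close>.\<close>

lemma openin_seminorm_topology_dominated:
  assumes S: "family_subspace S"
    and P: "\<forall>p\<in>P. seminorm_on S p" and Q: "\<forall>q\<in>Q. seminorm_on S q"
    and dom: "\<forall>p\<in>P. \<exists>q\<in>Q. \<forall>x\<in>S. p x \<le> q x"
    and U: "openin (seminorm_topology S P) U"
  shows "openin (seminorm_topology S Q) U"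
proof (rule generate_topology_on_coarsest[OF istopology_openin _
      openin_topology_generated_by[OF U[unfolded seminorm_topology_def]]])
  fix U assume "U \<in> insert S {{y \<in> S. p (\<lambda>i. y i - x i) < \<epsilon>} | x p \<epsilon>. x \<in> S \<and> p \<in> P \<and> 0 < \<epsilon>}"
  then consider "U = S" | x p \<epsilon> where "U = {y \<in> S. p (\<lambda>i. y i - x i) < \<epsilon>}" "x \<in> S" "p \<in> P" "0 < \<epsilon>"
    by blast
  then show "openin (seminorm_topology S Q) U"
  proof cases
    case 1
    then show ?thesis by (metis openin_topspace topspace_seminorm_topology)
  next
    case 2
    obtain q where q: "q \<in> Q" "\<forall>x\<in>S. p x \<le> q x" using dom 2 by blast
    show ?thesis
    proof (rule openin_seminorm_topologyI[OF S Q])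
      fix y assume y: "y \<in> U"
      show "\<exists>q\<in>Q. \<exists>\<delta>>0. {z \<in> S. q (\<lambda>i. z i - y i) < \<delta>} \<subseteq> U"
        using seminorm_ball_subset[OF S P[rule_format, OF 2(3)], of q x y \<epsilon>] 2 y q
        by (intro bexI[of _ q] exI[of _ "\<epsilon> - p (\<lambda>i. y i - x i)"]) auto
    qed (use 2 in auto)
  qed
qed

lemma seminorm_topology_eqI:
  assumes "family_subspace S"
    and "\<forall>p\<in>P. seminorm_on S p" and "\<forall>q\<in>Q. seminorm_on S q"
    and "\<forall>p\<in>P. \<exists>q\<in>Q. \<forall>x\<in>S. p x \<le> q x"
    and "\<forall>q\<in>Q. \<exists>p\<in>P. \<forall>x\<in>S. q x \<le> p x"
  shows "seminorm_topology S P = seminorm_topology S Q"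
  unfolding topology_eq
  using openin_seminorm_topology_dominated[OF assms(1,2,3,4)]
    openin_seminorm_topology_dominated[OF assms(1,3,2,5)] by blast

lemma directed_seminorms_subspace:
  assumes "directed_seminorms S P" "family_subspace V" "V \<subseteq> S"
  shows "directed_seminorms V P"
  unfolding directed_seminorms_def
proof (intro conjI ballI)
  fix p q assume "p \<in> P" "q \<in> P"
  then obtain r where "r \<in> P" "\<forall>x\<in>S. p x \<le> r x \<and> q x \<le> r x"
    using assms(1) unfolding directed_seminorms_def by blast
  then show "\<exists>r\<in>P. \<forall>x\<in>V. p x \<le> r x \<and> q x \<le> r x" using assms(3) by blast
qed (use assms in \<open>auto simp: directed_seminorms_def intro: seminorm_on_subset\<close>)

text \<open>A ball in \<open>V\<close> is the trace of the ball in \<open>S\<close> with the same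
  centre, seminorm and radius, so the subspace topology is given by the same seminorms.\<close>

lemma subtopology_seminorm_topology:
  assumes D: "directed_seminorms S P" and V: "family_subspace V" "V \<subseteq> S"
  shows "subtopology (seminorm_topology S P) V = seminorm_topology V P"
proof -
  note S = D[unfolded directed_seminorms_def, THEN conjunct1]
    and P = D[unfolded directed_seminorms_def, THEN conjunct2, THEN conjunct1]
  note openS = openin_seminorm_topology[OF D]
    and openV = openin_seminorm_topology[OF directed_seminorms_subspace[OF D V]]
  show ?thesis
    unfolding topology_eq
  proof (intro allI iffI)
    fix U assume "openin (subtopology (seminorm_topology S P) V) U"
    then obtain T where T: "openin (seminorm_topology S P) T" "U = T \<inter> V"
      unfolding openin_subtopology by blast
    have "\<exists>p\<in>P. \<exists>\<epsilon>>0. {y \<in> V. p (\<lambda>i. y i - x i) < \<epsilon>} \<subseteq> U" if "x \<in> U" for x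
    proof -
      have "x \<in> T" using that T by blast
      then obtain p \<epsilon> where "p \<in> P" "\<epsilon> > 0" "{y \<in> S. p (\<lambda>i. y i - x i) < \<epsilon>} \<subseteq> T"
        using T(1) openS by blast
      then show ?thesis using T(2) V(2) by blast
    qed
    then show "openin (seminorm_topology V P) U"
      unfolding openV using T(2) by (intro conjI ballI) auto
  next
    fix U assume U: "openin (seminorm_topology V P) U"
    \<comment> \<open>Each ball of \<open>V\<close> inside \<open>U\<close> is enlarged to the ball
      of \<open>S\<close> with the same data; the union of these meets \<open>V\<close> exactly in
      \<open>U\<close>.\<close>
    define K where "K = {{y \<in> S. p (\<lambda>i. y i - x i) < \<epsilon>} | x p \<epsilon>. x \<in> U \<and> p \<in> P \<and> 0 < \<epsilon> \<and>
              {y \<in> V. p (\<lambda>i. y i - x i) < \<epsilon>} \<subseteq> U}"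
    have UV: "U \<subseteq> V" using U openV by blast
    have "openin (seminorm_topology S P) (\<Union>K)"
    proof (rule openin_Union)
      fix W assume "W \<in> K"
      then have "W \<in> {{y \<in> S. p (\<lambda>i. y i - x i) < \<epsilon>} | x p \<epsilon>. x \<in> S \<and> p \<in> P \<and> 0 < \<epsilon>}"
        using UV V(2) unfolding K_def by blast
      then show "openin (seminorm_topology S P) W"
        unfolding seminorm_topology_def by (intro topology_generated_by_Basis) blast
    qed
    moreover have "U = \<Union>K \<inter> V"
    proof
      show "\<Union>K \<inter> V \<subseteq> U" unfolding K_def by blast
      show "U \<subseteq> \<Union>K \<inter> V"
      proof
        fix x assume x: "x \<in> U"
        then obtain p \<epsilon> where p: "p \<in> P" "\<epsilon> > 0" "{y \<in> V. p (\<lambda>i. y i - x i) < \<epsilon>} \<subseteq> U"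
          using U openV by blast
        have "x \<in> {y \<in> S. p (\<lambda>i. y i - x i) < \<epsilon>}"
          using x UV V(2) p seminorm_on_zero[OF S P[rule_format, OF p(1)]] by auto
        moreover have "{y \<in> S. p (\<lambda>i. y i - x i) < \<epsilon>} \<in> K"
          unfolding K_def using x p by blast
        ultimately show "x \<in> \<Union>K \<inter> V" using x UV by blast
      qed
    qed
    ultimately show "openin (subtopology (seminorm_topology S P) V) U"
      unfolding openin_subtopology by blast
  qed
qed

text \<open>Continuity at 0 puts a \<open>p\<close>-ball of some radius \<epsilon> inside the unit
  ball of \<open>s\<close>; homogeneity turns this into a bound everywhere.\<close>

lemma continuous_seminorm_dominated:
  assumes D: "directed_seminorms S P"
    and s: "s \<in> continuous_seminorms (seminorm_topology S P)"
  shows "\<exists>p\<in>P. \<exists>K>0. \<forall>x\<in>S. s x \<le> K * p x"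
proof -
  note S = D[unfolded directed_seminorms_def, THEN conjunct1]
    and P = D[unfolded directed_seminorms_def, THEN conjunct2, THEN conjunct1]
  have sn: "seminorm_on S s" and cont: "continuous_map (seminorm_topology S P) euclideanreal s"
    using s unfolding continuous_seminorms_def by auto
  have z: "(\<lambda>_. 0) \<in> S" using S by (simp add: family_subspace_def)
  have "openin (seminorm_topology S P) {x \<in> topspace (seminorm_topology S P). s x \<in> {..<1}}"
    by (rule openin_continuous_map_preimage[OF cont]) auto
  then have "openin (seminorm_topology S P) {x \<in> S. s x < 1}" by simp
  moreover have "(\<lambda>_. 0) \<in> {x \<in> S. s x < 1}"
    using z seminorm_on_zero[OF S sn] by simp
  ultimately have "\<exists>p\<in>P. \<exists>\<epsilon>>0. {y \<in> S. p (\<lambda>i. y i - 0) < \<epsilon>} \<subseteq> {x \<in> S. s x < 1}"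
    unfolding openin_seminorm_topology[OF D] by (elim conjE) (erule (1) bspec)
  then obtain p \<epsilon> where p: "p \<in> P" "\<epsilon> > 0" "{y \<in> S. p (\<lambda>i. y i - 0) < \<epsilon>} \<subseteq> {x \<in> S. s x < 1}"
    by blast
  have hom: "q (\<lambda>i. of_real t * x i) = t * q x" if "seminorm_on S q" "x \<in> S" "t \<ge> 0" for q t x
    using that unfolding seminorm_on_def by auto
  \<comment> \<open>Otherwise \<open>x\<close>, scaled to \<open>s\<close>-value 1, would lie in the
    \<open>p\<close>-ball, where \<open>s < 1\<close>.\<close>
  have "s x \<le> (2 / \<epsilon>) * p x" if x: "x \<in> S" for x
  proof (rule ccontr)
    assume neg: "\<not> ?thesis"
    have p0: "p x \<ge> 0" using P[rule_format, OF p(1)] x unfolding seminorm_on_def by blast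
    have sx: "s x > 0" using neg p0 p(2) by (smt (verit) divide_nonneg_pos mult_nonneg_nonneg)
    define t where "t = 1 / s x"
    have t: "t \<ge> 0" using sx by (simp add: t_def)
    have mem: "(\<lambda>i. of_real t * x i) \<in> S" using S x by (rule family_subspace_scale)
    have "p (\<lambda>i. of_real t * x i) = p x / s x"
      using hom[OF P[rule_format, OF p(1)] x t] by (simp add: t_def)
    also have "\<dots> < \<epsilon>"
      using neg sx p(2) p0 by (simp add: field_simps)
    finally have "s (\<lambda>i. of_real t * x i) < 1" using p(3) mem by auto
    then show False using hom[OF sn x t] sx by (simp add: t_def)
  qed
  then show ?thesis using p(1,2) by (intro bexI[of _ p] exI[of _ "2 / \<epsilon>"]) auto
qed

lemma seminorm_topology_generator_continuous:
  assumes S: "family_subspace S" and P: "\<forall>p\<in>P. seminorm_on S p" and p: "p \<in> P"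
  shows "p \<in> continuous_seminorms (seminorm_topology S P)"
proof -
  have "openin (seminorm_topology S P) {x \<in> S. p x \<in> U}" if U: "open U" for U
  proof (rule openin_seminorm_topologyI[OF S P])
    fix x assume x: "x \<in> {x \<in> S. p x \<in> U}"
    then obtain \<epsilon> where \<epsilon>: "\<epsilon> > 0" "ball (p x) \<epsilon> \<subseteq> U"
      using U open_contains_ball by blast
    have "p y \<in> U" if y: "y \<in> S" "p (\<lambda>i. y i - x i) < \<epsilon>" for y
    proof -
      have xy: "x \<in> S" "y \<in> S" "(\<lambda>_. 0) \<in> S" using x y S by (auto simp: family_subspace_def)
      have "p y \<le> p (\<lambda>i. y i - x i) + p x" "p x \<le> p (\<lambda>i. y i - x i) + p y"
        using seminorm_on_triangle[OF S P[rule_format, OF p] xy(2) xy(1) xy(3)]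
          seminorm_on_triangle[OF S P[rule_format, OF p] xy(1) xy(2) xy(3)]
          seminorm_on_minus_commute[OF S P[rule_format, OF p] xy(1,2)] by simp_all
      then have "dist (p x) (p y) < \<epsilon>" using y by (simp add: dist_real_def)
      then show ?thesis using \<epsilon>(2) by auto
    qed
    then show "\<exists>q\<in>P. \<exists>\<epsilon>>0. {y \<in> S. q (\<lambda>i. y i - x i) < \<epsilon>} \<subseteq> {x \<in> S. p x \<in> U}"
      using p \<epsilon>(1) by blast
  qed auto
  then have "continuous_map (seminorm_topology S P) euclideanreal p"
    unfolding continuous_map_def by auto
  then show ?thesis using P[rule_format, OF p] by (simp add: continuous_seminorms_def)
qed

section \<open>The strong dual of a nuclear weighted sequence space\<close>

text \<open>On \<open>ell A\<close> this is the nonnegative part of the test space in sup form: once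
  some \<open>1 / a ^ d\<close> is summable, sup bounds for all powers amount to l2 bounds for all
  powers. Outside \<open>ell A\<close> only the sign is prescribed, so that nonnegativity can be
  used at every index.\<close>

definition rapid_weights :: "nat set \<Rightarrow> (mindex \<Rightarrow> real) \<Rightarrow> (mindex \<Rightarrow> real) set" where
  "rapid_weights A a =
     {w. (\<forall>\<alpha>. 0 \<le> w \<alpha>) \<and> (\<forall>p. \<exists>K. \<forall>\<alpha>\<in>ell A. w \<alpha> * a \<alpha> ^ p \<le> K)}"

definition weighted_l1 :: "nat set \<Rightarrow> (mindex \<Rightarrow> real) \<Rightarrow> family \<Rightarrow> real" where
  "weighted_l1 A w f = (\<Sum>\<^sub>\<infinity>\<alpha>\<in>ell A. cmod (f \<alpha>) * w \<alpha>)"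

definition restrict_family :: "mindex set \<Rightarrow> family \<Rightarrow> family" where
  "restrict_family F f = (\<lambda>\<alpha>. if \<alpha> \<in> F then f \<alpha> else 0)"

lemma rapid_weights_nonneg: "w \<in> rapid_weights A a \<Longrightarrow> 0 \<le> w \<alpha>"
  by (simp add: rapid_weights_def)

lemma rapid_weightsE:
  assumes "w \<in> rapid_weights A a"
  obtains K where "0 \<le> K" "\<And>\<alpha>. \<alpha> \<in> ell A \<Longrightarrow> w \<alpha> * a \<alpha> ^ p \<le> K"
proof -
  obtain K where "\<forall>\<alpha>\<in>ell A. w \<alpha> * a \<alpha> ^ p \<le> K"
    using assms unfolding rapid_weights_def by blast
  then show ?thesis by (intro that[of "max 0 K"]) fastforce+
qed

lemma rapid_weights_add:
  assumes "u \<in> rapid_weights A a" "v \<in> rapid_weights A a"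
  shows "(\<lambda>\<alpha>. u \<alpha> + v \<alpha>) \<in> rapid_weights A a"
proof -
  have "\<exists>K. \<forall>\<alpha>\<in>ell A. (u \<alpha> + v \<alpha>) * a \<alpha> ^ p \<le> K" for p
  proof -
    obtain K L where "\<And>\<alpha>. \<alpha> \<in> ell A \<Longrightarrow> u \<alpha> * a \<alpha> ^ p \<le> K" "\<And>\<alpha>. \<alpha> \<in> ell A \<Longrightarrow> v \<alpha> * a \<alpha> ^ p \<le> L"
      using assms rapid_weightsE by metis
    then show ?thesis
      by (intro exI[of _ "K + L"]) (simp add: distrib_right add_mono)
  qed
  then show ?thesis using assms by (simp add: rapid_weights_def)
qed

lemma rapid_weights_scale:
  assumes "u \<in> rapid_weights A a" "0 \<le> c"
  shows "(\<lambda>\<alpha>. c * u \<alpha>) \<in> rapid_weights A a"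
proof -
  have "\<exists>K. \<forall>\<alpha>\<in>ell A. (c * u \<alpha>) * a \<alpha> ^ p \<le> K" for p
  proof -
    obtain K where "\<And>\<alpha>. \<alpha> \<in> ell A \<Longrightarrow> u \<alpha> * a \<alpha> ^ p \<le> K"
      using assms rapid_weightsE by metis
    then show ?thesis
      using assms(2) by (intro exI[of _ "c * K"]) (simp add: mult.assoc mult_left_mono)
  qed
  then show ?thesis using assms by (simp add: rapid_weights_def)
qed

text \<open>With a one-point \<open>F\<close> the weighted norm controls a single coefficient; with
  \<open>F = {}\<close> this shows that there are rapid weights at all.\<close>

lemma rapid_weights_finite_support:
  assumes "finite F"
  shows "(\<lambda>\<alpha>. if \<alpha> \<in> F then 1 else 0) \<in> rapid_weights A a"
proof -
  have "(if \<alpha> \<in> F then 1 else 0) * a \<alpha> ^ p \<le> (\<Sum>\<beta>\<in>F. \<bar>a \<beta> ^ p\<bar>)" for \<alpha> p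
  proof (cases "\<alpha> \<in> F")
    case True
    then have "\<bar>a \<alpha> ^ p\<bar> \<le> (\<Sum>\<beta>\<in>F. \<bar>a \<beta> ^ p\<bar>)"
      by (intro member_le_sum) (use assms in auto)
    then show ?thesis using True by simp
  qed (simp add: sum_nonneg)
  then have "\<exists>K. \<forall>\<alpha>\<in>ell A. (if \<alpha> \<in> F then 1 else 0) * a \<alpha> ^ p \<le> K" for p
    by blast
  then show ?thesis unfolding rapid_weights_def by simp
qed

text \<open>The two properties of a weight on which the topology of the dual depends. Isolating them
  lets the product weight be treated by the same results, with an exponent of its own.\<close>

locale nuclear_weight =
  fixes A :: "nat set" and a :: "mindex \<Rightarrow> real" and d :: nat
  assumes weight_ge_1: "\<And>\<alpha>. \<alpha> \<in> ell A \<Longrightarrow> 1 \<le> a \<alpha>"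
    and weight_summable: "(\<lambda>\<alpha>. 1 / a \<alpha> ^ d) summable_on ell A"
begin

lemma weight_pos: "\<alpha> \<in> ell A \<Longrightarrow> 0 < a \<alpha>"
  using weight_ge_1 by force

text \<open>A square-summable family is bounded termwise; conversely, a bound by a power of
  \<open>a\<close> becomes square-summable after division by enough further powers. The union of l2
  spaces is thus described by a growth condition, which is easier to manipulate.\<close>

lemma dual_space_iff:
  "f \<in> dual_space A a \<longleftrightarrow>
     f \<in> families A \<and> (\<exists>p K. \<forall>\<alpha>\<in>ell A. cmod (f \<alpha>) \<le> K * a \<alpha> ^ p)"
proof
  assume "f \<in> dual_space A a"
  then obtain p where f: "f \<in> families A" and s: "(\<lambda>\<alpha>. (cmod (f \<alpha>))\<^sup>2 / a \<alpha> ^ p) summable_on ell A"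
    unfolding dual_space_def l2_dual_def by blast
  define K where "K = (\<Sum>\<^sub>\<infinity>\<alpha>\<in>ell A. (cmod (f \<alpha>))\<^sup>2 / a \<alpha> ^ p)"
  have nn: "0 \<le> (cmod (f \<alpha>))\<^sup>2 / a \<alpha> ^ p" if "\<alpha> \<in> ell A" for \<alpha>
    using weight_pos[OF that] by simp
  have K0: "K \<ge> 0" unfolding K_def by (intro infsum_nonneg nn)
  \<comment> \<open>\<open>K + 1\<close> replaces the square root of \<open>K\<close>, as
    \<open>K \<le> (K + 1)\<^sup>2\<close>; likewise \<open>a \<ge> 1\<close> permits the exponent
    \<open>p\<close> instead of its half.\<close>
  have "cmod (f \<alpha>) \<le> (K + 1) * a \<alpha> ^ p" if \<alpha>: "\<alpha> \<in> ell A" for \<alpha>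
  proof (rule power2_le_imp_le)
    have "(\<Sum>\<beta>\<in>{\<alpha>}. (cmod (f \<beta>))\<^sup>2 / a \<beta> ^ p) \<le> K"
      unfolding K_def by (rule finite_sum_le_infsum[OF s]) (use \<alpha> nn in auto)
    then have "(cmod (f \<alpha>))\<^sup>2 \<le> K * a \<alpha> ^ p"
      using weight_pos[OF \<alpha>] by (simp add: divide_le_eq)
    also have "\<dots> \<le> (K + 1)\<^sup>2 * (a \<alpha> ^ p)\<^sup>2"
    proof (rule mult_mono)
      show "K \<le> (K + 1)\<^sup>2" using K0 by (simp add: power2_eq_square algebra_simps)
      have "1 \<le> a \<alpha> ^ p" using weight_ge_1[OF \<alpha>] by simp
      then show "a \<alpha> ^ p \<le> (a \<alpha> ^ p)\<^sup>2" by (simp add: power2_eq_square)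
    qed (use weight_pos[OF \<alpha>] in auto)
    finally show "(cmod (f \<alpha>))\<^sup>2 \<le> ((K + 1) * a \<alpha> ^ p)\<^sup>2" by (simp add: power_mult_distrib)
    show "0 \<le> (K + 1) * a \<alpha> ^ p" using K0 weight_pos[OF \<alpha>] by simp
  qed
  then show "f \<in> families A \<and> (\<exists>p K. \<forall>\<alpha>\<in>ell A. cmod (f \<alpha>) \<le> K * a \<alpha> ^ p)" using f by blast
next
  assume "f \<in> families A \<and> (\<exists>p K. \<forall>\<alpha>\<in>ell A. cmod (f \<alpha>) \<le> K * a \<alpha> ^ p)"
  then obtain p K where f: "f \<in> families A" and K: "\<And>\<alpha>. \<alpha> \<in> ell A \<Longrightarrow> cmod (f \<alpha>) \<le> K * a \<alpha> ^ p"
    by blast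
  \<comment> \<open>\<open>2 * p\<close> absorbs the growth of the squared modulus, \<open>d\<close>
    provides summability, and the extra 1 makes the exponent at least 1, as the union in
    \<open>dual_space\<close> requires.\<close>
  have "(\<lambda>\<alpha>. (cmod (f \<alpha>))\<^sup>2 / a \<alpha> ^ (2 * p + d + 1)) summable_on ell A"
  proof (rule summable_on_comparison_test)
    show "(\<lambda>\<alpha>. K\<^sup>2 * (1 / a \<alpha> ^ d)) summable_on ell A"
      by (intro summable_on_cmult_right weight_summable)
    fix \<alpha> assume \<alpha>: "\<alpha> \<in> ell A"
    have "(cmod (f \<alpha>))\<^sup>2 \<le> (K * a \<alpha> ^ p)\<^sup>2" using K[OF \<alpha>] by (intro power_mono) auto
    also have "\<dots> = K\<^sup>2 * a \<alpha> ^ (2 * p) * 1" by (simp add: power_mult_distrib power_mult[symmetric] mult.commute)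
    also have "\<dots> \<le> K\<^sup>2 * a \<alpha> ^ (2 * p) * a \<alpha>"
      using weight_ge_1[OF \<alpha>] by (intro mult_left_mono) auto
    finally have "(cmod (f \<alpha>))\<^sup>2 / a \<alpha> ^ (2 * p + d + 1) \<le> K\<^sup>2 * a \<alpha> ^ (2 * p) * a \<alpha> / a \<alpha> ^ (2 * p + d + 1)"
      using weight_pos[OF \<alpha>] by (intro divide_right_mono) auto
    also have "\<dots> = K\<^sup>2 * (1 / a \<alpha> ^ d)"
      using weight_pos[OF \<alpha>] by (simp add: power_add field_simps)
    finally show "(cmod (f \<alpha>))\<^sup>2 / a \<alpha> ^ (2 * p + d + 1) \<le> K\<^sup>2 * (1 / a \<alpha> ^ d)" .
    show "0 \<le> (cmod (f \<alpha>))\<^sup>2 / a \<alpha> ^ (2 * p + d + 1)" using weight_pos[OF \<alpha>] by simp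
  qed
  then have "f \<in> l2_dual A a (2 * p + d + 1)" using f by (simp add: l2_dual_def)
  then show "f \<in> dual_space A a" unfolding dual_space_def by auto
qed

lemma dual_spaceE:
  assumes "f \<in> dual_space A a"
  obtains p K where "0 \<le> K" "\<And>\<alpha>. \<alpha> \<in> ell A \<Longrightarrow> cmod (f \<alpha>) \<le> K * a \<alpha> ^ p"
proof -
  obtain p K where K: "\<forall>\<alpha>\<in>ell A. cmod (f \<alpha>) \<le> K * a \<alpha> ^ p"
    using assms dual_space_iff by blast
  have "cmod (f \<alpha>) \<le> max 0 K * a \<alpha> ^ p" if "\<alpha> \<in> ell A" for \<alpha>
    using K that weight_pos[OF that]
    by (meson max.cobounded2 mult_right_mono order_trans less_imp_le zero_le_power)
  then show ?thesis by (intro that[of "max 0 K" p]) auto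
qed

lemma dual_space_families: "f \<in> dual_space A a \<Longrightarrow> f \<in> families A"
  using dual_space_iff by blast

lemma family_subspace_dual_space: "family_subspace (dual_space A a)"
  unfolding family_subspace_def
proof (intro conjI ballI allI)
  show "(\<lambda>_. 0) \<in> dual_space A a"
    unfolding dual_space_iff by (auto simp: families_def intro!: exI[of _ 0])
next
  fix f g assume f: "f \<in> dual_space A a" and g: "g \<in> dual_space A a"
  obtain p K where K: "0 \<le> K" "\<And>\<alpha>. \<alpha> \<in> ell A \<Longrightarrow> cmod (f \<alpha>) \<le> K * a \<alpha> ^ p"
    using f by (rule dual_spaceE) blast
  obtain q L where L: "0 \<le> L" "\<And>\<alpha>. \<alpha> \<in> ell A \<Longrightarrow> cmod (g \<alpha>) \<le> L * a \<alpha> ^ q"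
    using g by (rule dual_spaceE) blast
  have "cmod (f \<alpha> + g \<alpha>) \<le> (K + L) * a \<alpha> ^ (p + q)" if \<alpha>: "\<alpha> \<in> ell A" for \<alpha>
  proof -
    have "cmod (f \<alpha>) \<le> K * a \<alpha> ^ (p + q)"
      using K(2)[OF \<alpha>] mult_left_mono[OF power_increasing[OF le_add1 weight_ge_1[OF \<alpha>]] K(1), of p q] by linarith
    moreover have "cmod (g \<alpha>) \<le> L * a \<alpha> ^ (p + q)"
      using L(2)[OF \<alpha>] mult_left_mono[OF power_increasing[OF le_add2 weight_ge_1[OF \<alpha>]] L(1), of q p] by linarith
    ultimately show ?thesis
      using norm_triangle_ineq[of "f \<alpha>" "g \<alpha>"] by (simp add: distrib_right)
  qed
  moreover have "(\<lambda>i. f i + g i) \<in> families A"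
    using dual_space_families[OF f] dual_space_families[OF g] by (simp add: families_def)
  ultimately show "(\<lambda>i. f i + g i) \<in> dual_space A a" unfolding dual_space_iff by blast
next
  fix c f assume f: "f \<in> dual_space A a"
  obtain p K where K: "0 \<le> K" "\<And>\<alpha>. \<alpha> \<in> ell A \<Longrightarrow> cmod (f \<alpha>) \<le> K * a \<alpha> ^ p"
    using f by (rule dual_spaceE) blast
  have "cmod (c * f \<alpha>) \<le> (cmod c * K) * a \<alpha> ^ p" if \<alpha>: "\<alpha> \<in> ell A" for \<alpha>
    using mult_left_mono[OF K(2)[OF \<alpha>], of "cmod c"] by (simp add: norm_mult mult.assoc)
  moreover have "(\<lambda>i. c * f i) \<in> families A"
    using dual_space_families[OF f] by (simp add: families_def)
  ultimately show "(\<lambda>i. c * f i) \<in> dual_space A a" unfolding dual_space_iff by blast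
qed

lemma restrict_family_in_dual_space:
  assumes "f \<in> dual_space A a"
  shows "restrict_family F f \<in> dual_space A a"
proof -
  obtain p K where K: "0 \<le> K" "\<And>\<alpha>. \<alpha> \<in> ell A \<Longrightarrow> cmod (f \<alpha>) \<le> K * a \<alpha> ^ p"
    using assms by (rule dual_spaceE) blast
  have "cmod (restrict_family F f \<alpha>) \<le> K * a \<alpha> ^ p" if "\<alpha> \<in> ell A" for \<alpha>
    using K(2)[OF that] K(1) weight_pos[OF that] by (simp add: restrict_family_def)
  moreover have "restrict_family F f \<in> families A"
    using dual_space_families[OF assms] by (simp add: families_def restrict_family_def)
  ultimately show ?thesis unfolding dual_space_iff by blast
qed

lemma delta_in_dual_space:
  assumes "\<alpha> \<in> ell A"
  shows "(\<lambda>\<beta>. if \<beta> = \<alpha> then 1 else 0) \<in> dual_space A a"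
  unfolding dual_space_iff
  by (intro conjI exI[of _ 0] exI[of _ 1]) (use assms in \<open>auto simp: families_def\<close>)

text \<open>Decay of order \<open>p + d\<close> leaves a multiple of \<open>1 / a ^ d\<close> as
  summable majorant.\<close>

lemma rapid_weights_power_summable:
  assumes "w \<in> rapid_weights A a"
  shows "(\<lambda>\<alpha>. w \<alpha> * a \<alpha> ^ p) summable_on ell A"
proof -
  obtain K where K: "0 \<le> K" "\<And>\<alpha>. \<alpha> \<in> ell A \<Longrightarrow> w \<alpha> * a \<alpha> ^ (p + d) \<le> K"
    using assms by (rule rapid_weightsE) blast
  show ?thesis
  proof (rule summable_on_comparison_test)
    show "(\<lambda>\<alpha>. K * (1 / a \<alpha> ^ d)) summable_on ell A"
      by (intro summable_on_cmult_right weight_summable)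
    fix \<alpha> assume \<alpha>: "\<alpha> \<in> ell A"
    show "w \<alpha> * a \<alpha> ^ p \<le> K * (1 / a \<alpha> ^ d)"
      using K(2)[OF \<alpha>] weight_pos[OF \<alpha>] by (simp add: power_add field_simps)
    show "0 \<le> w \<alpha> * a \<alpha> ^ p"
      using rapid_weights_nonneg[OF assms] weight_pos[OF \<alpha>] by simp
  qed
qed

lemma weighted_l1_summable:
  assumes f: "f \<in> dual_space A a" and w: "w \<in> rapid_weights A a"
  shows "(\<lambda>\<alpha>. cmod (f \<alpha>) * w \<alpha>) summable_on ell A"
proof -
  obtain p K where K: "0 \<le> K" "\<And>\<alpha>. \<alpha> \<in> ell A \<Longrightarrow> cmod (f \<alpha>) \<le> K * a \<alpha> ^ p"
    using f by (rule dual_spaceE) blast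
  show ?thesis
  proof (rule summable_on_comparison_test)
    show "(\<lambda>\<alpha>. K * (w \<alpha> * a \<alpha> ^ p)) summable_on ell A"
      by (intro summable_on_cmult_right rapid_weights_power_summable w)
    fix \<alpha> assume \<alpha>: "\<alpha> \<in> ell A"
    show "cmod (f \<alpha>) * w \<alpha> \<le> K * (w \<alpha> * a \<alpha> ^ p)"
      using mult_right_mono[OF K(2)[OF \<alpha>] rapid_weights_nonneg[OF w, of \<alpha>]] by (simp add: ac_simps)
    show "0 \<le> cmod (f \<alpha>) * w \<alpha>" using rapid_weights_nonneg[OF w] by simp
  qed
qed

lemma finite_sum_le_weighted_l1:
  assumes "f \<in> dual_space A a" "w \<in> rapid_weights A a" "finite X" "X \<subseteq> ell A"
  shows "(\<Sum>\<alpha>\<in>X. cmod (f \<alpha>) * w \<alpha>) \<le> weighted_l1 A w f"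
  unfolding weighted_l1_def
  by (rule finite_sum_le_infsum) (use assms rapid_weights_nonneg weighted_l1_summable in auto)

lemma weighted_l1_le:
  assumes "f \<in> dual_space A a" "w \<in> rapid_weights A a"
    and "\<And>X. finite X \<Longrightarrow> X \<subseteq> ell A \<Longrightarrow> (\<Sum>\<alpha>\<in>X. cmod (f \<alpha>) * w \<alpha>) \<le> K"
  shows "weighted_l1 A w f \<le> K"
  unfolding weighted_l1_def
  by (rule infsum_le_finite_sums) (use assms weighted_l1_summable in auto)

lemma weighted_l1_mono:
  assumes "f \<in> dual_space A a" "u \<in> rapid_weights A a" "v \<in> rapid_weights A a"
    and "\<And>\<alpha>. \<alpha> \<in> ell A \<Longrightarrow> u \<alpha> \<le> v \<alpha>"
  shows "weighted_l1 A u f \<le> weighted_l1 A v f"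
  unfolding weighted_l1_def
  by (intro infsum_mono weighted_l1_summable mult_left_mono) (use assms in auto)

lemma seminorm_on_weighted_l1:
  assumes w: "w \<in> rapid_weights A a"
  shows "seminorm_on (dual_space A a) (weighted_l1 A w)"
  unfolding seminorm_on_def
proof (intro conjI ballI allI)
  fix f assume "f \<in> dual_space A a"
  show "0 \<le> weighted_l1 A w f"
    unfolding weighted_l1_def using rapid_weights_nonneg[OF w] by (intro infsum_nonneg) auto
next
  fix c f assume f: "f \<in> dual_space A a"
  show "weighted_l1 A w (\<lambda>i. c * f i) = cmod c * weighted_l1 A w f"
    unfolding weighted_l1_def
    using infsum_cmult_right[OF weighted_l1_summable[OF f w], of "cmod c"] by (simp add: norm_mult mult.assoc)
next
  fix f g assume f: "f \<in> dual_space A a" and g: "g \<in> dual_space A a"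
  have "weighted_l1 A w (\<lambda>i. f i + g i) \<le> (\<Sum>\<^sub>\<infinity>\<alpha>\<in>ell A. cmod (f \<alpha>) * w \<alpha> + cmod (g \<alpha>) * w \<alpha>)"
    unfolding weighted_l1_def
  proof (rule infsum_mono)
    show "(\<lambda>\<alpha>. cmod (f \<alpha> + g \<alpha>) * w \<alpha>) summable_on ell A"
      using weighted_l1_summable[OF family_subspace_add[OF family_subspace_dual_space f g] w] .
    show "(\<lambda>\<alpha>. cmod (f \<alpha>) * w \<alpha> + cmod (g \<alpha>) * w \<alpha>) summable_on ell A"
      by (intro summable_on_add weighted_l1_summable f g w)
    show "cmod (f \<alpha> + g \<alpha>) * w \<alpha> \<le> cmod (f \<alpha>) * w \<alpha> + cmod (g \<alpha>) * w \<alpha>" for \<alpha>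
      using mult_right_mono[OF norm_triangle_ineq[of "f \<alpha>" "g \<alpha>"] rapid_weights_nonneg[OF w, of \<alpha>]]
      by (simp add: distrib_right)
  qed
  also have "\<dots> = weighted_l1 A w f + weighted_l1 A w g"
    unfolding weighted_l1_def by (intro infsum_add weighted_l1_summable f g w)
  finally show "weighted_l1 A w (\<lambda>i. f i + g i) \<le> weighted_l1 A w f + weighted_l1 A w g" .
qed

lemma directed_seminorms_weighted_l1:
  "directed_seminorms (dual_space A a) (weighted_l1 A ` rapid_weights A a)"
  unfolding directed_seminorms_def
proof (intro conjI ballI)
  show "weighted_l1 A ` rapid_weights A a \<noteq> {}"
    using rapid_weights_finite_support[of "{}"] by blast
  fix p q assume "p \<in> weighted_l1 A ` rapid_weights A a" "q \<in> weighted_l1 A ` rapid_weights A a"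
  then obtain u v where uv: "u \<in> rapid_weights A a" "v \<in> rapid_weights A a"
    and pq: "p = weighted_l1 A u" "q = weighted_l1 A v" by blast
  let ?w = "\<lambda>\<alpha>. u \<alpha> + v \<alpha>"
  have w: "?w \<in> rapid_weights A a" using uv by (rule rapid_weights_add)
  have "p x \<le> weighted_l1 A ?w x \<and> q x \<le> weighted_l1 A ?w x" if "x \<in> dual_space A a" for x
    unfolding pq using uv w that rapid_weights_nonneg by (intro conjI weighted_l1_mono) auto
  then show "\<exists>r\<in>weighted_l1 A ` rapid_weights A a. \<forall>x\<in>dual_space A a. p x \<le> r x \<and> q x \<le> r x"
    using w by blast
qed (use family_subspace_dual_space seminorm_on_weighted_l1 in auto)

text \<open>Tail estimate for a convergent sum. The bound holds for every larger \<open>G\<close>,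
  so that finitely many families can be truncated to one common set.\<close>

lemma weighted_l1_truncation:
  assumes f: "f \<in> dual_space A a" and w: "w \<in> rapid_weights A a" and \<epsilon>: "0 < \<epsilon>"
  obtains F where "finite F" "F \<subseteq> ell A"
    "\<And>G. F \<subseteq> G \<Longrightarrow> weighted_l1 A w (\<lambda>\<alpha>. f \<alpha> - restrict_family G f \<alpha>) \<le> \<epsilon>"
proof -
  obtain F where F: "finite F" "F \<subseteq> ell A"
    "dist (\<Sum>\<alpha>\<in>F. cmod (f \<alpha>) * w \<alpha>) (\<Sum>\<^sub>\<infinity>\<alpha>\<in>ell A. cmod (f \<alpha>) * w \<alpha>) \<le> \<epsilon>"
    using infsum_finite_approximation[OF weighted_l1_summable[OF f w] \<epsilon>] by blast
  have "weighted_l1 A w (\<lambda>\<alpha>. f \<alpha> - restrict_family G f \<alpha>) \<le> \<epsilon>" if G: "F \<subseteq> G" for G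
  proof (rule weighted_l1_le)
    show "(\<lambda>\<alpha>. f \<alpha> - restrict_family G f \<alpha>) \<in> dual_space A a"
      by (intro family_subspace_diff family_subspace_dual_space f restrict_family_in_dual_space)
    fix X assume X: "finite X" "X \<subseteq> ell A"
    have "(\<Sum>\<alpha>\<in>X. cmod (f \<alpha> - restrict_family G f \<alpha>) * w \<alpha>) = (\<Sum>\<alpha>\<in>X - G. cmod (f \<alpha>) * w \<alpha>)"
      by (rule sum.mono_neutral_cong_right) (use X in \<open>auto simp: restrict_family_def\<close>)
    also have "\<dots> \<le> (\<Sum>\<alpha>\<in>X - F. cmod (f \<alpha>) * w \<alpha>)"
      by (rule sum_mono2) (use X G rapid_weights_nonneg[OF w] in auto)
    also have "\<dots> = (\<Sum>\<alpha>\<in>(X - F) \<union> F. cmod (f \<alpha>) * w \<alpha>) - (\<Sum>\<alpha>\<in>F. cmod (f \<alpha>) * w \<alpha>)"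
      using X F by (subst sum.union_disjoint) auto
    also have "(\<Sum>\<alpha>\<in>(X - F) \<union> F. cmod (f \<alpha>) * w \<alpha>) \<le> weighted_l1 A w f"
      by (rule finite_sum_le_weighted_l1) (use f w X F in auto)
    also have "weighted_l1 A w f - (\<Sum>\<alpha>\<in>F. cmod (f \<alpha>) * w \<alpha>) \<le> \<epsilon>"
      using F(3) unfolding weighted_l1_def dist_real_def by linarith
    finally show "(\<Sum>\<alpha>\<in>X. cmod (f \<alpha> - restrict_family G f \<alpha>) * w \<alpha>) \<le> \<epsilon>" by simp
  qed (rule w)
  then show ?thesis using that F by blast
qed

section \<open>Bounded sets of test functions and rapidly decreasing weights\<close>

lemma pairing_abs_summable:
  assumes f: "f \<in> dual_space A a" and w: "w \<in> rapid_weights A a"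
    and \<phi>: "\<And>\<alpha>. \<alpha> \<in> ell A \<Longrightarrow> cmod (\<phi> \<alpha>) \<le> w \<alpha>"
  shows "(\<lambda>\<alpha>. norm (f \<alpha> * \<phi> \<alpha>)) summable_on ell A"
    and "cmod (pairing A f \<phi>) \<le> weighted_l1 A w f"
proof -
  have le: "norm (f \<alpha> * \<phi> \<alpha>) \<le> cmod (f \<alpha>) * w \<alpha>" if "\<alpha> \<in> ell A" for \<alpha>
    using \<phi>[OF that] by (simp add: norm_mult mult_left_mono)
  show abs: "(\<lambda>\<alpha>. norm (f \<alpha> * \<phi> \<alpha>)) summable_on ell A"
    by (rule summable_on_comparison_test[OF weighted_l1_summable[OF f w]]) (use le in auto)
  have "cmod (pairing A f \<phi>) \<le> (\<Sum>\<^sub>\<infinity>\<alpha>\<in>ell A. norm (f \<alpha> * \<phi> \<alpha>))"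
    unfolding pairing_def by (rule norm_infsum_bound[OF abs])
  also have "\<dots> \<le> weighted_l1 A w f"
    unfolding weighted_l1_def by (rule infsum_mono[OF abs weighted_l1_summable[OF f w] le])
  finally show "cmod (pairing A f \<phi>) \<le> weighted_l1 A w f" .
qed

text \<open>The pointwise supremum inherits bounds that are uniform in \<open>i\<close> for each
  \<open>p\<close>. It serves both for bounded sets of test functions and for splitting a weight on
  pairs into two factors.\<close>

lemma rapid_weights_dominating:
  assumes D: "D \<noteq> {}" and nonneg: "\<And>i \<alpha>. 0 \<le> g i \<alpha>"
    and bound: "\<And>p. \<exists>K. \<forall>i\<in>D. \<forall>\<alpha>\<in>ell A. g i \<alpha> * a \<alpha> ^ p \<le> K"
  obtains w where "w \<in> rapid_weights A a" "\<And>i \<alpha>. i \<in> D \<Longrightarrow> \<alpha> \<in> ell A \<Longrightarrow> g i \<alpha> \<le> w \<alpha>"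
proof -
  \<comment> \<open>Off \<open>ell A\<close> nothing bounds the family, so the value is set to 0
    there.\<close>
  define w where "w \<alpha> = (if \<alpha> \<in> ell A then SUP i\<in>D. g i \<alpha> else 0)" for \<alpha>
  obtain K0 where K0: "\<forall>i\<in>D. \<forall>\<alpha>\<in>ell A. g i \<alpha> * a \<alpha> ^ 0 \<le> K0" using bound by blast
  have bdd: "bdd_above ((\<lambda>i. g i \<alpha>) ` D)" if "\<alpha> \<in> ell A" for \<alpha>
    using K0 that by (intro bdd_aboveI[of _ K0]) auto
  have up: "g i \<alpha> \<le> w \<alpha>" if "i \<in> D" "\<alpha> \<in> ell A" for i \<alpha>
    using cSUP_upper[OF that(1) bdd[OF that(2)]] that by (simp add: w_def)
  obtain j where j: "j \<in> D" using D by blast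
  have "0 \<le> w \<alpha>" for \<alpha>
    using order_trans[OF nonneg up[OF j, of \<alpha>]] by (cases "\<alpha> \<in> ell A") (auto simp: w_def)
  moreover have "\<exists>K. \<forall>\<alpha>\<in>ell A. w \<alpha> * a \<alpha> ^ p \<le> K" for p
  proof -
    obtain K where K: "\<forall>i\<in>D. \<forall>\<alpha>\<in>ell A. g i \<alpha> * a \<alpha> ^ p \<le> K" using bound by blast
    have "w \<alpha> * a \<alpha> ^ p \<le> K" if \<alpha>: "\<alpha> \<in> ell A" for \<alpha>
    proof -
      have "(SUP i\<in>D. g i \<alpha>) \<le> K / a \<alpha> ^ p"
        by (rule cSUP_least[OF D]) (use K \<alpha> weight_pos[OF \<alpha>] in \<open>simp add: le_divide_eq\<close>)
      then show ?thesis using \<alpha> weight_pos[OF \<alpha>] by (simp add: w_def le_divide_eq)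
    qed
    then show ?thesis by blast
  qed
  ultimately have "w \<in> rapid_weights A a" by (simp add: rapid_weights_def)
  then show ?thesis using that up by blast
qed

text \<open>A single term of the squared test norm bounds a coefficient, uniformly over the bounded
  set.\<close>

lemma bounded_in_test_space_dominated:
  assumes D: "D \<noteq> {}" "bounded_in_test_space A a D"
  obtains w where "w \<in> rapid_weights A a"
    "\<And>\<phi> \<alpha>. \<phi> \<in> D \<Longrightarrow> \<alpha> \<in> ell A \<Longrightarrow> cmod (\<phi> \<alpha>) \<le> w \<alpha>"
proof -
  have bound: "\<exists>K. \<forall>\<phi>\<in>D. \<forall>\<alpha>\<in>ell A. cmod (\<phi> \<alpha>) * a \<alpha> ^ p \<le> K" for p
  proof -
    \<comment> \<open>The order is \<open>2 * (p + 1)\<close> rather than \<open>2 * p\<close>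
      because bounds are available only from order 1 on; the surplus power is dropped by
      \<open>a \<ge> 1\<close>.\<close>
    obtain K where K: "\<forall>\<phi>\<in>D. test_norm A a (2 * (p + 1)) \<phi> \<le> K"
      using D(2) unfolding bounded_in_test_space_def by force
    have "cmod (\<phi> \<alpha>) * a \<alpha> ^ p \<le> K" if \<phi>: "\<phi> \<in> D" and \<alpha>: "\<alpha> \<in> ell A" for \<phi> \<alpha>
    proof -
      have s: "(\<lambda>\<alpha>. (cmod (\<phi> \<alpha>))\<^sup>2 * a \<alpha> ^ (2 * (p + 1))) summable_on ell A"
      proof -
        have "\<phi> \<in> test_space A a" using D(2) \<phi> unfolding bounded_in_test_space_def by blast
        moreover have "2 * (p + 1) \<ge> 1" by simp
        ultimately show ?thesis unfolding test_space_def by blast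
      qed
      have "(\<Sum>\<beta>\<in>{\<alpha>}. (cmod (\<phi> \<beta>))\<^sup>2 * a \<beta> ^ (2 * (p + 1)))
          \<le> (\<Sum>\<^sub>\<infinity>\<beta>\<in>ell A. (cmod (\<phi> \<beta>))\<^sup>2 * a \<beta> ^ (2 * (p + 1)))"
        by (rule finite_sum_le_infsum[OF s]) (use \<alpha> weight_pos in \<open>auto simp: less_imp_le\<close>)
      then have "sqrt ((cmod (\<phi> \<alpha>) * a \<alpha> ^ (p + 1))\<^sup>2) \<le> test_norm A a (2 * (p + 1)) \<phi>"
        unfolding test_norm_def power_mult_distrib power_even_eq[symmetric]
        by (intro real_sqrt_le_mono) simp
      then have "cmod (\<phi> \<alpha>) * a \<alpha> ^ (p + 1) \<le> K"
        using K \<phi> weight_pos[OF \<alpha>] by (auto simp: abs_mult)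
      moreover have "cmod (\<phi> \<alpha>) * a \<alpha> ^ p \<le> cmod (\<phi> \<alpha>) * a \<alpha> ^ (p + 1)"
        using weight_ge_1[OF \<alpha>] by (intro mult_left_mono power_increasing) auto
      ultimately show ?thesis by simp
    qed
    then show ?thesis by blast
  qed
  show ?thesis
    by (rule rapid_weights_dominating[OF D(1), of "\<lambda>\<phi> \<alpha>. cmod (\<phi> \<alpha>)"]) (use bound that in auto)
qed

text \<open>The order interval of all families of modulus at most \<open>w\<close> is bounded in the
  test space and contains, for each \<open>f\<close>, a multiplier that turns the pairing into the
  weighted sum. One \<open>D\<close> serves all \<open>f\<close>.\<close>

lemma weighted_l1_le_dual_seminorm:
  assumes w: "w \<in> rapid_weights A a"
  obtains D where "D \<noteq> {}" "bounded_in_test_space A a D"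
    "\<And>f. f \<in> dual_space A a \<Longrightarrow> weighted_l1 A w f \<le> (SUP \<phi>\<in>D. cmod (pairing A f \<phi>))"
proof -
  define D where "D = {\<phi> \<in> families A. \<forall>\<alpha>\<in>ell A. cmod (\<phi> \<alpha>) \<le> w \<alpha>}"
  have "(\<lambda>_. 0) \<in> D"
    using rapid_weights_nonneg[OF w] by (simp add: D_def families_def)
  then have ne: "D \<noteq> {}" by blast
  \<comment> \<open>Test norms are quadratic, so boundedness of \<open>D\<close> rests on the decay
    of the square of \<open>w\<close>.\<close>
  have w2: "(\<lambda>\<alpha>. (w \<alpha>)\<^sup>2) \<in> rapid_weights A a"
  proof -
    obtain K where K: "0 \<le> K" "\<And>\<alpha>. \<alpha> \<in> ell A \<Longrightarrow> w \<alpha> * a \<alpha> ^ 0 \<le> K"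
      using w by (rule rapid_weightsE) blast
    have "\<exists>L. \<forall>\<alpha>\<in>ell A. (w \<alpha>)\<^sup>2 * a \<alpha> ^ p \<le> L" for p
    proof -
      obtain L where L: "0 \<le> L" "\<And>\<alpha>. \<alpha> \<in> ell A \<Longrightarrow> w \<alpha> * a \<alpha> ^ p \<le> L"
        using w by (rule rapid_weightsE) blast
      have "(w \<alpha>)\<^sup>2 * a \<alpha> ^ p \<le> K * L" if \<alpha>: "\<alpha> \<in> ell A" for \<alpha>
        using mult_mono[OF K(2)[OF \<alpha>] L(2)[OF \<alpha>] K(1)] rapid_weights_nonneg[OF w, of \<alpha>] weight_pos[OF \<alpha>]
        by (simp add: power2_eq_square mult.assoc)
      then show ?thesis by blast
    qed
    then show ?thesis by (simp add: rapid_weights_def)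
  qed
  have sq: "(cmod (\<phi> \<alpha>))\<^sup>2 * a \<alpha> ^ p \<le> (w \<alpha>)\<^sup>2 * a \<alpha> ^ p" if "\<phi> \<in> D" "\<alpha> \<in> ell A" for \<phi> \<alpha> p
    using that weight_pos[OF that(2)] by (intro mult_right_mono power_mono) (auto simp: D_def)
  have test_summable: "(\<lambda>\<alpha>. (cmod (\<phi> \<alpha>))\<^sup>2 * a \<alpha> ^ p) summable_on ell A" if "\<phi> \<in> D" for \<phi> p
    by (rule summable_on_comparison_test[OF rapid_weights_power_summable[OF w2, of p]])
       (use sq[OF that] weight_pos in \<open>auto simp: less_imp_le\<close>)
  have "test_norm A a p \<phi> \<le> sqrt (\<Sum>\<^sub>\<infinity>\<alpha>\<in>ell A. (w \<alpha>)\<^sup>2 * a \<alpha> ^ p)" if "\<phi> \<in> D" for \<phi> p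
    unfolding test_norm_def
    by (intro real_sqrt_le_mono infsum_mono test_summable that rapid_weights_power_summable w2 sq)
  moreover have "D \<subseteq> test_space A a"
    using test_summable by (auto simp: test_space_def D_def)
  ultimately have bounded: "bounded_in_test_space A a D"
    unfolding bounded_in_test_space_def by blast
  have "weighted_l1 A w f \<le> (SUP \<phi>\<in>D. cmod (pairing A f \<phi>))" if f: "f \<in> dual_space A a" for f
  proof -
    \<comment> \<open>\<open>w\<close> times the conjugate phase of \<open>f\<close>; at zeros of
      \<open>f\<close> the value is 0.\<close>
    define \<psi> where "\<psi> \<alpha> = (if \<alpha> \<in> ell A then of_real (w \<alpha>) * cnj (sgn (f \<alpha>)) else 0)" for \<alpha>
    have \<psi>: "\<psi> \<in> D"
      using rapid_weights_nonneg[OF w] by (auto simp: D_def families_def \<psi>_def norm_mult norm_sgn)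
    have "f \<alpha> * \<psi> \<alpha> = of_real (cmod (f \<alpha>) * w \<alpha>)" if "\<alpha> \<in> ell A" for \<alpha>
    proof -
      have "f \<alpha> * cnj (sgn (f \<alpha>)) = of_real (cmod (f \<alpha>))"
        by (cases "f \<alpha> = 0")
           (simp_all add: sgn_div_norm scaleR_conv_of_real complex_norm_square[symmetric] power2_eq_square field_simps)
      then show ?thesis using that by (simp add: \<psi>_def mult.left_commute mult.commute)
    qed
    then have "pairing A f \<psi> = (\<Sum>\<^sub>\<infinity>\<alpha>\<in>ell A. of_real (cmod (f \<alpha>) * w \<alpha>))"
      unfolding pairing_def by (rule infsum_cong)
    also have "\<dots> = of_real (weighted_l1 A w f)"
      unfolding weighted_l1_def
      by (intro infsumI has_sum_of_real has_sum_infsum weighted_l1_summable f w)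
    finally have "weighted_l1 A w f \<le> cmod (pairing A f \<psi>)" by simp
    also have "\<dots> \<le> (SUP \<phi>\<in>D. cmod (pairing A f \<phi>))"
      by (rule cSUP_upper[OF \<psi>], rule bdd_aboveI[of _ "weighted_l1 A w f"])
         (use pairing_abs_summable(2)[OF f w] in \<open>auto simp: D_def\<close>)
    finally show ?thesis .
  qed
  then show ?thesis using that ne bounded by blast
qed

text \<open>The supremum is a genuine one: a single rapid weight dominates \<open>D\<close>, which
  bounds the pairings with each fixed \<open>f\<close>.\<close>

lemma seminorm_on_dual_seminorm:
  assumes D: "D \<noteq> {}" "bounded_in_test_space A a D"
  shows "seminorm_on (dual_space A a) (\<lambda>f. SUP \<phi>\<in>D. cmod (pairing A f \<phi>))"
proof -
  obtain w where w: "w \<in> rapid_weights A a"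
    and dom: "\<And>\<phi> \<alpha>. \<phi> \<in> D \<Longrightarrow> \<alpha> \<in> ell A \<Longrightarrow> cmod (\<phi> \<alpha>) \<le> w \<alpha>"
    using bounded_in_test_space_dominated[OF D] by blast
  obtain \<phi>0 where \<phi>0: "\<phi>0 \<in> D" using D(1) by blast
  have bdd: "bdd_above ((\<lambda>\<phi>. cmod (pairing A f \<phi>)) ` D)" if "f \<in> dual_space A a" for f
    by (rule bdd_aboveI[of _ "weighted_l1 A w f"]) (use pairing_abs_summable(2)[OF that w dom] in auto)
  have summable: "(\<lambda>\<alpha>. f \<alpha> * \<phi> \<alpha>) summable_on ell A" if "f \<in> dual_space A a" "\<phi> \<in> D" for f \<phi>
    by (rule abs_summable_summable[OF pairing_abs_summable(1)[OF that(1) w dom[OF that(2)]]])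
  show ?thesis
    unfolding seminorm_on_def
  proof (intro conjI ballI allI)
    fix f assume f: "f \<in> dual_space A a"
    show "0 \<le> (SUP \<phi>\<in>D. cmod (pairing A f \<phi>))"
      using cSUP_upper[OF \<phi>0 bdd[OF f]] norm_ge_zero order_trans by blast
  next
    fix c f assume f: "f \<in> dual_space A a"
    have eq: "cmod (pairing A (\<lambda>i. c * f i) \<phi>) = cmod c * cmod (pairing A f \<phi>)" if "\<phi> \<in> D" for \<phi>
      using infsum_cmult_right[OF summable[OF f that], of c]
      by (simp add: pairing_def mult.assoc norm_mult)
    have cf: "(\<lambda>i. c * f i) \<in> dual_space A a"
      by (rule family_subspace_scale[OF family_subspace_dual_space f])
    show "(SUP \<phi>\<in>D. cmod (pairing A (\<lambda>i. c * f i) \<phi>)) = cmod c * (SUP \<phi>\<in>D. cmod (pairing A f \<phi>))"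
    proof (rule antisym)
      show "(SUP \<phi>\<in>D. cmod (pairing A (\<lambda>i. c * f i) \<phi>)) \<le> cmod c * (SUP \<phi>\<in>D. cmod (pairing A f \<phi>))"
        by (rule cSUP_least[OF D(1)]) (use f in \<open>auto simp: eq intro!: mult_left_mono cSUP_upper bdd\<close>)
      show "cmod c * (SUP \<phi>\<in>D. cmod (pairing A f \<phi>)) \<le> (SUP \<phi>\<in>D. cmod (pairing A (\<lambda>i. c * f i) \<phi>))"
      proof (cases "c = 0")
        case True
        then show ?thesis
          using order_trans[OF norm_ge_zero cSUP_upper[OF \<phi>0 bdd[OF cf]]] by simp
      next
        case False
        have "(SUP \<phi>\<in>D. cmod (pairing A f \<phi>)) \<le> (SUP \<phi>\<in>D. cmod (pairing A (\<lambda>i. c * f i) \<phi>)) / cmod c"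
        proof (rule cSUP_least[OF D(1)])
          fix \<phi> assume "\<phi> \<in> D"
          then show "cmod (pairing A f \<phi>) \<le> (SUP \<phi>\<in>D. cmod (pairing A (\<lambda>i. c * f i) \<phi>)) / cmod c"
            using cSUP_upper[OF _ bdd[OF cf]] eq False by (simp add: le_divide_eq mult.commute)
        qed
        then show ?thesis using False by (simp add: le_divide_eq mult.commute)
      qed
    qed
  next
    fix f g assume f: "f \<in> dual_space A a" and g: "g \<in> dual_space A a"
    show "(SUP \<phi>\<in>D. cmod (pairing A (\<lambda>i. f i + g i) \<phi>))
        \<le> (SUP \<phi>\<in>D. cmod (pairing A f \<phi>)) + (SUP \<phi>\<in>D. cmod (pairing A g \<phi>))"
    proof (rule cSUP_least[OF D(1)])
      fix \<phi> assume \<phi>: "\<phi> \<in> D"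
      have "pairing A (\<lambda>i. f i + g i) \<phi> = pairing A f \<phi> + pairing A g \<phi>"
        unfolding pairing_def distrib_right by (intro infsum_add summable f g \<phi>)
      then have "cmod (pairing A (\<lambda>i. f i + g i) \<phi>) \<le> cmod (pairing A f \<phi>) + cmod (pairing A g \<phi>)"
        by (simp add: norm_triangle_ineq)
      also have "\<dots> \<le> (SUP \<phi>\<in>D. cmod (pairing A f \<phi>)) + (SUP \<phi>\<in>D. cmod (pairing A g \<phi>))"
        by (intro add_mono cSUP_upper \<phi> bdd f g)
      finally show "cmod (pairing A (\<lambda>i. f i + g i) \<phi>)
          \<le> (SUP \<phi>\<in>D. cmod (pairing A f \<phi>)) + (SUP \<phi>\<in>D. cmod (pairing A g \<phi>))" .
    qed
  qed
qed

text \<open>Every bounded set lies in the order interval of some rapid weight, and every such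
  interval is bounded; hence the two families of seminorms dominate each other.\<close>

lemma strong_dual_eq:
  "strong_dual A a = seminorm_topology (dual_space A a) (weighted_l1 A ` rapid_weights A a)"
  unfolding strong_dual_def
proof (rule seminorm_topology_eqI[OF family_subspace_dual_space]; intro ballI)
  fix p assume "p \<in> {(\<lambda>f. SUP \<phi>\<in>D. cmod (pairing A f \<phi>)) | D. D \<noteq> {} \<and> bounded_in_test_space A a D}"
  then obtain D where D: "D \<noteq> {}" "bounded_in_test_space A a D"
    and p: "p = (\<lambda>f. SUP \<phi>\<in>D. cmod (pairing A f \<phi>))" by blast
  show "seminorm_on (dual_space A a) p"
    unfolding p by (rule seminorm_on_dual_seminorm[OF D])
  obtain w where w: "w \<in> rapid_weights A a"
    and dom: "\<And>\<phi> \<alpha>. \<phi> \<in> D \<Longrightarrow> \<alpha> \<in> ell A \<Longrightarrow> cmod (\<phi> \<alpha>) \<le> w \<alpha>"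
    using bounded_in_test_space_dominated[OF D] by blast
  have "p f \<le> weighted_l1 A w f" if "f \<in> dual_space A a" for f
    unfolding p by (rule cSUP_least[OF D(1)]) (rule pairing_abs_summable(2)[OF that w dom])
  then show "\<exists>q\<in>weighted_l1 A ` rapid_weights A a. \<forall>x\<in>dual_space A a. p x \<le> q x" using w by blast
next
  fix q assume "q \<in> weighted_l1 A ` rapid_weights A a"
  then obtain w where w: "w \<in> rapid_weights A a" and q: "q = weighted_l1 A w" by blast
  show "seminorm_on (dual_space A a) q" unfolding q by (rule seminorm_on_weighted_l1[OF w])
  obtain D where D: "D \<noteq> {}" "bounded_in_test_space A a D"
    and le: "\<And>f. f \<in> dual_space A a \<Longrightarrow> weighted_l1 A w f \<le> (SUP \<phi>\<in>D. cmod (pairing A f \<phi>))"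
    using weighted_l1_le_dual_seminorm[OF w] by blast
  show "\<exists>p\<in>{(\<lambda>f. SUP \<phi>\<in>D. cmod (pairing A f \<phi>)) | D. D \<noteq> {} \<and> bounded_in_test_space A a D}.
      \<forall>x\<in>dual_space A a. q x \<le> p x"
    unfolding q
    by (rule bexI[of _ "\<lambda>f. SUP \<phi>\<in>D. cmod (pairing A f \<phi>)"]) (use D le in auto)
qed

end

section \<open>Separation and completeness of the strong dual\<close>

context nuclear_weight
begin

lemma topspace_strong_dual: "topspace (strong_dual A a) = dual_space A a"
  by (simp add: strong_dual_def)

lemma openin_strong_dual:
  "openin (strong_dual A a) U \<longleftrightarrow>
     U \<subseteq> dual_space A a \<and>
     (\<forall>f\<in>U. \<exists>w\<in>rapid_weights A a. \<exists>\<epsilon>>0.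
        {g \<in> dual_space A a. weighted_l1 A w (\<lambda>\<alpha>. g \<alpha> - f \<alpha>) < \<epsilon>} \<subseteq> U)"
  unfolding strong_dual_eq openin_seminorm_topology[OF directed_seminorms_weighted_l1] by simp

lemma openin_weighted_l1_ball:
  assumes "f \<in> dual_space A a" "w \<in> rapid_weights A a" "0 < \<epsilon>"
  shows "openin (strong_dual A a) {g \<in> dual_space A a. weighted_l1 A w (\<lambda>\<alpha>. g \<alpha> - f \<alpha>) < \<epsilon>}"
  unfolding strong_dual_eq seminorm_topology_def
  by (rule topology_generated_by_Basis) (use assms in blast)

lemma locally_convex_strong_dual: "locally_convex (strong_dual A a)"
  unfolding locally_convex_def topspace_strong_dual
  using family_subspace_dual_space strong_dual_eq seminorm_on_weighted_l1 by blast

lemma coefficient_le_weighted_l1: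
  assumes "f \<in> dual_space A a" "w \<in> rapid_weights A a" "\<alpha> \<in> ell A"
  shows "cmod (f \<alpha>) * w \<alpha> \<le> weighted_l1 A w f"
  using finite_sum_le_weighted_l1[OF assms(1,2), of "{\<alpha>}"] assms(3) by simp

lemma norm_coefficient_le:
  assumes "f \<in> dual_space A a" "\<alpha> \<in> ell A"
  shows "cmod (f \<alpha>) \<le> weighted_l1 A (\<lambda>\<beta>. if \<beta> \<in> {\<alpha>} then 1 else 0) f"
  using coefficient_le_weighted_l1[OF assms(1) rapid_weights_finite_support[of "{\<alpha>}"] assms(2)] by simp

text \<open>Coefficients are bounded by the norms of one-point weights, and they separate
  families.\<close>

lemma Hausdorff_strong_dual: "Hausdorff_space (strong_dual A a)"
  unfolding Hausdorff_space_def topspace_strong_dual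
proof (intro allI impI)
  fix f g assume fg: "f \<in> dual_space A a \<and> g \<in> dual_space A a \<and> f \<noteq> g"
  then obtain \<alpha> where ne: "f \<alpha> \<noteq> g \<alpha>" by blast
  have \<alpha>: "\<alpha> \<in> ell A"
    using ne fg dual_space_families unfolding families_def by (metis (mono_tags, lifting) mem_Collect_eq)
  define w :: "mindex \<Rightarrow> real" where "w = (\<lambda>\<beta>. if \<beta> \<in> {\<alpha>} then 1 else 0)"
  have w: "w \<in> rapid_weights A a" unfolding w_def by (rule rapid_weights_finite_support) simp
  define \<epsilon> where "\<epsilon> = cmod (f \<alpha> - g \<alpha>) / 2"
  have \<epsilon>: "\<epsilon> > 0" using ne by (simp add: \<epsilon>_def)
  let ?B = "\<lambda>f. {h \<in> dual_space A a. weighted_l1 A w (\<lambda>\<alpha>. h \<alpha> - f \<alpha>) < \<epsilon>}"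
  have near: "cmod (h \<alpha> - k \<alpha>) < \<epsilon>" if "h \<in> ?B k" "k \<in> dual_space A a" for h k
    using norm_coefficient_le[OF family_subspace_diff[OF family_subspace_dual_space _ that(2)] \<alpha>, of h] that
    by (simp add: w_def)
  have centre: "h \<in> ?B h" if "h \<in> dual_space A a" for h
    using that \<epsilon> seminorm_on_zero[OF family_subspace_dual_space seminorm_on_weighted_l1[OF w]] by simp
  have "disjnt (?B f) (?B g)"
    unfolding disjnt_iff
  proof (intro allI notI)
    fix h assume h: "h \<in> ?B f \<and> h \<in> ?B g"
    have "cmod (f \<alpha> - g \<alpha>) \<le> cmod (h \<alpha> - f \<alpha>) + cmod (h \<alpha> - g \<alpha>)"
      using norm_triangle_ineq4[of "h \<alpha> - g \<alpha>" "h \<alpha> - f \<alpha>"] by simp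
    then show False using near[of h f] near[of h g] h fg \<epsilon>_def by fastforce
  qed
  then show "\<exists>U V. openin (strong_dual A a) U \<and> openin (strong_dual A a) V \<and> f \<in> U \<and> g \<in> V \<and> disjnt U V"
    using openin_weighted_l1_ball[OF _ w \<epsilon>] centre fg by blast
qed

text \<open>
  A family that grows faster than every power of the weight is unbounded against the weight
  supported on indices \<open>\<alpha> p\<close> with \<open>\<bar>f (\<alpha> p)\<bar> > (p + 1)\<^sup>2 * a (\<alpha> p) ^ (2 * p)\<close>, where it equals
  \<open>\<bar>f\<bar>\<close> to the power \<open>- 1/2\<close>.
\<close>

lemma dual_spaceI_bounded:
  assumes f: "f \<in> families A"
    and bound: "\<And>w. w \<in> rapid_weights A a \<Longrightarrow> \<exists>K. \<forall>\<alpha>\<in>ell A. cmod (f \<alpha>) * w \<alpha> \<le> K"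
  shows "f \<in> dual_space A a"
proof (rule ccontr)
  assume "f \<notin> dual_space A a"
  then have "\<forall>p. \<exists>\<alpha>. \<alpha> \<in> ell A \<and> (real p + 1)\<^sup>2 * a \<alpha> ^ (2 * p) < cmod (f \<alpha>)"
    using f unfolding dual_space_iff by (meson not_le)
  then obtain s where s: "\<And>p. s p \<in> ell A" "\<And>p. (real p + 1)\<^sup>2 * a (s p) ^ (2 * p) < cmod (f (s p))"
    by metis
  define w where "w \<alpha> = (if \<alpha> \<in> range s then 1 / sqrt (cmod (f \<alpha>)) else 0)" for \<alpha>
  have lower: "(real p + 1) * a (s p) ^ p < sqrt (cmod (f (s p)))" for p
  proof (rule real_less_rsqrt)
    show "((real p + 1) * a (s p) ^ p)\<^sup>2 < cmod (f (s p))"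
      using s(2)[of p] by (simp only: power_mult_distrib power_even_eq)
  qed
  \<comment> \<open>For \<open>p \<ge> q\<close> the lower bound on the square root gives at most 1;
    the finitely many points \<open>s p\<close> with \<open>p < q\<close> are covered by the
    sum.\<close>
  have "w \<alpha> * a \<alpha> ^ q \<le> 1 + (\<Sum>p<q. \<bar>w (s p) * a (s p) ^ q\<bar>)" if \<alpha>: "\<alpha> \<in> ell A" for \<alpha> q
  proof (cases "\<alpha> \<in> range s")
    case True
    then obtain p where p: "\<alpha> = s p" by blast
    show ?thesis
    proof (cases "p < q")
      case True
      have "w (s p) * a (s p) ^ q \<le> \<bar>w (s p) * a (s p) ^ q\<bar>" by simp
      also have "\<dots> \<le> (\<Sum>p<q. \<bar>w (s p) * a (s p) ^ q\<bar>)"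
        by (rule member_le_sum) (use True in auto)
      finally show ?thesis by (simp add: p)
    next
      case False
      have "a \<alpha> ^ q \<le> a \<alpha> ^ p"
        using weight_ge_1[OF \<alpha>] False by (intro power_increasing) auto
      also have "\<dots> \<le> (real p + 1) * a \<alpha> ^ p" using weight_pos[OF \<alpha>] by simp
      also have "\<dots> < sqrt (cmod (f \<alpha>))" using lower[of p] p by simp
      finally have "a \<alpha> ^ q < sqrt (cmod (f \<alpha>))" .
      moreover have "0 < a \<alpha> ^ q" using weight_pos[OF \<alpha>] by simp
      ultimately have "w \<alpha> * a \<alpha> ^ q \<le> 1"
        by (simp add: w_def True divide_le_eq)
      moreover have "0 \<le> (\<Sum>p<q. \<bar>w (s p) * a (s p) ^ q\<bar>)" by (intro sum_nonneg) simp
      ultimately show ?thesis by linarith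
    qed
  next
    case False
    have "0 \<le> (\<Sum>p<q. \<bar>w (s p) * a (s p) ^ q\<bar>)" by (intro sum_nonneg) simp
    then show ?thesis using False by (simp add: w_def)
  qed
  then have "\<exists>K. \<forall>\<alpha>\<in>ell A. w \<alpha> * a \<alpha> ^ q \<le> K" for q by blast
  moreover have "0 \<le> w \<alpha>" for \<alpha> by (simp add: w_def)
  ultimately have "w \<in> rapid_weights A a" unfolding rapid_weights_def by blast
  then obtain K where K: "\<forall>\<alpha>\<in>ell A. cmod (f \<alpha>) * w \<alpha> \<le> K" using bound by blast
  \<comment> \<open>At \<open>s p\<close>, modulus times weight is the square root of the modulus,
    which exceeds \<open>p + 1\<close>.\<close>
  obtain p :: nat where p: "K < real p" using reals_Archimedean2 by blast
  have "1 \<le> a (s p) ^ p" using weight_ge_1[OF s(1)] by simp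
  then have "real p + 1 \<le> (real p + 1) * a (s p) ^ p" by (simp add: mult_le_cancel_left1)
  also have "\<dots> \<le> sqrt (cmod (f (s p)))" using lower by (rule less_imp_le)
  also have "\<dots> = cmod (f (s p)) * w (s p)" by (simp add: w_def real_div_sqrt)
  also have "\<dots> \<le> K" using K s(1) by blast
  finally show False using p by simp
qed

text \<open>The limit is taken coefficientwise, which gives no control on its growth. Both
  membership in the dual and convergence come from finite partial sums, whose Cauchy bounds survive
  the limit and do not depend on the finite set.\<close>

lemma complete_strong_dual: "complete_tvs (strong_dual A a)"
  unfolding complete_tvs_def
proof (intro allI impI)
  fix F assume "cauchy_filter_in (strong_dual A a) F"
  then have nb: "F \<noteq> bot" and dual: "eventually (\<lambda>g. g \<in> dual_space A a) F"
    and small: "\<And>U. openin (strong_dual A a) U \<Longrightarrow> (\<lambda>_. 0) \<in> U \<Longrightarrow>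
        \<exists>M. eventually (\<lambda>x. x \<in> M) F \<and> (\<forall>x\<in>M. \<forall>y\<in>M. (\<lambda>i. x i - y i) \<in> U)"
    unfolding cauchy_filter_in_def topspace_strong_dual le_principal by blast+
  have cauchy: "\<exists>M. eventually (\<lambda>x. x \<in> M) F \<and> M \<subseteq> dual_space A a \<and>
      (\<forall>x\<in>M. \<forall>y\<in>M. weighted_l1 A w (\<lambda>i. x i - y i) < \<epsilon>)"
    if w: "w \<in> rapid_weights A a" and \<epsilon>: "0 < \<epsilon>" for w \<epsilon>
  proof -
    let ?U = "{g \<in> dual_space A a. weighted_l1 A w (\<lambda>\<alpha>. g \<alpha> - 0) < \<epsilon>}"
    have z: "(\<lambda>_. 0) \<in> dual_space A a"
      by (rule family_subspace_zero[OF family_subspace_dual_space])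
    have "(\<lambda>_. 0) \<in> ?U"
      using z \<epsilon> seminorm_on_zero[OF family_subspace_dual_space seminorm_on_weighted_l1[OF w]] by simp
    then obtain M where M: "eventually (\<lambda>x. x \<in> M) F" "\<forall>x\<in>M. \<forall>y\<in>M. (\<lambda>i. x i - y i) \<in> ?U"
      using small[OF openin_weighted_l1_ball[OF z w \<epsilon>]] by blast
    show ?thesis
      using eventually_conj[OF M(1) dual] M(2)
      by (intro exI[of _ "M \<inter> dual_space A a"]) simp
  qed
  have "\<exists>l. ((\<lambda>g. g \<alpha>) \<longlongrightarrow> l) F" if \<alpha>: "\<alpha> \<in> ell A" for \<alpha>
  proof -
    have "cauchy_filter (filtermap (\<lambda>g. g \<alpha>) F)"
      unfolding cauchy_filter_iff
    proof (intro allI impI)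
      fix P :: "complex \<times> complex \<Rightarrow> bool" assume "eventually P uniformity"
      then obtain \<epsilon> where \<epsilon>: "\<epsilon> > 0" "\<And>x y. dist x y < \<epsilon> \<Longrightarrow> P (x, y)"
        unfolding eventually_uniformity_metric by blast
      obtain M where M: "eventually (\<lambda>x. x \<in> M) F" "M \<subseteq> dual_space A a"
        "\<forall>x\<in>M. \<forall>y\<in>M. weighted_l1 A (\<lambda>\<beta>. if \<beta> \<in> {\<alpha>} then 1 else 0) (\<lambda>i. x i - y i) < \<epsilon>"
        using cauchy[OF rapid_weights_finite_support[of "{\<alpha>}"] \<epsilon>(1)] by blast
      have "dist (x \<alpha>) (y \<alpha>) < \<epsilon>" if "x \<in> M" "y \<in> M" for x y
        using norm_coefficient_le[OF family_subspace_diff[OF family_subspace_dual_space, of x y] \<alpha>] M that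
        unfolding dist_norm by force
      then show "\<exists>X. eventually (\<lambda>x. x \<in> X) (filtermap (\<lambda>g. g \<alpha>) F) \<and> (\<forall>z\<in>X \<times> X. P z)"
        using M(1) \<epsilon>(2)
        by (intro exI[of _ "(\<lambda>g. g \<alpha>) ` M"]) (auto simp: eventually_filtermap elim: eventually_mono)
    qed
    then show ?thesis
      using cauchy_filter_convergent unfolding convergent_filter_iff filterlim_def by blast
  qed
  then obtain l where l: "\<And>\<alpha>. \<alpha> \<in> ell A \<Longrightarrow> ((\<lambda>g. g \<alpha>) \<longlongrightarrow> l \<alpha>) F" by metis
  define f where "f \<alpha> = (if \<alpha> \<in> ell A then l \<alpha> else 0)" for \<alpha>
  have lim: "((\<lambda>g. g \<alpha>) \<longlongrightarrow> f \<alpha>) F" if "\<alpha> \<in> ell A" for \<alpha>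
    using l[OF that] that by (simp add: f_def)
  \<comment> \<open>Only finitely many coefficients occur, so \<open>h\<close> may tend to
    \<open>f\<close> along the filter in the Cauchy bound for \<open>g - h\<close>.\<close>
  have near: "(\<Sum>\<alpha>\<in>X. cmod (g \<alpha> - f \<alpha>) * w \<alpha>) \<le> \<epsilon>"
    if w: "w \<in> rapid_weights A a" and M: "eventually (\<lambda>x. x \<in> M) F" "M \<subseteq> dual_space A a"
      "\<forall>x\<in>M. \<forall>y\<in>M. weighted_l1 A w (\<lambda>i. x i - y i) < \<epsilon>"
      and g: "g \<in> M" and X: "finite X" "X \<subseteq> ell A" for w \<epsilon> M g X
  proof (rule tendsto_upperbound[OF _ _ nb])
    show "((\<lambda>h. \<Sum>\<alpha>\<in>X. cmod (g \<alpha> - h \<alpha>) * w \<alpha>) \<longlongrightarrow> (\<Sum>\<alpha>\<in>X. cmod (g \<alpha> - f \<alpha>) * w \<alpha>)) F"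
      by (intro tendsto_intros lim) (use X in auto)
    show "eventually (\<lambda>h. (\<Sum>\<alpha>\<in>X. cmod (g \<alpha> - h \<alpha>) * w \<alpha>) \<le> \<epsilon>) F"
      using M(1)
    proof (rule eventually_mono)
      fix h assume h: "h \<in> M"
      have "(\<lambda>i. g i - h i) \<in> dual_space A a"
        using g h M(2) by (intro family_subspace_diff[OF family_subspace_dual_space]) auto
      then have "(\<Sum>\<alpha>\<in>X. cmod (g \<alpha> - h \<alpha>) * w \<alpha>) \<le> weighted_l1 A w (\<lambda>i. g i - h i)"
        by (rule finite_sum_le_weighted_l1) (use w X in auto)
      then show "(\<Sum>\<alpha>\<in>X. cmod (g \<alpha> - h \<alpha>) * w \<alpha>) \<le> \<epsilon>" using M(3) g h by fastforce
    qed
  qed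
  \<comment> \<open>Any member \<open>g\<close> of a Cauchy set of size 1 bounds \<open>f\<close>
    against \<open>w\<close>, up to 1; boundedness against all rapid weights forces polynomial
    growth.\<close>
  have f_dual: "f \<in> dual_space A a"
  proof (rule dual_spaceI_bounded)
    show "f \<in> families A" by (simp add: families_def f_def)
    fix w assume w: "w \<in> rapid_weights A a"
    obtain M where M: "eventually (\<lambda>x. x \<in> M) F" "M \<subseteq> dual_space A a"
      "\<forall>x\<in>M. \<forall>y\<in>M. weighted_l1 A w (\<lambda>i. x i - y i) < 1"
      using cauchy[OF w, of 1] by auto
    obtain g where g: "g \<in> M" using eventually_happens'[OF nb M(1)] by blast
    have "cmod (f \<alpha>) * w \<alpha> \<le> 1 + weighted_l1 A w g" if \<alpha>: "\<alpha> \<in> ell A" for \<alpha>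
    proof -
      have "cmod (f \<alpha>) \<le> cmod (g \<alpha> - f \<alpha>) + cmod (g \<alpha>)"
        by (metis norm_minus_commute norm_triangle_sub add.commute)
      then have "cmod (f \<alpha>) * w \<alpha> \<le> cmod (g \<alpha> - f \<alpha>) * w \<alpha> + cmod (g \<alpha>) * w \<alpha>"
        using mult_right_mono[OF _ rapid_weights_nonneg[OF w, of \<alpha>]] by (simp add: distrib_right[symmetric])
      moreover have "cmod (g \<alpha> - f \<alpha>) * w \<alpha> \<le> 1"
        using near[OF w M g, of "{\<alpha>}"] \<alpha> by simp
      moreover have "cmod (g \<alpha>) * w \<alpha> \<le> weighted_l1 A w g"
        by (rule coefficient_le_weighted_l1) (use g M w \<alpha> in auto)
      ultimately show ?thesis by linarith
    qed
    then show "\<exists>K. \<forall>\<alpha>\<in>ell A. cmod (f \<alpha>) * w \<alpha> \<le> K" by blast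
  qed
  have "limitin (strong_dual A a) (\<lambda>y. y) f F"
    unfolding limitin_def topspace_strong_dual
  proof (intro conjI allI impI f_dual)
    fix U assume "openin (strong_dual A a) U \<and> f \<in> U"
    then obtain w \<epsilon> where w: "w \<in> rapid_weights A a" and \<epsilon>: "\<epsilon> > 0"
      and U: "{g \<in> dual_space A a. weighted_l1 A w (\<lambda>\<alpha>. g \<alpha> - f \<alpha>) < \<epsilon>} \<subseteq> U"
      unfolding openin_strong_dual by blast
    obtain M where M: "eventually (\<lambda>x. x \<in> M) F" "M \<subseteq> dual_space A a"
      "\<forall>x\<in>M. \<forall>y\<in>M. weighted_l1 A w (\<lambda>i. x i - y i) < \<epsilon> / 2"
      using cauchy[OF w, of "\<epsilon> / 2"] \<epsilon> by auto
    show "eventually (\<lambda>y. y \<in> U) F"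
      using M(1)
    proof (rule eventually_mono)
      fix g assume g: "g \<in> M"
      have "(\<lambda>\<alpha>. g \<alpha> - f \<alpha>) \<in> dual_space A a"
        using g M(2) f_dual by (intro family_subspace_diff[OF family_subspace_dual_space]) auto
      then have "weighted_l1 A w (\<lambda>\<alpha>. g \<alpha> - f \<alpha>) \<le> \<epsilon> / 2"
        by (rule weighted_l1_le[OF _ w near[OF w M g]])
      then show "g \<in> U" using U g M(2) \<epsilon> by auto
    qed
  qed
  then show "\<exists>x. limitin (strong_dual A a) (\<lambda>y. y) x F" by blast
qed

text \<open>The constant of the domination is absorbed into the weight.\<close>

lemma continuous_seminorm_le_weighted_l1:
  assumes "s \<in> continuous_seminorms (strong_dual A a)"
  obtains w where "w \<in> rapid_weights A a" "\<And>f. f \<in> dual_space A a \<Longrightarrow> s f \<le> weighted_l1 A w f"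
proof -
  obtain u K where u: "u \<in> rapid_weights A a" and K: "K > 0"
    and le: "\<And>f. f \<in> dual_space A a \<Longrightarrow> s f \<le> K * weighted_l1 A u f"
    using continuous_seminorm_dominated[OF directed_seminorms_weighted_l1 assms[unfolded strong_dual_eq]]
    by blast
  have "weighted_l1 A (\<lambda>\<alpha>. K * u \<alpha>) f = K * weighted_l1 A u f" if "f \<in> dual_space A a" for f
    using infsum_cmult_right[OF weighted_l1_summable[OF that u], of K]
    by (simp add: weighted_l1_def mult.left_commute)
  then show ?thesis
    using that[OF rapid_weights_scale[OF u less_imp_le[OF K]]] le by simp
qed

lemma weighted_l1_continuous:
  assumes "w \<in> rapid_weights A a"
  shows "weighted_l1 A w \<in> continuous_seminorms (strong_dual A a)"
  unfolding strong_dual_eq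
  by (rule seminorm_topology_generator_continuous[OF family_subspace_dual_space])
     (use assms seminorm_on_weighted_l1 in auto)

end

lemma infsum_sum:
  fixes f :: "'a \<Rightarrow> 'b \<Rightarrow> real"
  assumes "finite F" "\<And>i. i \<in> F \<Longrightarrow> f i summable_on B"
  shows "(\<lambda>x. \<Sum>i\<in>F. f i x) summable_on B"
    and "(\<Sum>\<^sub>\<infinity>x\<in>B. \<Sum>i\<in>F. f i x) = (\<Sum>i\<in>F. infsum (f i) B)"
proof -
  have "((\<lambda>x. \<Sum>i\<in>F. f i x) has_sum (\<Sum>i\<in>F. infsum (f i) B)) B"
    using assms by (induction F rule: finite_induct) (auto intro!: has_sum_add)
  then show "(\<lambda>x. \<Sum>i\<in>F. f i x) summable_on B"
    and "(\<Sum>\<^sub>\<infinity>x\<in>B. \<Sum>i\<in>F. f i x) = (\<Sum>i\<in>F. infsum (f i) B)"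
    by (simp_all add: has_sum_imp_summable infsumI)
qed

section \<open>Projective seminorms\<close>

text \<open>The index set is arbitrary so that two representations can be concatenated over a
  disjoint sum \<open><+>\<close> without renumbering.\<close>

lemma tensor_span_sumI:
  assumes "finite I" "\<And>m. m \<in> I \<Longrightarrow> x m \<in> E" "\<And>m. m \<in> I \<Longrightarrow> y m \<in> F"
  shows "(\<lambda>k. \<Sum>m\<in>I. \<tau> (x m) (y m) k) \<in> tensor_span E F \<tau>"
proof -
  obtain h where h: "bij_betw h {0..<card I} I"
    using ex_bij_betw_nat_finite[OF assms(1)] by blast
  then have "(\<Sum>m<card I. \<tau> (x (h m)) (y (h m)) k) = (\<Sum>m\<in>I. \<tau> (x m) (y m) k)" for k
    unfolding lessThan_atLeast0 by (rule sum.reindex_bij_betw)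
  moreover have "\<forall>m<card I. x (h m) \<in> E \<and> y (h m) \<in> F"
    using bij_betwE[OF h] assms by auto
  ultimately show ?thesis
    unfolding tensor_span_def
    by (intro CollectI exI[of _ "card I"] exI[of _ "\<lambda>m. x (h m)"] exI[of _ "\<lambda>m. y (h m)"]) auto
qed

lemma tensor_spanE:
  assumes "u \<in> tensor_span E F \<tau>"
  obtains n :: nat and x y where "\<And>m. m < n \<Longrightarrow> x m \<in> E" "\<And>m. m < n \<Longrightarrow> y m \<in> F"
    "u = (\<lambda>k. \<Sum>m<n. \<tau> (x m) (y m) k)"
  using assms unfolding tensor_span_def by blast

text \<open>Sums concatenate two representations; scalars move into the left factor.\<close>

lemma family_subspace_tensor_span:
  assumes E: "family_subspace E" and \<tau>: "bilinear_families E F \<tau>"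
  shows "family_subspace (tensor_span E F \<tau>)"
  unfolding family_subspace_def
proof (intro conjI ballI allI)
  show "(\<lambda>_. 0) \<in> tensor_span E F \<tau>"
    using tensor_span_sumI[of "{} :: nat set"] by simp
next
  fix u v assume "u \<in> tensor_span E F \<tau>" "v \<in> tensor_span E F \<tau>"
  then obtain n x y n' x' y' where
    xy: "\<And>m. m < (n::nat) \<Longrightarrow> x m \<in> E" "\<And>m. m < n \<Longrightarrow> y m \<in> F" and u: "u = (\<lambda>k. \<Sum>m<n. \<tau> (x m) (y m) k)" and
    xy': "\<And>m. m < (n'::nat) \<Longrightarrow> x' m \<in> E" "\<And>m. m < n' \<Longrightarrow> y' m \<in> F" and v: "v = (\<lambda>k. \<Sum>m<n'. \<tau> (x' m) (y' m) k)"
    by (elim tensor_spanE) blast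
  have "(\<lambda>k. \<Sum>m\<in>{..<n} <+> {..<n'}. \<tau> (case_sum x x' m) (case_sum y y' m) k) \<in> tensor_span E F \<tau>"
    by (rule tensor_span_sumI) (use xy xy' in auto)
  then show "(\<lambda>i. u i + v i) \<in> tensor_span E F \<tau>" by (simp add: sum.Plus u v)
next
  fix c u assume "u \<in> tensor_span E F \<tau>"
  then obtain n x y where
    xy: "\<And>m. m < (n::nat) \<Longrightarrow> x m \<in> E" "\<And>m. m < n \<Longrightarrow> y m \<in> F" and u: "u = (\<lambda>k. \<Sum>m<n. \<tau> (x m) (y m) k)"
    by (elim tensor_spanE) blast
  have "(\<lambda>k. \<Sum>m<n. \<tau> (\<lambda>i. c * x m i) (y m) k) \<in> tensor_span E F \<tau>"
    by (rule tensor_span_sumI) (use xy family_subspace_scale[OF E] in auto)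
  moreover have "\<tau> (\<lambda>i. c * x m i) (y m) = (\<lambda>k. c * \<tau> (x m) (y m) k)" if "m < n" for m
    using \<tau> xy[OF that] unfolding bilinear_families_def by simp
  ultimately show "(\<lambda>i. c * u i) \<in> tensor_span E F \<tau>" by (simp add: u sum_distrib_left)
qed

context
  fixes E :: "('i \<Rightarrow> complex) set" and F :: "('j \<Rightarrow> complex) set"
    and \<tau> :: "('i \<Rightarrow> complex) \<Rightarrow> ('j \<Rightarrow> complex) \<Rightarrow> ('k \<Rightarrow> complex)"
    and p :: "('i \<Rightarrow> complex) \<Rightarrow> real" and q :: "('j \<Rightarrow> complex) \<Rightarrow> real"
  assumes p: "seminorm_on E p" and q: "seminorm_on F q"
begin

lemma proj_seminorm_costs_nonneg:
  assumes "r \<in> {(\<Sum>m<n. p (x m) * q (y m)) | (n::nat) x y.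
            (\<forall>m<n. x m \<in> E \<and> y m \<in> F) \<and> u = (\<lambda>k. \<Sum>m<n. \<tau> (x m) (y m) k)}"
  shows "0 \<le> r"
  using assms by (auto intro!: sum_nonneg mult_nonneg_nonneg seminorm_on_nonneg[OF p] seminorm_on_nonneg[OF q])

lemma proj_seminorm_le:
  assumes I: "finite I" and x: "\<And>m. m \<in> I \<Longrightarrow> x m \<in> E" and y: "\<And>m. m \<in> I \<Longrightarrow> y m \<in> F"
    and u: "u = (\<lambda>k. \<Sum>m\<in>I. \<tau> (x m) (y m) k)"
  shows "proj_seminorm E F \<tau> p q u \<le> (\<Sum>m\<in>I. p (x m) * q (y m))"
  unfolding proj_seminorm_def
proof (rule cInf_lower)
  obtain h where h: "bij_betw h {0..<card I} I"
    using ex_bij_betw_nat_finite[OF I] by blast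
  have "(\<Sum>m<card I. \<tau> (x (h m)) (y (h m)) k) = (\<Sum>m\<in>I. \<tau> (x m) (y m) k)" for k
    unfolding lessThan_atLeast0 using h by (rule sum.reindex_bij_betw)
  moreover have "(\<Sum>m<card I. p (x (h m)) * q (y (h m))) = (\<Sum>m\<in>I. p (x m) * q (y m))"
    unfolding lessThan_atLeast0 using h by (rule sum.reindex_bij_betw)
  moreover have "\<forall>m<card I. x (h m) \<in> E \<and> y (h m) \<in> F"
    using bij_betwE[OF h] x y by auto
  ultimately show "(\<Sum>m\<in>I. p (x m) * q (y m)) \<in> {(\<Sum>m<n. p (x m) * q (y m)) | (n::nat) x y.
            (\<forall>m<n. x m \<in> E \<and> y m \<in> F) \<and> u = (\<lambda>k. \<Sum>m<n. \<tau> (x m) (y m) k)}"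
    unfolding u
    by (intro CollectI exI[of _ "card I"] exI[of _ "\<lambda>m. x (h m)"] exI[of _ "\<lambda>m. y (h m)"]) auto
qed (rule bdd_belowI[of _ 0], erule proj_seminorm_costs_nonneg)

lemma proj_seminorm_greatest:
  assumes u: "u \<in> tensor_span E F \<tau>"
    and le: "\<And>(n::nat) x y. (\<And>m. m < n \<Longrightarrow> x m \<in> E) \<Longrightarrow> (\<And>m. m < n \<Longrightarrow> y m \<in> F) \<Longrightarrow>
        u = (\<lambda>k. \<Sum>m<n. \<tau> (x m) (y m) k) \<Longrightarrow> r \<le> (\<Sum>m<n. p (x m) * q (y m))"
  shows "r \<le> proj_seminorm E F \<tau> p q u"
  unfolding proj_seminorm_def
proof (rule cInf_greatest)
  show "{(\<Sum>m<n. p (x m) * q (y m)) | (n::nat) x y.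
            (\<forall>m<n. x m \<in> E \<and> y m \<in> F) \<and> u = (\<lambda>k. \<Sum>m<n. \<tau> (x m) (y m) k)} \<noteq> {}"
    using u unfolding tensor_span_def by blast
qed (use le in blast)

lemma proj_seminorm_approx:
  assumes u: "u \<in> tensor_span E F \<tau>" and \<epsilon>: "0 < \<epsilon>"
  obtains n :: nat and x y where "\<And>m. m < n \<Longrightarrow> x m \<in> E" "\<And>m. m < n \<Longrightarrow> y m \<in> F"
    "u = (\<lambda>k. \<Sum>m<n. \<tau> (x m) (y m) k)" "(\<Sum>m<n. p (x m) * q (y m)) < proj_seminorm E F \<tau> p q u + \<epsilon>"
proof (rule ccontr)
  assume neg: "\<not> thesis"
  have "proj_seminorm E F \<tau> p q u + \<epsilon> \<le> proj_seminorm E F \<tau> p q u"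
  proof (rule proj_seminorm_greatest[OF u], rule ccontr)
    fix n :: nat and x y
    assume x: "\<And>m. m < n \<Longrightarrow> x m \<in> E" and y: "\<And>m. m < n \<Longrightarrow> y m \<in> F"
      and u: "u = (\<lambda>k. \<Sum>m<n. \<tau> (x m) (y m) k)"
      and less: "\<not> proj_seminorm E F \<tau> p q u + \<epsilon> \<le> (\<Sum>m<n. p (x m) * q (y m))"
    have thesis by (rule that[OF x y u less[unfolded not_le]])
    with neg show False ..
  qed
  then show False using \<epsilon> by simp
qed

text \<open>All estimates take representations that are optimal up to an error. Subadditivity
  concatenates two of them; homogeneity is one upper bound applied to \<open>c\<close> and to
  \<open>1 / c\<close>.\<close>

lemma seminorm_on_proj_seminorm:
  assumes E: "family_subspace E" and \<tau>: "bilinear_families E F \<tau>"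
  shows "seminorm_on (tensor_span E F \<tau>) (proj_seminorm E F \<tau> p q)"
  unfolding seminorm_on_def
proof (intro conjI ballI allI)
  let ?\<pi> = "proj_seminorm E F \<tau> p q"
  note sub = family_subspace_tensor_span[OF E \<tau>]
  have nonneg: "0 \<le> ?\<pi> u" if "u \<in> tensor_span E F \<tau>" for u
    using that by (rule proj_seminorm_greatest)
      (auto intro!: sum_nonneg mult_nonneg_nonneg seminorm_on_nonneg[OF p] seminorm_on_nonneg[OF q])
  show "0 \<le> ?\<pi> u" if "u \<in> tensor_span E F \<tau>" for u using that by (rule nonneg)
  have scale: "?\<pi> (\<lambda>i. c * u i) \<le> cmod c * ?\<pi> u" if u: "u \<in> tensor_span E F \<tau>" for c u
  proof (rule field_le_epsilon)
    fix \<epsilon> :: real assume \<epsilon>: "0 < \<epsilon>"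
    \<comment> \<open>The summand 1 keeps the denominator positive when
      \<open>c = 0\<close>.\<close>
    define \<delta> where "\<delta> = \<epsilon> / (cmod c + 1)"
    have pos: "cmod c + 1 > 0" using norm_ge_zero[of c] by linarith
    then have \<delta>: "\<delta> > 0" using \<epsilon> by (simp add: \<delta>_def)
    obtain n x y where xy: "\<And>m. m < (n::nat) \<Longrightarrow> x m \<in> E" "\<And>m. m < n \<Longrightarrow> y m \<in> F"
      and u_eq: "u = (\<lambda>k. \<Sum>m<n. \<tau> (x m) (y m) k)" and cost: "(\<Sum>m<n. p (x m) * q (y m)) < ?\<pi> u + \<delta>"
      using proj_seminorm_approx[OF u \<delta>] by blast
    have "\<tau> (\<lambda>i. c * x m i) (y m) = (\<lambda>k. c * \<tau> (x m) (y m) k)" if "m < n" for m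
      using \<tau> xy[OF that] unfolding bilinear_families_def by simp
    then have "(\<lambda>i. c * u i) = (\<lambda>k. \<Sum>m<n. \<tau> (\<lambda>i. c * x m i) (y m) k)"
      by (simp add: u_eq sum_distrib_left)
    then have "?\<pi> (\<lambda>i. c * u i) \<le> (\<Sum>m<n. p (\<lambda>i. c * x m i) * q (y m))"
      by (intro proj_seminorm_le) (use xy family_subspace_scale[OF E] in auto)
    also have "\<dots> = cmod c * (\<Sum>m<n. p (x m) * q (y m))"
      unfolding sum_distrib_left
      by (rule sum.cong) (use seminorm_on_scale[OF p xy(1)] in \<open>auto simp: mult.assoc\<close>)
    also have "\<dots> \<le> cmod c * (?\<pi> u + \<delta>)" using cost by (intro mult_left_mono) auto
    also have "\<dots> \<le> cmod c * ?\<pi> u + \<epsilon>"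
      using pos \<epsilon> by (simp add: \<delta>_def distrib_left divide_le_eq field_simps)
    finally show "?\<pi> (\<lambda>i. c * u i) \<le> cmod c * ?\<pi> u + \<epsilon>" .
  qed
  show "?\<pi> (\<lambda>i. c * u i) = cmod c * ?\<pi> u" if u: "u \<in> tensor_span E F \<tau>" for c u
  proof (rule antisym[OF scale[OF u]])
    have cu: "(\<lambda>i. c * u i) \<in> tensor_span E F \<tau>" using sub u by (rule family_subspace_scale)
    show "cmod c * ?\<pi> u \<le> ?\<pi> (\<lambda>i. c * u i)"
    proof (cases "c = 0")
      case True
      then show ?thesis using nonneg[OF cu] by simp
    next
      case False
      then have "?\<pi> u \<le> cmod (1 / c) * ?\<pi> (\<lambda>i. c * u i)"
        using scale[OF cu, of "1 / c"] by simp
      then show ?thesis using False by (simp add: norm_divide field_simps)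
    qed
  qed
  show "?\<pi> (\<lambda>i. u i + v i) \<le> ?\<pi> u + ?\<pi> v"
    if uv: "u \<in> tensor_span E F \<tau>" "v \<in> tensor_span E F \<tau>" for u v
  proof (rule field_le_epsilon)
    fix \<epsilon> :: real assume "0 < \<epsilon>"
    then have \<epsilon>: "0 < \<epsilon> / 2" by simp
    obtain n x y where xy: "\<And>m. m < (n::nat) \<Longrightarrow> x m \<in> E" "\<And>m. m < n \<Longrightarrow> y m \<in> F"
      and u: "u = (\<lambda>k. \<Sum>m<n. \<tau> (x m) (y m) k)" and cost: "(\<Sum>m<n. p (x m) * q (y m)) < ?\<pi> u + \<epsilon> / 2"
      using proj_seminorm_approx[OF uv(1) \<epsilon>] by blast
    obtain n' x' y' where xy': "\<And>m. m < (n'::nat) \<Longrightarrow> x' m \<in> E" "\<And>m. m < n' \<Longrightarrow> y' m \<in> F"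
      and v: "v = (\<lambda>k. \<Sum>m<n'. \<tau> (x' m) (y' m) k)" and cost': "(\<Sum>m<n'. p (x' m) * q (y' m)) < ?\<pi> v + \<epsilon> / 2"
      using proj_seminorm_approx[OF uv(2) \<epsilon>] by blast
    have "?\<pi> (\<lambda>i. u i + v i) \<le> (\<Sum>m\<in>{..<n} <+> {..<n'}. p (case_sum x x' m) * q (case_sum y y' m))"
      by (rule proj_seminorm_le) (use xy xy' in \<open>auto simp: sum.Plus u v\<close>)
    also have "\<dots> = (\<Sum>m<n. p (x m) * q (y m)) + (\<Sum>m<n'. p (x' m) * q (y' m))"
      by (simp add: sum.Plus)
    finally show "?\<pi> (\<lambda>i. u i + v i) \<le> ?\<pi> u + ?\<pi> v + \<epsilon>" using cost cost' by simp
  qed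
qed

end

section \<open>Products of weights\<close>

text \<open>The tensor product of two real functions, read on joint indices. It is applied to the
  defining weights, to rapid weights and to whole summands of weighted norms.\<close>

definition product_weight :: "(mindex \<Rightarrow> real) \<Rightarrow> (mindex \<Rightarrow> real) \<Rightarrow> mindex \<Rightarrow> real" where
  "product_weight u v \<gamma> = u (odd_part \<gamma>) * v (even_part \<gamma>)"

text \<open>Positivity excludes the index 0, where on \<open>nat\<close> both \<open>2 * n\<close>
  and \<open>2 * n - 1\<close> are 0 and the odd and even positions would collide.\<close>

locale index_pair =
  fixes A B :: "nat set"
  assumes index_pos: "A \<subseteq> {1..}" "B \<subseteq> {1..}"
begin

abbreviation "C \<equiv> joint_index A B"

lemma parts_in_ell: "\<gamma> \<in> ell C \<Longrightarrow> odd_part \<gamma> \<in> ell A" "\<gamma> \<in> ell C \<Longrightarrow> even_part \<gamma> \<in> ell B"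
  using bij_betwE[OF bij_betw_ell_joint_index[OF index_pos]] by auto

lemma parts_inject:
  "\<gamma> \<in> ell C \<Longrightarrow> \<delta> \<in> ell C \<Longrightarrow> odd_part \<gamma> = odd_part \<delta> \<Longrightarrow> even_part \<gamma> = even_part \<delta> \<Longrightarrow> \<gamma> = \<delta>"
  using bij_betw_imp_inj_on[OF bij_betw_ell_joint_index[OF index_pos]] unfolding inj_on_def by blast

lemma obtain_joint:
  assumes "\<alpha> \<in> ell A" "\<beta> \<in> ell B"
  obtains \<gamma> where "\<gamma> \<in> ell C" "odd_part \<gamma> = \<alpha>" "even_part \<gamma> = \<beta>"
proof -
  have "(\<alpha>, \<beta>) \<in> (\<lambda>\<gamma>. (odd_part \<gamma>, even_part \<gamma>)) ` ell C"
    using assms bij_betw_imp_surj_on[OF bij_betw_ell_joint_index[OF index_pos]] by auto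
  then show ?thesis using that by auto
qed

text \<open>A finite set of pairs lies in the rectangle of its projections, over which the sum
  factors.\<close>

lemma sum_product_weight_le:
  assumes X: "finite X" "X \<subseteq> ell C"
    and u: "\<And>\<alpha>. \<alpha> \<in> ell A \<Longrightarrow> 0 \<le> u \<alpha>" and v: "\<And>\<beta>. \<beta> \<in> ell B \<Longrightarrow> 0 \<le> v \<beta>"
  shows "(\<Sum>\<gamma>\<in>X. product_weight u v \<gamma>) \<le> (\<Sum>\<alpha>\<in>odd_part ` X. u \<alpha>) * (\<Sum>\<beta>\<in>even_part ` X. v \<beta>)"
proof -
  let ?h = "\<lambda>\<gamma>. (odd_part \<gamma>, even_part \<gamma>)"
  have "inj_on ?h X" using X(2) parts_inject by (auto simp: inj_on_def)
  then have "(\<Sum>\<gamma>\<in>X. product_weight u v \<gamma>) = (\<Sum>(\<alpha>, \<beta>)\<in>?h ` X. u \<alpha> * v \<beta>)"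
    by (simp add: sum.reindex product_weight_def)
  also have "\<dots> \<le> (\<Sum>(\<alpha>, \<beta>)\<in>odd_part ` X \<times> even_part ` X. u \<alpha> * v \<beta>)"
    by (rule sum_mono2) (use X parts_in_ell u v in \<open>auto simp: subset_iff\<close>)
  finally show ?thesis by (simp add: sum_product sum.cartesian_product)
qed

text \<open>The counterpart in the other direction: a finite rectangle is exhausted by joint
  indices, so a double sum becomes a partial sum over \<open>ell C\<close>.\<close>

lemma obtain_joint_rectangle:
  assumes "finite F" "F \<subseteq> ell A" "finite G" "G \<subseteq> ell B"
  obtains X where "finite X" "X \<subseteq> ell C"
    "\<And>f. (\<Sum>\<gamma>\<in>X. f (odd_part \<gamma>) (even_part \<gamma>)) = (\<Sum>\<alpha>\<in>F. \<Sum>\<beta>\<in>G. f \<alpha> \<beta> :: real)"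
proof -
  let ?h = "\<lambda>\<gamma>. (odd_part \<gamma>, even_part \<gamma>)"
  define X where "X = {\<gamma> \<in> ell C. odd_part \<gamma> \<in> F \<and> even_part \<gamma> \<in> G}"
  have "(\<alpha>, \<beta>) \<in> ?h ` X" if "\<alpha> \<in> F" "\<beta> \<in> G" for \<alpha> \<beta>
  proof -
    have "\<alpha> \<in> ell A" "\<beta> \<in> ell B" using that assms by blast+
    then obtain \<gamma> where "\<gamma> \<in> ell C" "odd_part \<gamma> = \<alpha>" "even_part \<gamma> = \<beta>"
      by (rule obtain_joint)
    then show ?thesis using that by (intro image_eqI[of _ _ \<gamma>]) (auto simp: X_def)
  qed
  then have X: "X \<subseteq> ell C" "?h ` X = F \<times> G" by (auto simp: X_def)
  have inj: "inj_on ?h X" using X(1) parts_inject by (auto simp: inj_on_def)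
  have "finite (?h ` X)" using X(2) assms by simp
  then have fin: "finite X" using inj by (rule finite_imageD)
  have "(\<Sum>\<gamma>\<in>X. f (odd_part \<gamma>) (even_part \<gamma>)) = (\<Sum>\<alpha>\<in>F. \<Sum>\<beta>\<in>G. f \<alpha> \<beta>)" for f :: "mindex \<Rightarrow> mindex \<Rightarrow> real"
  proof -
    have "(\<Sum>\<alpha>\<in>F. \<Sum>\<beta>\<in>G. f \<alpha> \<beta>) = (\<Sum>(\<alpha>, \<beta>)\<in>?h ` X. f \<alpha> \<beta>)"
      unfolding X(2) by (rule sum.cartesian_product)
    then show ?thesis using inj by (simp add: sum.reindex)
  qed
  then show ?thesis using that fin X(1) by blast
qed

lemma bilinear_families_tensor: "bilinear_families E F (tensor A B)"
  unfolding bilinear_families_def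
  by (intro conjI ballI allI ext) (simp_all add: tensor_def algebra_simps)

end

locale nuclear_weight_pair =
  index_pair A B + A: nuclear_weight A a d + B: nuclear_weight B b e
  for A B a b d e
begin

abbreviation "c \<equiv> product_weight a b"
abbreviation "DA \<equiv> dual_space A a"
abbreviation "DB \<equiv> dual_space B b"
abbreviation "T \<equiv> tensor A B"

end

text \<open>Both weights are at least 1, so \<open>c ^ (d + e)\<close> is at least the product of
  \<open>a ^ d\<close> and \<open>b ^ e\<close>, and finite sums are bounded by the product of the
  two given sums.\<close>

sublocale nuclear_weight_pair \<subseteq> C: nuclear_weight "joint_index A B" "product_weight a b" "d + e"
proof
  show "1 \<le> c \<gamma>" if "\<gamma> \<in> ell C" for \<gamma>
    unfolding product_weight_def
    using mult_mono[OF A.weight_ge_1[OF parts_in_ell(1)[OF that]] B.weight_ge_1[OF parts_in_ell(2)[OF that]]]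
      A.weight_pos[OF parts_in_ell(1)[OF that]] by simp
  show "(\<lambda>\<gamma>. 1 / c \<gamma> ^ (d + e)) summable_on ell C"
  proof (rule nonneg_bdd_above_summable_on)
    show "0 \<le> 1 / c \<gamma> ^ (d + e)" if "\<gamma> \<in> ell C" for \<gamma>
      using A.weight_pos[OF parts_in_ell(1)[OF that]] B.weight_pos[OF parts_in_ell(2)[OF that]]
      by (simp add: product_weight_def)
    let ?S = "infsum (\<lambda>\<alpha>. 1 / a \<alpha> ^ d) (ell A)" and ?R = "infsum (\<lambda>\<beta>. 1 / b \<beta> ^ e) (ell B)"
    show "bdd_above (sum (\<lambda>\<gamma>. 1 / c \<gamma> ^ (d + e)) ` {F. F \<subseteq> ell C \<and> finite F})"
    proof (intro bdd_aboveI[of _ "?S * ?R"], clarify)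
      fix X assume X: "X \<subseteq> ell C" "finite X"
      have an: "0 \<le> 1 / a \<alpha> ^ d" if "\<alpha> \<in> ell A" for \<alpha> using A.weight_pos[OF that] by simp
      have bn: "0 \<le> 1 / b \<beta> ^ e" if "\<beta> \<in> ell B" for \<beta> using B.weight_pos[OF that] by simp
      have "(\<Sum>\<gamma>\<in>X. 1 / c \<gamma> ^ (d + e)) \<le> (\<Sum>\<gamma>\<in>X. product_weight (\<lambda>\<alpha>. 1 / a \<alpha> ^ d) (\<lambda>\<beta>. 1 / b \<beta> ^ e) \<gamma>)"
      proof (rule sum_mono)
        fix \<gamma> assume "\<gamma> \<in> X"
        then have \<gamma>: "odd_part \<gamma> \<in> ell A" "even_part \<gamma> \<in> ell B" using X parts_in_ell by blast+
        have "a (odd_part \<gamma>) ^ d * b (even_part \<gamma>) ^ e \<le> a (odd_part \<gamma>) ^ (d + e) * b (even_part \<gamma>) ^ (d + e)"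
          using A.weight_ge_1[OF \<gamma>(1)] B.weight_ge_1[OF \<gamma>(2)]
          by (intro mult_mono power_increasing) auto
        then show "1 / c \<gamma> ^ (d + e) \<le> product_weight (\<lambda>\<alpha>. 1 / a \<alpha> ^ d) (\<lambda>\<beta>. 1 / b \<beta> ^ e) \<gamma>"
          using A.weight_pos[OF \<gamma>(1)] B.weight_pos[OF \<gamma>(2)]
          by (simp add: product_weight_def power_mult_distrib frac_le)
      qed
      also have "\<dots> \<le> (\<Sum>\<alpha>\<in>odd_part ` X. 1 / a \<alpha> ^ d) * (\<Sum>\<beta>\<in>even_part ` X. 1 / b \<beta> ^ e)"
        by (rule sum_product_weight_le) (use X an bn in auto)
      also have "\<dots> \<le> ?S * ?R"
      proof (rule mult_mono)
        show "(\<Sum>\<alpha>\<in>odd_part ` X. 1 / a \<alpha> ^ d) \<le> ?S"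
          by (rule finite_sum_le_infsum[OF A.weight_summable]) (use X parts_in_ell an in auto)
        show "(\<Sum>\<beta>\<in>even_part ` X. 1 / b \<beta> ^ e) \<le> ?R"
          by (rule finite_sum_le_infsum[OF B.weight_summable]) (use X parts_in_ell bn in auto)
        show "0 \<le> ?S" by (intro infsum_nonneg an)
        show "0 \<le> (\<Sum>\<beta>\<in>even_part ` X. 1 / b \<beta> ^ e)"
          by (rule sum_nonneg) (use X parts_in_ell bn in auto)
      qed
      finally show "(\<Sum>\<gamma>\<in>X. 1 / c \<gamma> ^ (d + e)) \<le> ?S * ?R" .
    qed
  qed
qed

section \<open>The algebraic tensor product inside the dual of the product weight\<close>

context nuclear_weight_pair
begin

abbreviation "DC \<equiv> dual_space C c"

lemma tensor_in_dual_space: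
  assumes f: "f \<in> DA" and g: "g \<in> DB"
  shows "T f g \<in> DC"
proof -
  obtain p K where K: "0 \<le> K" "\<And>\<alpha>. \<alpha> \<in> ell A \<Longrightarrow> cmod (f \<alpha>) \<le> K * a \<alpha> ^ p"
    using f by (rule A.dual_spaceE) blast
  obtain q L where L: "0 \<le> L" "\<And>\<beta>. \<beta> \<in> ell B \<Longrightarrow> cmod (g \<beta>) \<le> L * b \<beta> ^ q"
    using g by (rule B.dual_spaceE) blast
  have "cmod (T f g \<gamma>) \<le> (K * L) * c \<gamma> ^ (p + q)" if "\<gamma> \<in> ell C" for \<gamma>
  proof -
    have \<gamma>: "odd_part \<gamma> \<in> ell A" "even_part \<gamma> \<in> ell B" using that parts_in_ell by blast+
    note pos = A.weight_pos[OF \<gamma>(1)] B.weight_pos[OF \<gamma>(2)]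
    have "cmod (T f g \<gamma>) = cmod (f (odd_part \<gamma>)) * cmod (g (even_part \<gamma>))"
      using that by (simp add: tensor_def norm_mult)
    also have "\<dots> \<le> (K * a (odd_part \<gamma>) ^ p) * (L * b (even_part \<gamma>) ^ q)"
      by (intro mult_mono K(2) L(2) \<gamma>) (use K(1) pos in auto)
    also have "\<dots> = (K * L) * (a (odd_part \<gamma>) ^ p * b (even_part \<gamma>) ^ q)" by simp
    also have "\<dots> \<le> (K * L) * (a (odd_part \<gamma>) ^ (p + q) * b (even_part \<gamma>) ^ (p + q))"
      using A.weight_ge_1[OF \<gamma>(1)] B.weight_ge_1[OF \<gamma>(2)] K(1) L(1)
      by (intro mult_left_mono mult_mono power_increasing) auto
    finally show ?thesis by (simp add: product_weight_def power_mult_distrib)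
  qed
  then show ?thesis unfolding C.dual_space_iff by (auto simp: families_def tensor_def)
qed

lemma family_subspace_span: "family_subspace (tensor_span DA DB T)"
  by (rule family_subspace_tensor_span[OF A.family_subspace_dual_space bilinear_families_tensor])

lemma tensor_span_subset: "tensor_span DA DB T \<subseteq> DC"
proof
  fix z assume "z \<in> tensor_span DA DB T"
  then obtain n x y where "\<And>m. m < (n::nat) \<Longrightarrow> x m \<in> DA" "\<And>m. m < n \<Longrightarrow> y m \<in> DB"
    and z: "z = (\<lambda>k. \<Sum>m<n. T (x m) (y m) k)" by (elim tensor_spanE) blast
  then show "z \<in> DC" unfolding z
    by (intro family_subspace_sum[OF C.family_subspace_dual_space] tensor_in_dual_space) auto
qed

text \<open>With the second index \<beta> fixed, a vanishing sum of elementary tensors is a linear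
  relation among the \<open>x m\<close> with coefficients \<open>y m \<beta>\<close>; symmetrically
  for the first index.\<close>

lemma is_tensor_product_tensor: "is_tensor_product DA DB T (tensor_span DA DB T)"
  unfolding is_tensor_product_def
proof (intro conjI allI impI bilinear_families_tensor refl)
  fix n :: nat and x y :: "nat \<Rightarrow> family"
  assume "(\<forall>m<n. x m \<in> DA \<and> y m \<in> DB) \<and> (\<lambda>k. \<Sum>m<n. T (x m) (y m) k) = (\<lambda>_. 0)"
  then have x: "\<And>m. m < n \<Longrightarrow> x m \<in> DA" and y: "\<And>m. m < n \<Longrightarrow> y m \<in> DB"
    and z: "\<And>\<gamma>. (\<Sum>m<n. T (x m) (y m) \<gamma>) = 0" by (auto simp: fun_eq_iff)
  have x0: "x m \<alpha> = 0" if "m < n" "\<alpha> \<notin> ell A" for m \<alpha>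
    using A.dual_space_families[OF x[OF that(1)]] that by (simp add: families_def)
  have y0: "y m \<beta> = 0" if "m < n" "\<beta> \<notin> ell B" for m \<beta>
    using B.dual_space_families[OF y[OF that(1)]] that by (simp add: families_def)
  have 0: "(\<Sum>m<n. x m \<alpha> * y m \<beta>) = 0" for \<alpha> \<beta>
  proof (cases "\<alpha> \<in> ell A \<and> \<beta> \<in> ell B")
    case True
    then obtain \<gamma> where \<gamma>: "\<gamma> \<in> ell C" "odd_part \<gamma> = \<alpha>" "even_part \<gamma> = \<beta>" using obtain_joint by blast
    then show ?thesis using z[of \<gamma>] by (simp add: tensor_def)
  next
    case False
    then show ?thesis using x0 y0 by (intro sum.neutral) auto
  qed
  show "y m = (\<lambda>_. 0)" if "lin_indep n x" "m < n" for m
  proof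
    fix \<beta>
    have "(\<lambda>i. \<Sum>m<n. y m \<beta> * x m i) = (\<lambda>_. 0)" using 0 by (simp add: mult.commute)
    then show "y m \<beta> = 0"
      using that(1)[unfolded lin_indep_def, rule_format, of "\<lambda>m. y m \<beta>"] that(2) by blast
  qed
  show "x m = (\<lambda>_. 0)" if "lin_indep n y" "m < n" for m
  proof
    fix \<alpha>
    have "(\<lambda>i. \<Sum>m<n. x m \<alpha> * y m i) = (\<lambda>_. 0)" using 0 by simp
    then show "x m \<alpha> = 0"
      using that(1)[unfolded lin_indep_def, rule_format, of "\<lambda>m. x m \<alpha>"] that(2) by blast
  qed
qed

section \<open>Projective seminorms against weighted l1 norms\<close>

lemma product_weight_rapid:
  assumes u: "u \<in> rapid_weights A a" and v: "v \<in> rapid_weights B b"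
  shows "product_weight u v \<in> rapid_weights C c"
proof -
  have "\<exists>K. \<forall>\<gamma>\<in>ell C. product_weight u v \<gamma> * c \<gamma> ^ p \<le> K" for p
  proof -
    obtain K where K: "0 \<le> K" "\<And>\<alpha>. \<alpha> \<in> ell A \<Longrightarrow> u \<alpha> * a \<alpha> ^ p \<le> K"
      using u by (rule rapid_weightsE) blast
    obtain L where L: "0 \<le> L" "\<And>\<beta>. \<beta> \<in> ell B \<Longrightarrow> v \<beta> * b \<beta> ^ p \<le> L"
      using v by (rule rapid_weightsE) blast
    have "product_weight u v \<gamma> * c \<gamma> ^ p \<le> K * L" if "\<gamma> \<in> ell C" for \<gamma>
    proof -
      have \<gamma>: "odd_part \<gamma> \<in> ell A" "even_part \<gamma> \<in> ell B" using that parts_in_ell by blast+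
      have "(u (odd_part \<gamma>) * a (odd_part \<gamma>) ^ p) * (v (even_part \<gamma>) * b (even_part \<gamma>) ^ p) \<le> K * L"
        by (intro mult_mono K L \<gamma>)
           (use rapid_weights_nonneg[OF v] B.weight_pos[OF \<gamma>(2)] in auto)
      then show ?thesis by (simp add: product_weight_def power_mult_distrib ac_simps)
    qed
    then show ?thesis by blast
  qed
  then show ?thesis
    using rapid_weights_nonneg[OF u] rapid_weights_nonneg[OF v]
    by (simp add: rapid_weights_def product_weight_def)
qed

text \<open>
  The two factors are the suprema of \<open>sqrt w\<close> over the other variable.
\<close>

lemma rapid_weights_product_dominating:
  assumes w: "w \<in> rapid_weights C c"
  obtains u v where "u \<in> rapid_weights A a" "v \<in> rapid_weights B b"
    "\<And>\<gamma>. \<gamma> \<in> ell C \<Longrightarrow> w \<gamma> \<le> product_weight u v \<gamma>"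
proof -
  \<comment> \<open>The joint index of a pair; by injectivity it recovers every element of
    \<open>ell C\<close> from its parts.\<close>
  define J where "J \<alpha> \<beta> = (SOME \<gamma>. \<gamma> \<in> ell C \<and> odd_part \<gamma> = \<alpha> \<and> even_part \<gamma> = \<beta>)" for \<alpha> \<beta>
  have J: "J \<alpha> \<beta> \<in> ell C \<and> odd_part (J \<alpha> \<beta>) = \<alpha> \<and> even_part (J \<alpha> \<beta>) = \<beta>"
    if "\<alpha> \<in> ell A" "\<beta> \<in> ell B" for \<alpha> \<beta>
    unfolding J_def using obtain_joint[OF that] by (intro someI_ex[of "\<lambda>\<gamma>. \<gamma> \<in> ell C \<and> odd_part \<gamma> = \<alpha> \<and> even_part \<gamma> = \<beta>"]) blast
  have 0: "0 \<in> ell A" "0 \<in> ell B" by (auto simp: ell_def)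
  \<comment> \<open>The square root halves the exponent, hence the decay of order
    \<open>2 * p\<close>.\<close>
  have bound: "\<exists>K. \<forall>\<alpha>\<in>ell A. \<forall>\<beta>\<in>ell B. sqrt (w (J \<alpha> \<beta>)) * (a \<alpha> ^ p * b \<beta> ^ p) \<le> K" for p
  proof -
    obtain K where K: "\<And>\<gamma>. \<gamma> \<in> ell C \<Longrightarrow> w \<gamma> * c \<gamma> ^ (2 * p) \<le> K"
      using w by (rule rapid_weightsE) blast
    have "sqrt (w (J \<alpha> \<beta>)) * (a \<alpha> ^ p * b \<beta> ^ p) \<le> sqrt K" if "\<alpha> \<in> ell A" "\<beta> \<in> ell B" for \<alpha> \<beta>
    proof -
      have "c (J \<alpha> \<beta>) = a \<alpha> * b \<beta>" using J[OF that] by (simp add: product_weight_def)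
      then have "w (J \<alpha> \<beta>) * (a \<alpha> ^ p * b \<beta> ^ p)\<^sup>2 \<le> K"
        using K[of "J \<alpha> \<beta>"] J[OF that] by (simp add: power_mult_distrib power_even_eq)
      then have "sqrt (w (J \<alpha> \<beta>) * (a \<alpha> ^ p * b \<beta> ^ p)\<^sup>2) \<le> sqrt K" by (rule real_sqrt_le_mono)
      then show ?thesis
        using A.weight_pos[OF that(1)] B.weight_pos[OF that(2)] by (simp add: real_sqrt_mult)
    qed
    then show ?thesis by blast
  qed
  have "\<exists>K. \<forall>\<beta>\<in>ell B. \<forall>\<alpha>\<in>ell A. sqrt (w (J \<alpha> \<beta>)) * a \<alpha> ^ p \<le> K" for p
  proof -
    obtain K where K: "\<forall>\<alpha>\<in>ell A. \<forall>\<beta>\<in>ell B. sqrt (w (J \<alpha> \<beta>)) * (a \<alpha> ^ p * b \<beta> ^ p) \<le> K"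
      using bound by blast
    have "sqrt (w (J \<alpha> \<beta>)) * a \<alpha> ^ p \<le> sqrt (w (J \<alpha> \<beta>)) * (a \<alpha> ^ p * b \<beta> ^ p)" if "\<alpha> \<in> ell A" "\<beta> \<in> ell B" for \<alpha> \<beta>
      using A.weight_pos[OF that(1)] one_le_power[OF B.weight_ge_1[OF that(2)], of p] rapid_weights_nonneg[OF w]
      by (intro mult_left_mono) (auto simp: mult_le_cancel_left1)
    then show ?thesis using K by (meson order_trans)
  qed
  then obtain u where u: "u \<in> rapid_weights A a"
    "\<And>\<beta> \<alpha>. \<beta> \<in> ell B \<Longrightarrow> \<alpha> \<in> ell A \<Longrightarrow> sqrt (w (J \<alpha> \<beta>)) \<le> u \<alpha>"
    using A.rapid_weights_dominating[of "ell B" "\<lambda>\<beta> \<alpha>. sqrt (w (J \<alpha> \<beta>))"] 0 rapid_weights_nonneg[OF w]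
    by (metis empty_iff real_sqrt_ge_zero)
  have "\<exists>K. \<forall>\<alpha>\<in>ell A. \<forall>\<beta>\<in>ell B. sqrt (w (J \<alpha> \<beta>)) * b \<beta> ^ p \<le> K" for p
  proof -
    obtain K where K: "\<forall>\<alpha>\<in>ell A. \<forall>\<beta>\<in>ell B. sqrt (w (J \<alpha> \<beta>)) * (a \<alpha> ^ p * b \<beta> ^ p) \<le> K"
      using bound by blast
    have "sqrt (w (J \<alpha> \<beta>)) * b \<beta> ^ p \<le> sqrt (w (J \<alpha> \<beta>)) * (a \<alpha> ^ p * b \<beta> ^ p)" if "\<alpha> \<in> ell A" "\<beta> \<in> ell B" for \<alpha> \<beta>
      using B.weight_pos[OF that(2)] one_le_power[OF A.weight_ge_1[OF that(1)], of p] rapid_weights_nonneg[OF w]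
      by (intro mult_left_mono) (auto simp: mult_le_cancel_right1)
    then show ?thesis using K by (meson order_trans)
  qed
  then obtain v where v: "v \<in> rapid_weights B b"
    "\<And>\<beta> \<alpha>. \<alpha> \<in> ell A \<Longrightarrow> \<beta> \<in> ell B \<Longrightarrow> sqrt (w (J \<alpha> \<beta>)) \<le> v \<beta>"
    using B.rapid_weights_dominating[of "ell A" "\<lambda>\<alpha> \<beta>. sqrt (w (J \<alpha> \<beta>))"] 0 rapid_weights_nonneg[OF w]
    by (metis empty_iff real_sqrt_ge_zero)
  have "w \<gamma> \<le> product_weight u v \<gamma>" if \<gamma>: "\<gamma> \<in> ell C" for \<gamma>
  proof -
    have parts: "odd_part \<gamma> \<in> ell A" "even_part \<gamma> \<in> ell B" using \<gamma> parts_in_ell by blast+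
    have "J (odd_part \<gamma>) (even_part \<gamma>) = \<gamma>"
      using J[OF parts] \<gamma> parts_inject by blast
    then have "sqrt (w \<gamma>) * sqrt (w \<gamma>) \<le> u (odd_part \<gamma>) * v (even_part \<gamma>)"
      using u(2)[OF parts(2) parts(1)] v(2)[OF parts] rapid_weights_nonneg[OF w] rapid_weights_nonneg[OF u(1)]
      by (intro mult_mono) auto
    then show ?thesis using rapid_weights_nonneg[OF w] by (simp add: product_weight_def)
  qed
  then show ?thesis using that u(1) v(1) by blast
qed

text \<open>For every representation the triangle inequality reduces the claim to elementary
  tensors, whose weighted sums factor; the infimum over representations follows.\<close>

lemma weighted_l1_le_proj_seminorm:
  assumes u: "u \<in> rapid_weights A a" and v: "v \<in> rapid_weights B b" and w: "w \<in> rapid_weights C c"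
    and dom: "\<And>\<gamma>. \<gamma> \<in> ell C \<Longrightarrow> w \<gamma> \<le> product_weight u v \<gamma>"
    and z: "z \<in> tensor_span DA DB T"
  shows "weighted_l1 C w z \<le> proj_seminorm DA DB T (weighted_l1 A u) (weighted_l1 B v) z"
proof (rule proj_seminorm_greatest[OF A.seminorm_on_weighted_l1[OF u] B.seminorm_on_weighted_l1[OF v] z])
  fix n :: nat and x y :: "nat \<Rightarrow> family"
  assume x: "\<And>m. m < n \<Longrightarrow> x m \<in> DA" and y: "\<And>m. m < n \<Longrightarrow> y m \<in> DB"
    and z_eq: "z = (\<lambda>k. \<Sum>m<n. T (x m) (y m) k)"
  show "weighted_l1 C w z \<le> (\<Sum>m<n. weighted_l1 A u (x m) * weighted_l1 B v (y m))"
  proof (rule C.weighted_l1_le[OF _ w])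
    show "z \<in> DC" using z tensor_span_subset by blast
    fix X assume X: "finite X" "X \<subseteq> ell C"
    have summand: "(\<Sum>\<gamma>\<in>X. cmod (T (x m) (y m) \<gamma>) * w \<gamma>) \<le> weighted_l1 A u (x m) * weighted_l1 B v (y m)"
      if m: "m < n" for m
    proof -
      have "(\<Sum>\<gamma>\<in>X. cmod (T (x m) (y m) \<gamma>) * w \<gamma>)
          \<le> (\<Sum>\<gamma>\<in>X. product_weight (\<lambda>\<alpha>. cmod (x m \<alpha>) * u \<alpha>) (\<lambda>\<beta>. cmod (y m \<beta>) * v \<beta>) \<gamma>)"
      proof (rule sum_mono)
        fix \<gamma> assume "\<gamma> \<in> X"
        then have "\<gamma> \<in> ell C" using X by blast
        then show "cmod (T (x m) (y m) \<gamma>) * w \<gamma>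
            \<le> product_weight (\<lambda>\<alpha>. cmod (x m \<alpha>) * u \<alpha>) (\<lambda>\<beta>. cmod (y m \<beta>) * v \<beta>) \<gamma>"
          using mult_left_mono[OF dom, of \<gamma> "cmod (T (x m) (y m) \<gamma>)"]
          by (simp add: tensor_def product_weight_def norm_mult ac_simps)
      qed
      also have "\<dots> \<le> (\<Sum>\<alpha>\<in>odd_part ` X. cmod (x m \<alpha>) * u \<alpha>) * (\<Sum>\<beta>\<in>even_part ` X. cmod (y m \<beta>) * v \<beta>)"
        by (rule sum_product_weight_le[OF X])
           (use rapid_weights_nonneg[OF u] rapid_weights_nonneg[OF v] in auto)
      also have "\<dots> \<le> weighted_l1 A u (x m) * weighted_l1 B v (y m)"
        using X parts_in_ell x[OF m] y[OF m] rapid_weights_nonneg[OF v]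
        by (intro mult_mono A.finite_sum_le_weighted_l1[OF _ u] B.finite_sum_le_weighted_l1[OF _ v] sum_nonneg
            seminorm_on_nonneg[OF A.seminorm_on_weighted_l1[OF u]]) auto
      finally show ?thesis .
    qed
    have "(\<Sum>\<gamma>\<in>X. cmod (z \<gamma>) * w \<gamma>) \<le> (\<Sum>\<gamma>\<in>X. \<Sum>m<n. cmod (T (x m) (y m) \<gamma>) * w \<gamma>)"
      unfolding z_eq sum_distrib_right[symmetric]
      by (intro sum_mono mult_right_mono norm_sum rapid_weights_nonneg[OF w])
    also have "\<dots> = (\<Sum>m<n. \<Sum>\<gamma>\<in>X. cmod (T (x m) (y m) \<gamma>) * w \<gamma>)" by (rule sum.swap)
    also have "\<dots> \<le> (\<Sum>m<n. weighted_l1 A u (x m) * weighted_l1 B v (y m))"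
      by (rule sum_mono) (use summand in auto)
    finally show "(\<Sum>\<gamma>\<in>X. cmod (z \<gamma>) * w \<gamma>) \<le> (\<Sum>m<n. weighted_l1 A u (x m) * weighted_l1 B v (y m))" .
  qed
qed

text \<open>
  For \<open>z = (\<Sum>m. x m \<otimes> y m)\<close>, truncating only the factors \<open>x m\<close> to a finite set \<open>F\<close> leaves
  \<open>\<Sum>\<alpha>\<in>F. \<delta> \<alpha> \<otimes> z (\<alpha>, _)\<close>, whose cost is at most the weighted \<open>l\<^sup>1\<close> norm of \<open>z\<close>, up to an error
  of small projective seminorm.
\<close>

lemma proj_seminorm_le_weighted_l1:
  assumes p: "seminorm_on DA p" and q: "seminorm_on DB q"
    and u: "u \<in> rapid_weights A a" and v: "v \<in> rapid_weights B b"
    and pu: "\<And>f. f \<in> DA \<Longrightarrow> p f \<le> weighted_l1 A u f"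
    and qv: "\<And>g. g \<in> DB \<Longrightarrow> q g \<le> weighted_l1 B v g"
    and z: "z \<in> tensor_span DA DB T"
  shows "proj_seminorm DA DB T p q z \<le> weighted_l1 C (product_weight u v) z"
proof (rule field_le_epsilon)
  fix \<epsilon> :: real assume \<epsilon>: "0 < \<epsilon>"
  obtain n x y where x: "\<And>m. m < (n::nat) \<Longrightarrow> x m \<in> DA" and y: "\<And>m. m < n \<Longrightarrow> y m \<in> DB"
    and z_eq: "z = (\<lambda>k. \<Sum>m<n. T (x m) (y m) k)" using z by (elim tensor_spanE) blast
  have zC: "z \<in> DC" using z tensor_span_subset by blast
  note w = product_weight_rapid[OF u v]
  note nonneg_u = seminorm_on_nonneg[OF A.seminorm_on_weighted_l1[OF u]]
    and nonneg_v = seminorm_on_nonneg[OF B.seminorm_on_weighted_l1[OF v]]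
  \<comment> \<open>Truncation errors get multiplied by the norms of the \<open>y m\<close>; the
    added 1 keeps \<open>L\<close> positive, also for \<open>n = 0\<close>.\<close>
  define L where "L = (\<Sum>m<n. weighted_l1 B v (y m)) + 1"
  have L: "L > 0" unfolding L_def using y nonneg_v by (intro add_nonneg_pos sum_nonneg) auto
  define \<eta> where "\<eta> = \<epsilon> / L"
  have \<eta>: "\<eta> > 0" using \<epsilon> L by (simp add: \<eta>_def)
  have "\<exists>F. finite F \<and> F \<subseteq> ell A \<and>
      (\<forall>G. F \<subseteq> G \<longrightarrow> weighted_l1 A u (\<lambda>\<alpha>. x m \<alpha> - restrict_family G (x m) \<alpha>) \<le> \<eta>)" if "m < n" for m
    using A.weighted_l1_truncation[OF x[OF that] u \<eta>] by metis
  then obtain Fs where Fs: "\<And>m. m < n \<Longrightarrow> finite (Fs m)" "\<And>m. m < n \<Longrightarrow> Fs m \<subseteq> ell A"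
    "\<And>m G. m < n \<Longrightarrow> Fs m \<subseteq> G \<Longrightarrow> weighted_l1 A u (\<lambda>\<alpha>. x m \<alpha> - restrict_family G (x m) \<alpha>) \<le> \<eta>"
    by metis
  define F where "F = (\<Union>m<n. Fs m)"
  have F: "finite F" "F \<subseteq> ell A" unfolding F_def using Fs by auto
  define \<delta> :: "mindex \<Rightarrow> family" where "\<delta> \<alpha> = (\<lambda>\<beta>. if \<beta> = \<alpha> then 1 else 0)" for \<alpha>
  \<comment> \<open>The slice of \<open>z\<close> at the first index \<alpha>, which is the partner
    of the basis vector \<open>\<delta> \<alpha>\<close>.\<close>
  define s :: "mindex \<Rightarrow> family" where "s \<alpha> = (\<lambda>\<beta>. \<Sum>m<n. x m \<alpha> * y m \<beta>)" for \<alpha>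
  define r where "r m = (\<lambda>\<alpha>. x m \<alpha> - restrict_family F (x m) \<alpha>)" for m
  have \<delta>: "\<delta> \<alpha> \<in> DA" if "\<alpha> \<in> F" for \<alpha>
    unfolding \<delta>_def using that F by (intro A.delta_in_dual_space) auto
  have s: "s \<alpha> \<in> DB" for \<alpha>
    unfolding s_def
    by (intro family_subspace_sum[OF B.family_subspace_dual_space]
        family_subspace_scale[OF B.family_subspace_dual_space]) (use y in auto)
  have r: "r m \<in> DA" if "m < n" for m
    unfolding r_def using x[OF that]
    by (intro family_subspace_diff[OF A.family_subspace_dual_space] A.restrict_family_in_dual_space)
  have decomposition: "z \<gamma> = (\<Sum>\<alpha>\<in>F. T (\<delta> \<alpha>) (s \<alpha>) \<gamma>) + (\<Sum>m<n. T (r m) (y m) \<gamma>)" for \<gamma>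
  proof (cases "\<gamma> \<in> ell C")
    case True
    have "(\<Sum>\<alpha>\<in>F. T (\<delta> \<alpha>) (s \<alpha>) \<gamma>) = (\<Sum>\<alpha>\<in>F. if odd_part \<gamma> = \<alpha> then s \<alpha> (even_part \<gamma>) else 0)"
      by (rule sum.cong) (use True in \<open>auto simp: tensor_def \<delta>_def\<close>)
    also have "\<dots> = (if odd_part \<gamma> \<in> F then s (odd_part \<gamma>) (even_part \<gamma>) else 0)"
      using F(1) by (simp add: sum.delta')
    also have "\<dots> = (\<Sum>m<n. restrict_family F (x m) (odd_part \<gamma>) * y m (even_part \<gamma>))"
      by (simp add: restrict_family_def s_def)
    finally show ?thesis
      using True by (simp add: z_eq tensor_def r_def left_diff_distrib sum_subtractf)
  qed (simp add: z_eq tensor_def)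
  have "proj_seminorm DA DB T p q z
      \<le> (\<Sum>i\<in>F <+> {..<n}. p (case_sum \<delta> r i) * q (case_sum s y i))"
    by (rule proj_seminorm_le[OF p q])
       (use F \<delta> s r y in \<open>auto simp: sum.Plus decomposition\<close>)
  also have "\<dots> = (\<Sum>\<alpha>\<in>F. p (\<delta> \<alpha>) * q (s \<alpha>)) + (\<Sum>m<n. p (r m) * q (y m))"
    using F by (simp add: sum.Plus)
  also have "(\<Sum>m<n. p (r m) * q (y m)) \<le> (\<Sum>m<n. \<eta> * weighted_l1 B v (y m))"
  proof (rule sum_mono)
    fix m assume "m \<in> {..<n}"
    then have m: "m < n" by simp
    have "weighted_l1 A u (r m) \<le> \<eta>"
      unfolding r_def using m by (intro Fs(3)) (auto simp: F_def)
    then show "p (r m) * q (y m) \<le> \<eta> * weighted_l1 B v (y m)"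
      using pu[OF r[OF m]] qv[OF y[OF m]] \<eta> seminorm_on_nonneg[OF q y[OF m]] by (intro mult_mono) auto
  qed
  also have "\<dots> \<le> \<epsilon>"
  proof -
    have "(\<Sum>m<n. \<eta> * weighted_l1 B v (y m)) \<le> \<eta> * L"
      unfolding L_def sum_distrib_left[symmetric] using \<eta> by (intro mult_left_mono) auto
    then show ?thesis using L by (simp add: \<eta>_def)
  qed
  also have "(\<Sum>\<alpha>\<in>F. p (\<delta> \<alpha>) * q (s \<alpha>)) \<le> (\<Sum>\<alpha>\<in>F. u \<alpha> * weighted_l1 B v (s \<alpha>))"
  proof (rule sum_mono)
    fix \<alpha> assume \<alpha>: "\<alpha> \<in> F"
    have "weighted_l1 A u (\<delta> \<alpha>) \<le> u \<alpha>"
    proof (rule A.weighted_l1_le[OF \<delta>[OF \<alpha>] u])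
      fix X :: "mindex set" assume "finite X"
      have "(\<Sum>\<beta>\<in>X. cmod (\<delta> \<alpha> \<beta>) * u \<beta>) = (\<Sum>\<beta>\<in>X. if \<beta> = \<alpha> then u \<beta> else 0)"
        by (rule sum.cong) (auto simp: \<delta>_def)
      then show "(\<Sum>\<beta>\<in>X. cmod (\<delta> \<alpha> \<beta>) * u \<beta>) \<le> u \<alpha>"
        using \<open>finite X\<close> rapid_weights_nonneg[OF u] by simp
    qed
    then show "p (\<delta> \<alpha>) * q (s \<alpha>) \<le> u \<alpha> * weighted_l1 B v (s \<alpha>)"
      using pu[OF \<delta>[OF \<alpha>]] qv[OF s] seminorm_on_nonneg[OF q s] rapid_weights_nonneg[OF u]
      by (intro mult_mono) auto
  qed
  also have "(\<Sum>\<alpha>\<in>F. u \<alpha> * weighted_l1 B v (s \<alpha>)) \<le> weighted_l1 C (product_weight u v) z"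
  proof -
    have "(\<Sum>\<alpha>\<in>F. u \<alpha> * weighted_l1 B v (s \<alpha>)) = (\<Sum>\<alpha>\<in>F. \<Sum>\<^sub>\<infinity>\<beta>\<in>ell B. u \<alpha> * (cmod (s \<alpha> \<beta>) * v \<beta>))"
      unfolding weighted_l1_def
      by (rule sum.cong) (auto intro!: infsum_cmult_right[symmetric] B.weighted_l1_summable s v)
    also have "\<dots> = (\<Sum>\<^sub>\<infinity>\<beta>\<in>ell B. \<Sum>\<alpha>\<in>F. u \<alpha> * (cmod (s \<alpha> \<beta>) * v \<beta>))"
      by (intro infsum_sum(2)[OF F(1), symmetric] summable_on_cmult_right B.weighted_l1_summable s v)
    also have "\<dots> \<le> weighted_l1 C (product_weight u v) z"
    proof (rule infsum_le_finite_sums)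
      show "(\<lambda>\<beta>. \<Sum>\<alpha>\<in>F. u \<alpha> * (cmod (s \<alpha> \<beta>) * v \<beta>)) summable_on ell B"
        by (intro infsum_sum(1)[OF F(1)] summable_on_cmult_right B.weighted_l1_summable s v)
      \<comment> \<open>Over the rectangle with sides \<open>F\<close> and \<open>G\<close> the
        slices add up to a partial sum of the norm of \<open>z\<close>.\<close>
      fix G assume G: "finite G" "G \<subseteq> ell B"
      obtain X where X: "finite X" "X \<subseteq> ell C" and rect:
        "\<And>f. (\<Sum>\<gamma>\<in>X. f (odd_part \<gamma>) (even_part \<gamma>)) = (\<Sum>\<alpha>\<in>F. \<Sum>\<beta>\<in>G. f \<alpha> \<beta> :: real)"
        using obtain_joint_rectangle[OF F G] by blast
      have "(\<Sum>\<beta>\<in>G. \<Sum>\<alpha>\<in>F. u \<alpha> * (cmod (s \<alpha> \<beta>) * v \<beta>)) = (\<Sum>\<alpha>\<in>F. \<Sum>\<beta>\<in>G. u \<alpha> * (cmod (s \<alpha> \<beta>) * v \<beta>))"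
        by (rule sum.swap)
      also have "\<dots> = (\<Sum>\<gamma>\<in>X. u (odd_part \<gamma>) * (cmod (s (odd_part \<gamma>) (even_part \<gamma>)) * v (even_part \<gamma>)))"
        by (rule rect[symmetric])
      also have "\<dots> = (\<Sum>\<gamma>\<in>X. cmod (z \<gamma>) * product_weight u v \<gamma>)"
        by (rule sum.cong) (use X(2) in \<open>auto simp: z_eq tensor_def s_def product_weight_def subset_iff\<close>)
      also have "\<dots> \<le> weighted_l1 C (product_weight u v) z"
        by (rule C.finite_sum_le_weighted_l1[OF zC w X])
      finally show "(\<Sum>\<beta>\<in>G. \<Sum>\<alpha>\<in>F. u \<alpha> * (cmod (s \<alpha> \<beta>) * v \<beta>)) \<le> weighted_l1 C (product_weight u v) z" .
    qed
    finally show ?thesis .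
  qed
  finally show "proj_seminorm DA DB T p q z \<le> weighted_l1 C (product_weight u v) z + \<epsilon>" by simp
qed

text \<open>Continuous seminorms are first bounded by weighted l1 norms, so their projective
  seminorm is at most the norm of a product weight. Conversely a weight on pairs is dominated by a
  product weight, whose two factors give a projective seminorm among the generators.\<close>

lemma proj_topology_eq:
  "proj_topology (strong_dual A a) (strong_dual B b) T =
     seminorm_topology (tensor_span DA DB T) (weighted_l1 C ` rapid_weights C c)"
  unfolding proj_topology_def A.topspace_strong_dual B.topspace_strong_dual
proof (rule seminorm_topology_eqI[OF family_subspace_span]; intro ballI)
  fix \<pi> assume "\<pi> \<in> {proj_seminorm DA DB T p q | p q.
    p \<in> continuous_seminorms (strong_dual A a) \<and> q \<in> continuous_seminorms (strong_dual B b)}"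
  then obtain p q where \<pi>: "\<pi> = proj_seminorm DA DB T p q"
    and pc: "p \<in> continuous_seminorms (strong_dual A a)" and qc: "q \<in> continuous_seminorms (strong_dual B b)"
    by blast
  have p: "seminorm_on DA p" and q: "seminorm_on DB q"
    using pc qc unfolding continuous_seminorms_def A.topspace_strong_dual B.topspace_strong_dual by auto
  show "seminorm_on (tensor_span DA DB T) \<pi>"
    unfolding \<pi>
    by (rule seminorm_on_proj_seminorm[OF p q A.family_subspace_dual_space bilinear_families_tensor])
  obtain u where u: "u \<in> rapid_weights A a" "\<And>f. f \<in> DA \<Longrightarrow> p f \<le> weighted_l1 A u f"
    using A.continuous_seminorm_le_weighted_l1[OF pc] by blast
  obtain v where v: "v \<in> rapid_weights B b" "\<And>g. g \<in> DB \<Longrightarrow> q g \<le> weighted_l1 B v g"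
    using B.continuous_seminorm_le_weighted_l1[OF qc] by blast
  show "\<exists>\<rho>\<in>weighted_l1 C ` rapid_weights C c. \<forall>z\<in>tensor_span DA DB T. \<pi> z \<le> \<rho> z"
    unfolding \<pi> using proj_seminorm_le_weighted_l1[OF p q u(1) v(1) u(2) v(2)] product_weight_rapid[OF u(1) v(1)]
    by blast
next
  fix \<rho> assume "\<rho> \<in> weighted_l1 C ` rapid_weights C c"
  then obtain w where w: "w \<in> rapid_weights C c" and \<rho>: "\<rho> = weighted_l1 C w" by blast
  show "seminorm_on (tensor_span DA DB T) \<rho>"
    unfolding \<rho> by (rule seminorm_on_subset[OF C.seminorm_on_weighted_l1[OF w] tensor_span_subset])
  obtain u v where uv: "u \<in> rapid_weights A a" "v \<in> rapid_weights B b"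
    "\<And>\<gamma>. \<gamma> \<in> ell C \<Longrightarrow> w \<gamma> \<le> product_weight u v \<gamma>"
    using rapid_weights_product_dominating[OF w] by blast
  have "\<rho> z \<le> proj_seminorm DA DB T (weighted_l1 A u) (weighted_l1 B v) z" if "z \<in> tensor_span DA DB T" for z
    unfolding \<rho> by (rule weighted_l1_le_proj_seminorm[OF uv(1,2) w uv(3) that])
  then show "\<exists>\<pi>\<in>{proj_seminorm DA DB T p q | p q.
      p \<in> continuous_seminorms (strong_dual A a) \<and> q \<in> continuous_seminorms (strong_dual B b)}.
      \<forall>z\<in>tensor_span DA DB T. \<rho> z \<le> \<pi> z"
    using A.weighted_l1_continuous[OF uv(1)] B.weighted_l1_continuous[OF uv(2)] by blast
qed

section \<open>Density of the algebraic tensor product\<close>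

lemma restrict_family_in_tensor_span:
  assumes F: "finite F" "F \<subseteq> ell C" and f: "f \<in> DC"
  shows "restrict_family F f \<in> tensor_span DA DB T"
proof -
  define x :: "mindex \<Rightarrow> family" where "x \<gamma> = (\<lambda>\<alpha>. f \<gamma> * (if \<alpha> = odd_part \<gamma> then 1 else 0))" for \<gamma>
  define y :: "mindex \<Rightarrow> family" where "y \<gamma> = (\<lambda>\<beta>. if \<beta> = even_part \<gamma> then 1 else 0)" for \<gamma>
  have "(\<lambda>\<delta>. \<Sum>\<gamma>\<in>F. T (x \<gamma>) (y \<gamma>) \<delta>) \<in> tensor_span DA DB T"
  proof (rule tensor_span_sumI[OF F(1)])
    fix \<gamma> assume "\<gamma> \<in> F"
    then have \<gamma>: "odd_part \<gamma> \<in> ell A" "even_part \<gamma> \<in> ell B" using F parts_in_ell by blast+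
    show "x \<gamma> \<in> DA" unfolding x_def
      by (rule family_subspace_scale[OF A.family_subspace_dual_space A.delta_in_dual_space[OF \<gamma>(1)]])
    show "y \<gamma> \<in> DB" unfolding y_def by (rule B.delta_in_dual_space[OF \<gamma>(2)])
  qed
  moreover have "(\<Sum>\<gamma>\<in>F. T (x \<gamma>) (y \<gamma>) \<delta>) = restrict_family F f \<delta>" for \<delta>
  proof (cases "\<delta> \<in> ell C")
    case True
    have "(\<Sum>\<gamma>\<in>F. T (x \<gamma>) (y \<gamma>) \<delta>) = (\<Sum>\<gamma>\<in>F. if \<delta> = \<gamma> then f \<gamma> else 0)"
      by (rule sum.cong) (use True F parts_inject in \<open>auto simp: tensor_def x_def y_def\<close>)
    then show ?thesis using F(1) by (simp add: restrict_family_def)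
  next
    case False
    then show ?thesis using F(2) by (auto simp: tensor_def restrict_family_def)
  qed
  ultimately show ?thesis by simp
qed

text \<open>Truncations to finite sets are finite sums of elementary tensors of basis vectors, and
  they approximate \<open>f\<close> in each weighted norm.\<close>

lemma dense_tensor_span: "strong_dual C c closure_of tensor_span DA DB T = DC"
proof (rule antisym)
  show "strong_dual C c closure_of tensor_span DA DB T \<subseteq> DC"
    using closure_of_subset_topspace[of "strong_dual C c"] by (simp add: C.topspace_strong_dual)
  show "DC \<subseteq> strong_dual C c closure_of tensor_span DA DB T"
  proof
    fix f assume f: "f \<in> DC"
    have "\<exists>g. g \<in> tensor_span DA DB T \<and> g \<in> U" if U: "f \<in> U" "openin (strong_dual C c) U" for U
    proof -
      obtain w \<epsilon> where w: "w \<in> rapid_weights C c" and \<epsilon>: "\<epsilon> > 0"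
        and ball: "{g \<in> DC. weighted_l1 C w (\<lambda>\<alpha>. g \<alpha> - f \<alpha>) < \<epsilon>} \<subseteq> U"
        using U unfolding C.openin_strong_dual by blast
      obtain F where F: "finite F" "F \<subseteq> ell C"
        "\<And>G. F \<subseteq> G \<Longrightarrow> weighted_l1 C w (\<lambda>\<alpha>. f \<alpha> - restrict_family G f \<alpha>) \<le> \<epsilon> / 2"
        using C.weighted_l1_truncation[OF f w, of "\<epsilon> / 2"] \<epsilon> by auto
      have r: "restrict_family F f \<in> DC" by (rule C.restrict_family_in_dual_space[OF f])
      have "weighted_l1 C w (\<lambda>\<alpha>. restrict_family F f \<alpha> - f \<alpha>) \<le> \<epsilon> / 2"
        using F(3)[OF order_refl]
          seminorm_on_minus_commute[OF C.family_subspace_dual_space C.seminorm_on_weighted_l1[OF w] f r] by simp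
      then have "restrict_family F f \<in> U" using ball r \<epsilon> by auto
      then show ?thesis using restrict_family_in_tensor_span[OF F(1,2) f] by blast
    qed
    then show "f \<in> strong_dual C c closure_of tensor_span DA DB T"
      using f by (auto simp: in_closure_of C.topspace_strong_dual)
  qed
qed

lemma completed_tensor_product:
  "is_completed_tensor_product (strong_dual A a) (strong_dual B b) T (strong_dual C c)"
  unfolding is_completed_tensor_product_def
proof (intro conjI exI)
  show "subtopology (strong_dual C c) (tensor_span DA DB T) =
      proj_topology (strong_dual A a) (strong_dual B b) T"
    unfolding proj_topology_eq C.strong_dual_eq
    by (rule subtopology_seminorm_topology[OF C.directed_seminorms_weighted_l1 family_subspace_span tensor_span_subset])
qed (simp_all add: C.locally_convex_strong_dual C.Hausdorff_strong_dual C.complete_strong_dual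
      A.topspace_strong_dual B.topspace_strong_dual C.topspace_strong_dual
      is_tensor_product_tensor tensor_span_subset dense_tensor_span)

end

section \<open>Vage spaces and superexponential weights\<close>

definition superexponential :: "nat set \<Rightarrow> (mindex \<Rightarrow> real) \<Rightarrow> bool" where
  "superexponential A a \<longleftrightarrow> (\<forall>\<alpha>\<in>ell A. \<forall>\<beta>\<in>ell A. a \<alpha> * a \<beta> \<le> a (\<alpha> + \<beta>))"

lemma ell_add: "\<alpha> \<in> ell A \<Longrightarrow> \<beta> \<in> ell A \<Longrightarrow> \<alpha> + \<beta> \<in> ell A"
  using Poly_Mapping.keys_add[of \<alpha> \<beta>] unfolding ell_def by blast

lemma l2_dual_delta:
  assumes "\<alpha> \<in> ell A"
  defines "f \<equiv> (\<lambda>\<beta>. if \<beta> = \<alpha> then 1 else 0)"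
  shows "f \<in> l2_dual A a p" and "dual_norm A a p f = sqrt (1 / a \<alpha> ^ p)"
proof -
  have "((\<lambda>\<beta>. (cmod (f \<beta>))\<^sup>2 / a \<beta> ^ p) has_sum (1 / a \<alpha> ^ p)) (ell A)"
    by (rule has_sum_finite_neutralI[of "{\<alpha>}"]) (use assms in auto)
  then show "f \<in> l2_dual A a p" and "dual_norm A a p f = sqrt (1 / a \<alpha> ^ p)"
    using assms by (auto simp: l2_dual_def dual_norm_def families_def has_sum_imp_summable infsumI)
qed

lemma convolution_delta:
  assumes "\<alpha> \<in> ell A" "\<beta> \<in> ell A"
  shows "convolution A (\<lambda>\<gamma>. if \<gamma> = \<alpha> then 1 else 0) (\<lambda>\<gamma>. if \<gamma> = \<beta> then 1 else 0) =
    (\<lambda>\<gamma>. if \<gamma> = \<alpha> + \<beta> then 1 else 0)"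
proof
  fix \<gamma>
  let ?T = "{(\<alpha>, \<beta>). \<alpha> \<in> ell A \<and> \<beta> \<in> ell A \<and> \<alpha> + \<beta> = \<gamma>}"
  have "convolution A (\<lambda>\<gamma>. if \<gamma> = \<alpha> then 1 else 0) (\<lambda>\<gamma>. if \<gamma> = \<beta> then 1 else 0) \<gamma> =
      (\<Sum>x\<in>?T. if (\<alpha>, \<beta>) = x then 1 else 0)"
    unfolding convolution_def by (rule sum.cong) (auto split: if_splits)
  also have "\<dots> = (if \<gamma> = \<alpha> + \<beta> then 1 else 0)"
    using assms finite_convolution_index[of A \<gamma>] by auto
  finally show "convolution A (\<lambda>\<gamma>. if \<gamma> = \<alpha> then 1 else 0) (\<lambda>\<gamma>. if \<gamma> = \<beta> then 1 else 0) \<gamma> =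
      (if \<gamma> = \<alpha> + \<beta> then 1 else 0)" .
qed

text \<open>
  Applied to basis vectors, the inequality gives
  \<open>(a \<alpha> * a \<beta>) ^ p \<le> (M e)\<^sup>2 * a \<alpha> ^ e * a (\<alpha> + \<beta>) ^ p\<close> for all large \<open>p\<close>.
\<close>

lemma vage_space_superexponential:
  assumes "vage_space A a"
  shows "superexponential A a"
  unfolding superexponential_def
proof (intro ballI, rule ccontr)
  fix \<alpha> \<beta> assume \<alpha>: "\<alpha> \<in> ell A" and \<beta>: "\<beta> \<in> ell A" and neg: "\<not> a \<alpha> * a \<beta> \<le> a (\<alpha> + \<beta>)"
  have pos: "0 < a \<gamma>" if "\<gamma> \<in> ell A" for \<gamma>
    using assms that unfolding vage_space_def admissible_def by blast
  obtain e and M :: "nat \<Rightarrow> real" where M: "\<forall>k\<ge>e. 0 < M k"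
    and conv: "\<forall>q\<ge>1. \<forall>p\<ge>q + e. \<forall>f\<in>l2_dual A a q. \<forall>g\<in>l2_dual A a p.
      convolution A f g \<in> l2_dual A a p \<and>
      dual_norm A a p (convolution A f g) \<le> M (p - q) * dual_norm A a q f * dual_norm A a p g"
    using assms unfolding vage_space_def by (elim conjE exE) rule
  define r where "r = a \<alpha> * a \<beta> / a (\<alpha> + \<beta>)"
  have \<alpha>\<beta>: "\<alpha> + \<beta> \<in> ell A" using \<alpha> \<beta> by (rule ell_add)
  note positive = pos[OF \<alpha>] pos[OF \<beta>] pos[OF \<alpha>\<beta>]
  have r: "1 < r" using neg positive by (simp add: r_def)
  \<comment> \<open>Taking \<open>p = q + e\<close> keeps the constant at \<open>M e\<close> while
    the exponents grow; of \<open>a \<alpha> ^ p / a \<alpha> ^ q\<close> only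
    \<open>a \<alpha> ^ e\<close> remains.\<close>
  have bound: "r ^ (q + e) \<le> (M e)\<^sup>2 * a \<alpha> ^ e" if q: "1 \<le> q" for q
  proof -
    let ?p = "q + e"
    have "sqrt (1 / a (\<alpha> + \<beta>) ^ ?p) \<le> M e * sqrt (1 / a \<alpha> ^ q) * sqrt (1 / a \<beta> ^ ?p)"
      using conv[rule_format, OF q order_refl l2_dual_delta(1)[OF \<alpha>] l2_dual_delta(1)[OF \<beta>], THEN conjunct2]
      by (simp add: convolution_delta \<alpha> \<beta> l2_dual_delta(2) \<alpha>\<beta>)
    then have "(sqrt (1 / a (\<alpha> + \<beta>) ^ ?p))\<^sup>2 \<le> (M e * sqrt (1 / a \<alpha> ^ q) * sqrt (1 / a \<beta> ^ ?p))\<^sup>2"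
      using positive by (intro power_mono) auto
    then have "1 / a (\<alpha> + \<beta>) ^ ?p \<le> (M e)\<^sup>2 * (1 / a \<alpha> ^ q) * (1 / a \<beta> ^ ?p)"
      using positive by (simp add: power_mult_distrib power_divide real_sqrt_divide)
    then have "1 / a (\<alpha> + \<beta>) ^ ?p * (a \<alpha> ^ ?p * a \<beta> ^ ?p)
        \<le> (M e)\<^sup>2 * (1 / a \<alpha> ^ q) * (1 / a \<beta> ^ ?p) * (a \<alpha> ^ ?p * a \<beta> ^ ?p)"
      using positive by (intro mult_right_mono) auto
    then show ?thesis
      using positive by (simp add: r_def power_divide power_mult_distrib power_add field_simps)
  qed
  \<comment> \<open>Powers of \<open>r > 1\<close> are unbounded, whereas the right side is
    independent of \<open>q\<close>. The choice \<open>q = Suc n\<close> meets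
    \<open>q \<ge> 1\<close>.\<close>
  obtain n where n: "(M e)\<^sup>2 * a \<alpha> ^ e < r ^ n" using real_arch_pow[OF r] by blast
  have "r ^ n \<le> r ^ (Suc n + e)" using r by (intro power_increasing) auto
  then show False using bound[of "Suc n"] n by simp
qed

section \<open>From superexponentiality and regularity to Vage's inequality\<close>

locale superexponential_weight =
  fixes A :: "nat set" and a :: "mindex \<Rightarrow> real" and d :: nat
  assumes adm: "admissible A a" and superexp: "superexponential A a"
    and d: "1 \<le> d" and reg: "regular A a d"
begin

lemma pos: "\<alpha> \<in> ell A \<Longrightarrow> 0 < a \<alpha>"
  using adm by (simp add: admissible_def)

lemma unit_gt_1: "n \<in> A \<Longrightarrow> 1 < a (unit_index n)"
  using adm by (simp add: admissible_def)

lemma unit_pos: "n \<in> A \<Longrightarrow> 0 < a (unit_index n)"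
  using unit_gt_1 by force

lemma single_ge:
  assumes "n \<in> A"
  shows "a (unit_index n) ^ k \<le> a (Poly_Mapping.single n k)"
proof (induction k)
  case 0
  then show ?case using adm by (simp add: admissible_def)
next
  case (Suc k)
  have ell: "Poly_Mapping.single n k \<in> ell A" "unit_index n \<in> ell A"
    using assms by (auto simp: ell_def unit_index_def)
  have "a (unit_index n) ^ Suc k \<le> a (unit_index n) * a (Poly_Mapping.single n k)"
    using Suc unit_gt_1[OF assms] by simp
  also have "\<dots> \<le> a (unit_index n + Poly_Mapping.single n k)"
    using superexp ell unfolding superexponential_def by blast
  also have "unit_index n + Poly_Mapping.single n k = Poly_Mapping.single n (Suc k)"
    by (simp add: unit_index_def single_add[symmetric])
  finally show ?case .
qed

text \<open>Superexponentiality iterated over the decomposition of \<alpha> into unit indices.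
  \<open>N\<close> may exceed the support, so that one set can serve a finite collection of
  indices.\<close>

lemma weight_ge_prod:
  assumes "finite N" "N \<subseteq> A" "Poly_Mapping.keys \<alpha> \<subseteq> N"
  shows "(\<Prod>n\<in>N. a (unit_index n) ^ Poly_Mapping.lookup \<alpha> n) \<le> a \<alpha>"
proof -
  \<comment> \<open>The exponents \<open>k\<close> are arbitrary because \<alpha> itself is not
    supported in the smaller sets of the induction; membership in \<open>ell A\<close> is carried
    along for superexponentiality to apply.\<close>
  have "(\<Prod>n\<in>N. a (unit_index n) ^ k n) \<le> a (\<Sum>n\<in>N. Poly_Mapping.single n (k n)) \<and>
      (\<Sum>n\<in>N. Poly_Mapping.single n (k n)) \<in> ell A" for k
    using assms(1,2)
  proof (induction N rule: finite_induct)
    case empty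
    then show ?case using adm by (simp add: admissible_def ell_def)
  next
    case (insert n N)
    let ?s = "\<Sum>n\<in>N. Poly_Mapping.single n (k n)"
    have n: "n \<in> A" "Poly_Mapping.single n (k n) \<in> ell A" using insert by (auto simp: ell_def)
    have IH: "(\<Prod>n\<in>N. a (unit_index n) ^ k n) \<le> a ?s" "?s \<in> ell A" using insert by auto
    have "(\<Prod>n\<in>insert n N. a (unit_index n) ^ k n)
        = a (unit_index n) ^ k n * (\<Prod>n\<in>N. a (unit_index n) ^ k n)" using insert by simp
    also have "\<dots> \<le> a (Poly_Mapping.single n (k n)) * a ?s"
    proof (rule mult_mono[OF single_ge[OF n(1)] IH(1)])
      show "0 \<le> a (Poly_Mapping.single n (k n))" using pos[OF n(2)] by simp
      show "0 \<le> (\<Prod>n\<in>N. a (unit_index n) ^ k n)"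
        using insert unit_pos by (intro prod_nonneg zero_le_power ballI) (auto simp: less_imp_le)
    qed
    also have "\<dots> \<le> a (Poly_Mapping.single n (k n) + ?s)"
      using superexp n(2) IH(2) unfolding superexponential_def by blast
    finally show ?case using insert ell_add[OF n(2) IH(2)] by simp
  qed
  moreover have "(\<Sum>n\<in>N. Poly_Mapping.single n (Poly_Mapping.lookup \<alpha> n)) = \<alpha>"
  proof (rule poly_mapping_eqI)
    fix m
    have "Poly_Mapping.lookup (\<Sum>n\<in>N. Poly_Mapping.single n (Poly_Mapping.lookup \<alpha> n)) m
        = (\<Sum>n\<in>N. if n = m then Poly_Mapping.lookup \<alpha> n else 0)"
      by (simp add: lookup_sum lookup_single when_def)
    also have "\<dots> = Poly_Mapping.lookup \<alpha> m"
      using assms(1,3) by (auto simp: in_keys_iff)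
    finally show "Poly_Mapping.lookup (\<Sum>n\<in>N. Poly_Mapping.single n (Poly_Mapping.lookup \<alpha> n)) m
        = Poly_Mapping.lookup \<alpha> m" .
  qed
  ultimately show ?thesis by metis
qed

lemma weight_ge_1:
  assumes "\<alpha> \<in> ell A"
  shows "1 \<le> a \<alpha>"
proof -
  have keys: "Poly_Mapping.keys \<alpha> \<subseteq> A" using assms by (simp add: ell_def)
  have "1 \<le> (\<Prod>n\<in>Poly_Mapping.keys \<alpha>. a (unit_index n) ^ Poly_Mapping.lookup \<alpha> n)"
    using keys unit_gt_1 by (intro prod_ge_1 one_le_power) (auto simp: less_imp_le)
  also have "\<dots> \<le> a \<alpha>" by (rule weight_ge_prod) (use keys in auto)
  finally show ?thesis .
qed

text \<open>Finite partial sums are bounded by expanding a product of truncated geometric series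
  with ratios \<open>r n\<close>. Each full series equals
  \<open>1 / (1 - r n) = 1 + 1 / (a (unit_index n) ^ d - 1)\<close>, at most the exponential of the
  regularity term.\<close>

lemma weight_summable: "(\<lambda>\<alpha>. 1 / a \<alpha> ^ d) summable_on ell A"
proof (rule nonneg_bdd_above_summable_on)
  show "0 \<le> 1 / a \<alpha> ^ d" if "\<alpha> \<in> ell A" for \<alpha> using pos[OF that] by simp
  let ?S = "\<Sum>\<^sub>\<infinity>n\<in>A. 1 / (a (unit_index n) ^ d - 1)"
  define r where "r n = 1 / a (unit_index n) ^ d" for n
  have unit_pow: "1 < a (unit_index n) ^ d" if "n \<in> A" for n
    using unit_gt_1[OF that] d by (simp add: one_less_power)
  have r: "0 < r n" "r n < 1" if "n \<in> A" for n
    using unit_pow[OF that] by (simp_all add: r_def divide_less_eq)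
  show "bdd_above (sum (\<lambda>\<alpha>. 1 / a \<alpha> ^ d) ` {F. F \<subseteq> ell A \<and> finite F})"
  proof (intro bdd_aboveI[of _ "exp ?S"], clarify)
    fix X assume X: "X \<subseteq> ell A" "finite X"
    define N where "N = (\<Union>\<alpha>\<in>X. Poly_Mapping.keys \<alpha>)"
    have N: "finite N" "N \<subseteq> A" using X by (auto simp: N_def ell_def)
    \<comment> \<open>A crude common bound for all exponents in \<open>X\<close>, which embeds
      \<open>X\<close> into the finite box of functions from \<open>N\<close> to
      \<open>{..m}\<close>.\<close>
    define m where "m = (\<Sum>\<alpha>\<in>X. \<Sum>n\<in>N. Poly_Mapping.lookup \<alpha> n)"
    have m: "Poly_Mapping.lookup \<alpha> n \<le> m" if "\<alpha> \<in> X" "n \<in> N" for \<alpha> n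
    proof -
      have "Poly_Mapping.lookup \<alpha> n \<le> (\<Sum>n\<in>N. Poly_Mapping.lookup \<alpha> n)"
        using that(2) N(1) by (intro member_le_sum) auto
      also have "\<dots> \<le> m" unfolding m_def using that(1) X(2) by (intro member_le_sum) auto
      finally show ?thesis .
    qed
    let ?h = "\<lambda>\<alpha>. restrict (Poly_Mapping.lookup \<alpha>) N"
    have inj: "inj_on ?h X"
    proof (rule inj_onI)
      fix \<alpha> \<beta> assume \<alpha>\<beta>: "\<alpha> \<in> X" "\<beta> \<in> X" "?h \<alpha> = ?h \<beta>"
      show "\<alpha> = \<beta>"
      proof (rule poly_mapping_eqI)
        fix n show "Poly_Mapping.lookup \<alpha> n = Poly_Mapping.lookup \<beta> n"
        proof (cases "n \<in> N")
          case True
          then show ?thesis using fun_cong[OF \<alpha>\<beta>(3), of n] by simp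
        next
          case False
          then show ?thesis using \<alpha>\<beta>(1,2) by (simp add: N_def in_keys_iff)
        qed
      qed
    qed
    have "(\<Sum>\<alpha>\<in>X. 1 / a \<alpha> ^ d) \<le> (\<Sum>\<alpha>\<in>X. \<Prod>n\<in>N. r n ^ ?h \<alpha> n)"
    proof (rule sum_mono)
      fix \<alpha> assume \<alpha>: "\<alpha> \<in> X"
      let ?P = "\<Prod>n\<in>N. a (unit_index n) ^ Poly_Mapping.lookup \<alpha> n"
      have "0 < ?P" using N(2) unit_pos by (intro prod_pos zero_less_power ballI) auto
      moreover have "?P \<le> a \<alpha>" by (rule weight_ge_prod[OF N]) (use \<alpha> in \<open>auto simp: N_def\<close>)
      ultimately have "1 / a \<alpha> ^ d \<le> 1 / ?P ^ d" by (intro divide_left_mono power_mono) auto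
      also have "\<dots> = (\<Prod>n\<in>N. r n ^ ?h \<alpha> n)"
        by (simp add: r_def prod_power_distrib power_divide prod_dividef power_mult[symmetric] mult.commute)
      finally show "1 / a \<alpha> ^ d \<le> (\<Prod>n\<in>N. r n ^ ?h \<alpha> n)" .
    qed
    also have "\<dots> = (\<Sum>g\<in>?h ` X. \<Prod>n\<in>N. r n ^ g n)" using inj by (simp add: sum.reindex)
    also have "\<dots> \<le> (\<Sum>g\<in>PiE N (\<lambda>_. {..m}). \<Prod>n\<in>N. r n ^ g n)"
    proof (rule sum_mono2)
      show "finite (PiE N (\<lambda>_. {..m}))" using N(1) by (intro finite_PiE) auto
      show "?h ` X \<subseteq> PiE N (\<lambda>_. {..m})" using m by auto
      show "0 \<le> (\<Prod>n\<in>N. r n ^ g n)" for g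
        using N(2) r(1) by (intro prod_nonneg) (auto simp: less_imp_le subset_iff)
    qed
    also have "\<dots> = (\<Prod>n\<in>N. \<Sum>k\<le>m. r n ^ k)"
      by (rule prod_sum_PiE[symmetric]) (use N(1) in auto)
    also have "\<dots> \<le> (\<Prod>n\<in>N. exp (1 / (a (unit_index n) ^ d - 1)))"
    proof (rule prod_mono, intro conjI)
      fix n assume "n \<in> N"
      then have n: "n \<in> A" using N by blast
      show "0 \<le> (\<Sum>k\<le>m. r n ^ k)" using r(1)[OF n] by (intro sum_nonneg) auto
      have "(\<Sum>k\<le>m. r n ^ k) = (1 - r n ^ Suc m) / (1 - r n)"
        using r[OF n] by (simp add: sum_gp0)
      also have "\<dots> \<le> 1 / (1 - r n)" using r[OF n] by (intro divide_right_mono) auto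
      also have "\<dots> = 1 + 1 / (a (unit_index n) ^ d - 1)"
        using unit_pow[OF n] unit_pos[OF n] by (simp add: r_def field_simps)
      also have "\<dots> \<le> exp (1 / (a (unit_index n) ^ d - 1))" by (rule exp_ge_add_one_self)
      finally show "(\<Sum>k\<le>m. r n ^ k) \<le> exp (1 / (a (unit_index n) ^ d - 1))" .
    qed
    also have "\<dots> = exp (\<Sum>n\<in>N. 1 / (a (unit_index n) ^ d - 1))" using N(1) by (simp add: exp_sum)
    also have "\<dots> \<le> exp ?S"
      using finite_sum_le_infsum[OF reg[unfolded regular_def] N] unit_pow by (simp add: less_imp_le)
    finally show "(\<Sum>\<alpha>\<in>X. 1 / a \<alpha> ^ d) \<le> exp ?S" .
  qed
qed

sublocale nuclear_weight A a d
  by unfold_locales (rule weight_ge_1 weight_summable, assumption?)+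

lemma weight_power_summable:
  assumes "d \<le> k"
  shows "(\<lambda>\<alpha>. 1 / a \<alpha> ^ k) summable_on ell A"
proof (rule summable_on_comparison_test[OF weight_summable])
  fix \<alpha> assume \<alpha>: "\<alpha> \<in> ell A"
  show "1 / a \<alpha> ^ k \<le> 1 / a \<alpha> ^ d"
    using weight_ge_1[OF \<alpha>] pos[OF \<alpha>] assms by (intro divide_left_mono power_increasing) auto
  show "0 \<le> 1 / a \<alpha> ^ k" using pos[OF \<alpha>] by simp
qed

text \<open>
  Young's inequality for \<open>l\<^sup>1 * l\<^sup>2\<close>, applied to \<open>\<bar>f\<bar> / sqrt (a ^ p)\<close> and \<open>\<bar>g\<bar> / sqrt (a ^ p)\<close>.
\<close>

lemma convolution_bound:
  assumes p: "q + d \<le> p" and f: "f \<in> l2_dual A a q" and g: "g \<in> l2_dual A a p"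
  shows "convolution A f g \<in> l2_dual A a p"
    and "dual_norm A a p (convolution A f g)
      \<le> sqrt (\<Sum>\<^sub>\<infinity>\<alpha>\<in>ell A. 1 / a \<alpha> ^ (p - q)) * dual_norm A a q f * dual_norm A a p g"
proof -
  define F where "F \<alpha> = cmod (f \<alpha>) / sqrt (a \<alpha> ^ p)" for \<alpha>
  define G where "G \<alpha> = cmod (g \<alpha>) / sqrt (a \<alpha> ^ p)" for \<alpha>
  define S where "S = (\<Sum>\<^sub>\<infinity>\<alpha>\<in>ell A. 1 / a \<alpha> ^ (p - q))"
  define f2 where "f2 = (\<Sum>\<^sub>\<infinity>\<alpha>\<in>ell A. (cmod (f \<alpha>))\<^sup>2 / a \<alpha> ^ q)"
  define g2 where "g2 = (\<Sum>\<^sub>\<infinity>\<alpha>\<in>ell A. (cmod (g \<alpha>))\<^sup>2 / a \<alpha> ^ p)"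
  define T where "T \<gamma> = {(\<alpha>, \<beta>). \<alpha> \<in> ell A \<and> \<beta> \<in> ell A \<and> \<alpha> + \<beta> = \<gamma>}" for \<gamma>
  have finT: "finite (T \<gamma>)" for \<gamma> unfolding T_def by (rule finite_convolution_index)
  have nonneg: "0 \<le> F \<alpha>" "0 \<le> G \<alpha>" if "\<alpha> \<in> ell A" for \<alpha>
    using pos[OF that] by (simp_all add: F_def G_def)
  have S0: "0 \<le> S" and f20: "0 \<le> f2" and g20: "0 \<le> g2"
    unfolding S_def f2_def g2_def by (intro infsum_nonneg; use pos in \<open>simp add: less_imp_le\<close>)+
  define N where "N = sqrt (f2 * S)"
  have N0: "0 \<le> N" using S0 f20 by (simp add: N_def)
  \<comment> \<open>\<open>a ^ p\<close> is split into \<open>a ^ q\<close> and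
    \<open>a ^ (p - q)\<close>; Cauchy-Schwarz leaves the sum of \<open>1 / a ^ (p - q)\<close>,
    finite because \<open>p - q \<ge> d\<close>.\<close>
  have F_sum: "(\<Sum>\<alpha>\<in>X. F \<alpha>) \<le> N" if X: "finite X" "X \<subseteq> ell A" for X
    unfolding N_def
  proof (rule real_le_rsqrt)
    have "F \<alpha> = (cmod (f \<alpha>) / sqrt (a \<alpha> ^ q)) * (1 / sqrt (a \<alpha> ^ (p - q)))" for \<alpha>
      using p by (simp add: F_def real_sqrt_mult[symmetric] power_add[symmetric])
    then have "(\<Sum>\<alpha>\<in>X. F \<alpha>)\<^sup>2 \<le> (\<Sum>\<alpha>\<in>X. (cmod (f \<alpha>) / sqrt (a \<alpha> ^ q))\<^sup>2) * (\<Sum>\<alpha>\<in>X. (1 / sqrt (a \<alpha> ^ (p - q)))\<^sup>2)"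
      using Cauchy_Schwarz_ineq_sum[of "\<lambda>\<alpha>. cmod (f \<alpha>) / sqrt (a \<alpha> ^ q)" "\<lambda>\<alpha>. 1 / sqrt (a \<alpha> ^ (p - q))" X]
      by presburger
    also have "\<dots> = (\<Sum>\<alpha>\<in>X. (cmod (f \<alpha>))\<^sup>2 / a \<alpha> ^ q) * (\<Sum>\<alpha>\<in>X. 1 / a \<alpha> ^ (p - q))"
      using X(2) pos by (intro arg_cong2[of _ _ _ _ "(*)"] sum.cong) (auto simp: power_divide subset_iff less_imp_le)
    also have "\<dots> \<le> f2 * S"
    proof (rule mult_mono)
      show "(\<Sum>\<alpha>\<in>X. (cmod (f \<alpha>))\<^sup>2 / a \<alpha> ^ q) \<le> f2"
        unfolding f2_def using f X pos
        by (intro finite_sum_le_infsum) (auto simp: l2_dual_def less_imp_le)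
      show "(\<Sum>\<alpha>\<in>X. 1 / a \<alpha> ^ (p - q)) \<le> S"
        unfolding S_def using p X pos
        by (intro finite_sum_le_infsum weight_power_summable) (auto simp: less_imp_le)
      show "0 \<le> (\<Sum>\<alpha>\<in>X. 1 / a \<alpha> ^ (p - q))"
        using X(2) pos by (intro sum_nonneg) (auto simp: subset_iff less_imp_le)
    qed (rule f20)
    finally show "(\<Sum>\<alpha>\<in>X. F \<alpha>)\<^sup>2 \<le> f2 * S" .
  qed
  have G_sum: "(\<Sum>\<alpha>\<in>X. (G \<alpha>)\<^sup>2) \<le> g2" if X: "finite X" "X \<subseteq> ell A" for X
  proof -
    have "(\<Sum>\<alpha>\<in>X. (G \<alpha>)\<^sup>2) = (\<Sum>\<alpha>\<in>X. (cmod (g \<alpha>))\<^sup>2 / a \<alpha> ^ p)"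
      using X(2) pos by (intro sum.cong) (auto simp: G_def power_divide subset_iff less_imp_le)
    also have "\<dots> \<le> g2"
      unfolding g2_def using g X pos
      by (intro finite_sum_le_infsum) (auto simp: l2_dual_def less_imp_le)
    finally show ?thesis .
  qed
  \<comment> \<open>Superexponentiality replaces \<open>a \<gamma> ^ p\<close> by the product of the
    powers at both summands. Cauchy-Schwarz with respect to the weight \<open>F\<close> then gives
    the l1 bound for \<open>F\<close> times the convolution of \<open>F\<close> with the square of
    \<open>G\<close>.\<close>
  have pointwise: "(cmod (convolution A f g \<gamma>))\<^sup>2 / a \<gamma> ^ p \<le> N * (\<Sum>(\<alpha>, \<beta>)\<in>T \<gamma>. F \<alpha> * (G \<beta>)\<^sup>2)"
    if \<gamma>: "\<gamma> \<in> ell A" for \<gamma>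
  proof -
    have "cmod (convolution A f g \<gamma>) / sqrt (a \<gamma> ^ p) \<le> (\<Sum>x\<in>T \<gamma>. cmod (f (fst x)) * cmod (g (snd x))) / sqrt (a \<gamma> ^ p)"
      unfolding convolution_def T_def[symmetric]
      by (intro divide_right_mono order_trans[OF norm_sum]) (use pos[OF \<gamma>] in \<open>auto simp: norm_mult case_prod_beta\<close>)
    also have "\<dots> = (\<Sum>x\<in>T \<gamma>. cmod (f (fst x)) * cmod (g (snd x)) / sqrt (a \<gamma> ^ p))"
      by (rule sum_divide_distrib)
    also have "\<dots> \<le> (\<Sum>x\<in>T \<gamma>. F (fst x) * G (snd x))"
    proof (rule sum_mono)
      fix x assume x: "x \<in> T \<gamma>"
      then have ell: "fst x \<in> ell A" "snd x \<in> ell A" and \<gamma>_eq: "fst x + snd x = \<gamma>" by (auto simp: T_def)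
      note px = pos[OF ell(1)] pos[OF ell(2)]
      have "a (fst x) * a (snd x) \<le> a \<gamma>"
        using superexp ell \<gamma>_eq unfolding superexponential_def by blast
      then have "a (fst x) ^ p * a (snd x) ^ p \<le> a \<gamma> ^ p"
        unfolding power_mult_distrib[symmetric] using px by (intro power_mono) auto
      then have "sqrt (a (fst x) ^ p) * sqrt (a (snd x) ^ p) \<le> sqrt (a \<gamma> ^ p)"
        by (simp add: real_sqrt_mult[symmetric])
      then have "cmod (f (fst x)) * cmod (g (snd x)) / sqrt (a \<gamma> ^ p)
          \<le> cmod (f (fst x)) * cmod (g (snd x)) / (sqrt (a (fst x) ^ p) * sqrt (a (snd x) ^ p))"
        using px pos[OF \<gamma>] by (intro divide_left_mono) auto
      then show "cmod (f (fst x)) * cmod (g (snd x)) / sqrt (a \<gamma> ^ p) \<le> F (fst x) * G (snd x)"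
        by (simp add: F_def G_def)
    qed
    finally have "(cmod (convolution A f g \<gamma>) / sqrt (a \<gamma> ^ p))\<^sup>2 \<le> (\<Sum>x\<in>T \<gamma>. F (fst x) * G (snd x))\<^sup>2"
      using pos[OF \<gamma>] by (intro power_mono) auto
    also have "(\<Sum>x\<in>T \<gamma>. F (fst x) * G (snd x)) = (\<Sum>x\<in>T \<gamma>. sqrt (F (fst x)) * (sqrt (F (fst x)) * G (snd x)))"
      by (rule sum.cong) (use nonneg in \<open>auto simp: T_def mult.assoc[symmetric]\<close>)
    also have "(\<dots>)\<^sup>2 \<le> (\<Sum>x\<in>T \<gamma>. (sqrt (F (fst x)))\<^sup>2) * (\<Sum>x\<in>T \<gamma>. (sqrt (F (fst x)) * G (snd x))\<^sup>2)"
      by (rule Cauchy_Schwarz_ineq_sum)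
    also have "(\<Sum>x\<in>T \<gamma>. (sqrt (F (fst x)))\<^sup>2) = (\<Sum>x\<in>T \<gamma>. F (fst x))"
      by (rule sum.cong) (use nonneg in \<open>auto simp: T_def\<close>)
    also have "(\<Sum>x\<in>T \<gamma>. (sqrt (F (fst x)) * G (snd x))\<^sup>2) = (\<Sum>(\<alpha>, \<beta>)\<in>T \<gamma>. F \<alpha> * (G \<beta>)\<^sup>2)"
      by (rule sum.cong) (use nonneg in \<open>auto simp: T_def power_mult_distrib\<close>)
    \<comment> \<open>By cancellation the first component determines the pair, so \<open>F\<close>
      is summed over distinct indices.\<close>
    also have "(\<Sum>x\<in>T \<gamma>. F (fst x)) = (\<Sum>\<alpha>\<in>fst ` T \<gamma>. F \<alpha>)"
      by (subst sum.reindex) (auto simp: T_def inj_on_def)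
    also have "(\<Sum>\<alpha>\<in>fst ` T \<gamma>. F \<alpha>) * (\<Sum>(\<alpha>, \<beta>)\<in>T \<gamma>. F \<alpha> * (G \<beta>)\<^sup>2) \<le> N * (\<Sum>(\<alpha>, \<beta>)\<in>T \<gamma>. F \<alpha> * (G \<beta>)\<^sup>2)"
      by (intro mult_right_mono F_sum sum_nonneg finite_imageI finT) (use nonneg in \<open>auto simp: T_def\<close>)
    finally show ?thesis using pos[OF \<gamma>] by (simp add: power_divide)
  qed
  have total: "(\<Sum>\<gamma>\<in>X. (cmod (convolution A f g \<gamma>))\<^sup>2 / a \<gamma> ^ p) \<le> S * f2 * g2"
    if X: "finite X" "X \<subseteq> ell A" for X
  proof -
    define U where "U = (\<Union>\<gamma>\<in>X. T \<gamma>)"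
    have U: "finite U" "fst ` U \<subseteq> ell A" "snd ` U \<subseteq> ell A"
      unfolding U_def using X finT by (auto simp: T_def)
    have "(\<Sum>\<gamma>\<in>X. (cmod (convolution A f g \<gamma>))\<^sup>2 / a \<gamma> ^ p)
        \<le> (\<Sum>\<gamma>\<in>X. N * (\<Sum>(\<alpha>, \<beta>)\<in>T \<gamma>. F \<alpha> * (G \<beta>)\<^sup>2))"
      using X(2) by (intro sum_mono pointwise) auto
    \<comment> \<open>The sets \<open>T \<gamma>\<close> are disjoint, since \<gamma> is the sum of
      the two components.\<close>
    also have "\<dots> = N * (\<Sum>(\<alpha>, \<beta>)\<in>U. F \<alpha> * (G \<beta>)\<^sup>2)"
      unfolding U_def sum_distrib_left[symmetric] using X(1) finT
      by (subst sum.UNION_disjoint) (auto simp: T_def)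
    also have "\<dots> \<le> N * (\<Sum>(\<alpha>, \<beta>)\<in>fst ` U \<times> snd ` U. F \<alpha> * (G \<beta>)\<^sup>2)"
    proof (intro mult_left_mono N0 sum_mono2)
      show "finite (fst ` U \<times> snd ` U)" using U(1) by simp
      show "U \<subseteq> fst ` U \<times> snd ` U" by (rule subset_fst_snd)
      fix x assume "x \<in> fst ` U \<times> snd ` U - U"
      then have "fst x \<in> ell A" "snd x \<in> ell A" using U(2,3) by auto
      then show "0 \<le> (case x of (\<alpha>, \<beta>) \<Rightarrow> F \<alpha> * (G \<beta>)\<^sup>2)" using nonneg by (simp add: case_prod_beta)
    qed
    also have "(\<Sum>(\<alpha>, \<beta>)\<in>fst ` U \<times> snd ` U. F \<alpha> * (G \<beta>)\<^sup>2) = (\<Sum>\<alpha>\<in>fst ` U. F \<alpha>) * (\<Sum>\<beta>\<in>snd ` U. (G \<beta>)\<^sup>2)"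
      by (simp add: sum_product sum.cartesian_product)
    also have "N * \<dots> \<le> N * (N * g2)"
    proof (rule mult_left_mono[OF mult_mono N0])
      show "(\<Sum>\<alpha>\<in>fst ` U. F \<alpha>) \<le> N" using U by (intro F_sum) auto
      show "(\<Sum>\<beta>\<in>snd ` U. (G \<beta>)\<^sup>2) \<le> g2" using U by (intro G_sum) auto
    qed (use N0 in \<open>auto intro: sum_nonneg\<close>)
    also have "\<dots> = (N * N) * g2" by simp
    also have "N * N = S * f2" using S0 f20 by (simp add: N_def)
    finally show ?thesis .
  qed
  have summable: "(\<lambda>\<gamma>. (cmod (convolution A f g \<gamma>))\<^sup>2 / a \<gamma> ^ p) summable_on ell A"
  proof (rule nonneg_bdd_above_summable_on)
    show "bdd_above (sum (\<lambda>\<gamma>. (cmod (convolution A f g \<gamma>))\<^sup>2 / a \<gamma> ^ p) ` {F. F \<subseteq> ell A \<and> finite F})"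
      by (rule bdd_aboveI[of _ "S * f2 * g2"]) (use total in blast)
  qed (use pos in \<open>simp add: less_imp_le\<close>)
  have "convolution A f g \<gamma> = 0" if "\<gamma> \<notin> ell A" for \<gamma>
    unfolding convolution_def by (rule sum.neutral) (use that ell_add in blast)
  then show "convolution A f g \<in> l2_dual A a p"
    using summable by (simp add: l2_dual_def families_def)
  have "dual_norm A a p (convolution A f g) \<le> sqrt (S * f2 * g2)"
    unfolding dual_norm_def by (intro real_sqrt_le_mono infsum_le_finite_sums summable total)
  then show "dual_norm A a p (convolution A f g)
      \<le> sqrt (\<Sum>\<^sub>\<infinity>\<alpha>\<in>ell A. 1 / a \<alpha> ^ (p - q)) * dual_norm A a q f * dual_norm A a p g"
    by (simp add: real_sqrt_mult dual_norm_def S_def f2_def g2_def)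
qed

text \<open>The gap is the regularity exponent \<open>d\<close>, and the constants are those of
  Young's inequality; they are positive because the index 0 contributes 1.\<close>

lemma vage_space: "vage_space A a"
  unfolding vage_space_def
proof (intro conjI exI[of _ d] exI[of _ "\<lambda>k. sqrt (\<Sum>\<^sub>\<infinity>\<alpha>\<in>ell A. 1 / a \<alpha> ^ k)"] allI impI ballI adm d reg)
  fix k assume k: "d \<le> k"
  have "(\<Sum>\<alpha>\<in>{0}. 1 / a \<alpha> ^ k) \<le> (\<Sum>\<^sub>\<infinity>\<alpha>\<in>ell A. 1 / a \<alpha> ^ k)"
    by (rule finite_sum_le_infsum[OF weight_power_summable[OF k]])
       (use pos in \<open>auto simp: ell_def less_imp_le\<close>)
  moreover have "a 0 = 1" using adm by (simp add: admissible_def)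
  ultimately show "0 < sqrt (\<Sum>\<^sub>\<infinity>\<alpha>\<in>ell A. 1 / a \<alpha> ^ k)" by simp
qed (use convolution_bound in blast)+

end

section \<open>Passage to the product weight\<close>

lemma regular_mono:
  assumes "admissible A a" "regular A a d" "1 \<le> d" "d \<le> d'"
  shows "regular A a d'"
  unfolding regular_def
proof (rule summable_on_comparison_test[OF assms(2)[unfolded regular_def]])
  fix n assume n: "n \<in> A"
  have "1 < a (unit_index n)" using assms(1) n by (simp add: admissible_def)
  then have "1 < a (unit_index n) ^ d" "a (unit_index n) ^ d \<le> a (unit_index n) ^ d'"
    using assms(3,4) by (auto intro: one_less_power power_increasing)
  then show "1 / (a (unit_index n) ^ d' - 1) \<le> 1 / (a (unit_index n) ^ d - 1)"
    and "0 \<le> 1 / (a (unit_index n) ^ d' - 1)"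
    by (auto intro!: divide_left_mono mult_pos_pos)
qed

context index_pair
begin

lemma odd_part_add: "odd_part (\<gamma> + \<delta>) = odd_part \<gamma> + odd_part \<delta>"
  by (rule poly_mapping_eqI) (simp add: lookup_odd_part lookup_add)

lemma even_part_add: "even_part (\<gamma> + \<delta>) = even_part \<gamma> + even_part \<delta>"
  by (rule poly_mapping_eqI) (simp add: lookup_even_part lookup_add)

lemma odd_part_0: "odd_part 0 = 0" and even_part_0: "even_part 0 = 0"
  by (rule poly_mapping_eqI, simp add: lookup_odd_part lookup_even_part)+

lemma parts_unit_odd:
  assumes "n \<in> A"
  shows "odd_part (unit_index (2 * n - 1)) = unit_index n" "even_part (unit_index (2 * n - 1)) = 0"
proof -
  have n: "1 \<le> n" using assms index_pos by auto
  have "2 * n - 1 = 2 * m - 1 \<longleftrightarrow> n = m" "2 * n - 1 \<noteq> 2 * m" for m using n by presburger+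
  then show "odd_part (unit_index (2 * n - 1)) = unit_index n" "even_part (unit_index (2 * n - 1)) = 0"
    by (intro poly_mapping_eqI; simp add: lookup_odd_part lookup_even_part unit_index_def lookup_single when_def)+
qed

lemma parts_unit_even:
  assumes "n \<in> B"
  shows "odd_part (unit_index (2 * n)) = 0" "even_part (unit_index (2 * n)) = unit_index n"
proof -
  have n: "1 \<le> n" using assms index_pos by auto
  have "2 * n \<noteq> 2 * m - 1" for m using n by presburger
  then show "odd_part (unit_index (2 * n)) = 0" "even_part (unit_index (2 * n)) = unit_index n"
    by (intro poly_mapping_eqI; simp add: lookup_odd_part lookup_even_part unit_index_def lookup_single when_def)+
qed

text \<open>At a unit index one of the two parts is 0, where its weight is 1, so the product takes
  there a unit value of \<open>a\<close> or of \<open>b\<close>.\<close>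

lemma admissible_product_weight:
  assumes a: "admissible A a" and b: "admissible B b"
  shows "admissible C (product_weight a b)"
  unfolding admissible_def
proof (intro conjI ballI)
  have 0: "a 0 = 1" "b 0 = 1" using a b by (simp_all add: admissible_def)
  show "0 < product_weight a b \<gamma>" if "\<gamma> \<in> ell C" for \<gamma>
    using a b parts_in_ell[OF that] by (simp add: admissible_def product_weight_def)
  show "product_weight a b 0 = 1" by (simp add: product_weight_def odd_part_0 even_part_0 0)
  show "1 < product_weight a b (unit_index n)" if "n \<in> C" for n
    using that a b 0 unfolding joint_index_def
    by (auto simp: product_weight_def parts_unit_even parts_unit_odd[unfolded One_nat_def] parts_unit_odd admissible_def)
qed

lemma superexponential_product_weight:
  assumes a: "admissible A a" "superexponential A a" and b: "admissible B b" "superexponential B b"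
  shows "superexponential C (product_weight a b)"
  unfolding superexponential_def
proof (intro ballI)
  fix \<gamma> \<delta> assume \<gamma>: "\<gamma> \<in> ell C" and \<delta>: "\<delta> \<in> ell C"
  note parts = parts_in_ell[OF \<gamma>] parts_in_ell[OF \<delta>]
  have pos: "0 < a \<alpha>" if "\<alpha> \<in> ell A" for \<alpha> using a that by (simp add: admissible_def)
  have pos': "0 < b \<beta>" if "\<beta> \<in> ell B" for \<beta> using b that by (simp add: admissible_def)
  have "(a (odd_part \<gamma>) * a (odd_part \<delta>)) * (b (even_part \<gamma>) * b (even_part \<delta>))
      \<le> a (odd_part \<gamma> + odd_part \<delta>) * b (even_part \<gamma> + even_part \<delta>)"
    using a(2) b(2) parts pos pos' unfolding superexponential_def
    by (intro mult_mono) (auto simp: less_imp_le ell_add)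
  then show "product_weight a b \<gamma> * product_weight a b \<delta> \<le> product_weight a b (\<gamma> + \<delta>)"
    by (simp add: product_weight_def odd_part_add even_part_add ac_simps)
qed

text \<open>For the same reason the regularity sum over \<open>C\<close> splits into the sums over
  the even positions, from \<open>B\<close>, and the odd ones, from \<open>A\<close>.\<close>

lemma regular_product_weight:
  assumes "admissible A a" "admissible B b" "regular A a d" "regular B b d"
  shows "regular C (product_weight a b) d"
  unfolding regular_def joint_index_def
proof (rule summable_on_union)
  have 0: "a 0 = 1" "b 0 = 1" using assms by (simp_all add: admissible_def)
  have "(\<lambda>n. 1 / (product_weight a b (unit_index (2 * n)) ^ d - 1)) summable_on B"
    using assms(4) unfolding regular_def
    by (rule summable_on_cong[THEN iffD1, rotated]) (simp add: product_weight_def parts_unit_even 0)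
  then show "(\<lambda>n. 1 / (product_weight a b (unit_index n) ^ d - 1)) summable_on (\<lambda>n. 2 * n) ` B"
    by (subst summable_on_reindex) (auto simp: inj_on_def o_def)
  have "(\<lambda>n. 1 / (product_weight a b (unit_index (2 * n - 1)) ^ d - 1)) summable_on A"
    using assms(3) unfolding regular_def
    by (rule summable_on_cong[THEN iffD1, rotated]) (simp add: product_weight_def parts_unit_odd[unfolded One_nat_def] 0)
  moreover have "inj_on (\<lambda>n. 2 * n - 1) A" by (auto simp: inj_on_def)
  ultimately show "(\<lambda>n. 1 / (product_weight a b (unit_index n) ^ d - 1)) summable_on (\<lambda>n. 2 * n - 1) ` A"
    by (subst summable_on_reindex) (simp_all add: o_def)
qed

end

theorem theorem5p7:
  fixes A B :: "nat set" and a b :: "(nat \<Rightarrow>\<^sub>0 nat) \<Rightarrow> real"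
  assumes "A \<subseteq> {1..}" and "B \<subseteq> {1..}"
    and "vage_space A a" and "vage_space B b"
  shows "\<exists>c :: (nat \<Rightarrow>\<^sub>0 nat) \<Rightarrow> real.
           vage_space (joint_index A B) c \<and>
           is_completed_tensor_product (strong_dual A a) (strong_dual B b) (tensor A B)
             (strong_dual (joint_index A B) c)"
proof -
  interpret index_pair A B by unfold_locales (use assms in auto)
  obtain d1 where a: "admissible A a" "1 \<le> d1" "regular A a d1"
    using assms(3) unfolding vage_space_def by blast
  obtain d2 where b: "admissible B b" "1 \<le> d2" "regular B b d2"
    using assms(4) unfolding vage_space_def by blast
  \<comment> \<open>The product is treated with one exponent for both weights; raising the exponent
    preserves regularity.\<close>
  define d where "d = max d1 d2"
  have d: "1 \<le> d" "d1 \<le> d" "d2 \<le> d" using a(2) by (auto simp: d_def)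
  have reg: "regular A a d" "regular B b d"
    using regular_mono[OF a(1,3,2) d(2)] regular_mono[OF b(1,3,2) d(3)] by auto
  note sa = vage_space_superexponential[OF assms(3)] and sb = vage_space_superexponential[OF assms(4)]
  interpret A: superexponential_weight A a d by unfold_locales (fact a(1) sa d(1) reg(1))+
  interpret B: superexponential_weight B b d by unfold_locales (fact b(1) sb d(1) reg(2))+
  interpret C: superexponential_weight "joint_index A B" "product_weight a b" d
    by unfold_locales
      (fact admissible_product_weight[OF a(1) b(1)]
        superexponential_product_weight[OF a(1) sa b(1) sb] d(1)
        regular_product_weight[OF a(1) b(1) reg])+
  \<comment> \<open>This yields the topological statement, while \<open>C\<close> yields Vage's
    inequality for the same weight.\<close>
  interpret pair: nuclear_weight_pair A B a b d d by unfold_locales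
  show ?thesis using C.vage_space pair.completed_tensor_product by blast
qed

end
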